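(* Let $r$ be a rank array that can occur. Every minimal length lacing diagram for $r$ occurs as the lacing diagram derived from a reduced pipe dream for the Zelevinsky permutation $v(r)$; precisely, $$W(r)=W_{\mathcal{RP}}(r):=\{\mathbf w(D): D\in\mathcal{RP}(v(r))\}.$$
   Context: Rank arrays. Let $k$ be a field, $n\ge1$, $r_0,\dots,r_n$ nonnegative integers, $d=r_0+\cdots+r_n$, $\mathit{Hom}=\prod_{i=1}^nM_{r_{i-1}\times r_i}(k)$. The rank array of $\phi\in\mathit{Hom}$ is $r_{ij}(\phi)=\operatorname{rank}(\phi_{i+1}\cdots\phi_j)$ for $i<j$, $r_{ii}(\phi)=r_i$. A rank array can occur if it is $r(\phi)$ for some $\phi\in\mathit{Hom}$. Zelevinsky permutation. Put $s_{ij}=r_{ij}-r_{i-1,j}-r_{i,j+1}+r_{i-1,j+1}$ for $0\le i\le j\le n$, where $r_{ab}=0$ unless $0\le a,b\le n$. Divide the $d\times d$ grid into block rows $0,\dots,n$ from top to bottom of heights $r_0,\dots,r_n$ and block columns labelled $n,\dots,0$ from left to right, block column $i$ having width $r_i$. The matrix of a permutation $v$ has its $1$'s at $(q,v(q))$. $v(r)\in S_d$ is the unique permutation such that the block in block column $i$ and block row $j$ contains exactly $s_{ij}$ ones if $i\le j$, $r_{j,j+1}$ ones if $i=j+1$, none if $i\ge j+2$, and such that within every block row and block column the $1$'s proceed from northwest to southeast. Pipe dreams. A pipe dream $D$ is a subset of the boxes $(q,p)$ (row $q$, column $p$) of the $d\times d$ grid, all with $q+p\le d$. Boxes in $D$ carry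 a crossing tile and all others an elbow tile (the pipe entering from the west turns north, the pipe entering from the south turns east). $D$ is reduced if every two pipes cross at most once. $\mathcal{RP}(v)$ is the set of reduced pipe dreams in which the pipe entering row $q$ from the west exits at the top of column $v(q)$, for all $q\le d$. The lacing diagram of a pipe dream. The $j$-th antidiagonal block is the $r_j\times r_j$ block in block row $j$ and block column $j$. Follow the pipes from northeast to southwest. For $D\in\mathcal{RP}(v(r))$ and $1\le j\le n$, $w_j(D)$ is the $r_{j-1}\times r_j$ partial permutation matrix with a $1$ at $(p,q)$ exactly when the pipe entering the $(j-1)$-st antidiagonal block through the top of its $p$-th column from the right enters the $j$-th antidiagonal block through the top of its $q$-th column from the right. Set $\mathbf w(D)=(w_1(D),\dots,w_n(D))$. Minimal length lacing diagrams. A partial permutation of size $a\times b$ is an $a\times b$ $0$-$1$ matrix with at most one $1$ in each row and column. Its completion $\tilde w$ is the minimal-length permutation whose matrix has $w$ as its northwest corner (in rows below $a$ and in columns right of $b$ the $1$'s proceed northwest to southeast); $\ell(w)=\ell(\tilde w)$. A lacing diagram is a list $\mathbf w=(w_1,\dots,w_n)\in\mathit{Hom}$ of partial permutations; $\ell(\mathbf w)=\sum\ell(w_i)$. With $d(r)=\sum_{0\le i<j\le n}(r_{i,j-1}-r_{ij})(r_{i+1,j}-r_{ij})$ (the codimension of the quiver locus $\Omega_r$), $W(r)$ is the set of lacing diagrams in $\mathit{Hom}$ with rank array $r$ and length $d(r)$. *)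

theory Defs
  imports
    "Jordan_Normal_Form.DL_Rank"
    "HOL-Combinatorics.Permutations"
begin

section \<open>Quiver representations and rank arrays\<close>

text \<open>
  A sequence \<open>\<phi>\<^sub>1, \<dots>, \<phi>\<^sub>n\<close> is a list, so \<open>\<phi>\<^sub>i\<close> is \<open>\<phi> ! (i - 1)\<close>.  Matrix entries count from 0;
  permutations and the boxes of the grid count from 1.  Only the entries \<open>r i j\<close> with
  \<open>i \<le> j \<le> n\<close> of an array are ever used; its diagonal is the dimension vector.
\<close>

definition Hom :: "nat \<Rightarrow> (nat \<Rightarrow> nat) \<Rightarrow> 'k::field mat list set" where
  "Hom n ds = {\<phi>. length \<phi> = n \<and> (\<forall>i\<in>{1..n}. \<phi> ! (i - 1) \<in> carrier_mat (ds (i - 1)) (ds i))}"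

text \<open>The product \<open>\<phi>\<^sub>i\<^sub>+\<^sub>1 \<cdots> \<phi>\<^sub>j\<close>, for \<open>i < j\<close>.\<close>

definition path_prod :: "'k::field mat list \<Rightarrow> nat \<Rightarrow> nat \<Rightarrow> 'k mat" where
  "path_prod \<phi> i j = foldl (*) (1\<^sub>m (dim_row (\<phi> ! i))) (map ((!) \<phi>) [i..<j])"

definition rank_array :: "(nat \<Rightarrow> nat) \<Rightarrow> 'k::field mat list \<Rightarrow> nat \<Rightarrow> nat \<Rightarrow> nat" where
  "rank_array ds \<phi> i j = (if i < j then vec_space.rank (ds i) (path_prod \<phi> i j) else ds i)"

definition has_rank_array :: "nat \<Rightarrow> (nat \<Rightarrow> nat \<Rightarrow> nat) \<Rightarrow> 'k::field mat list \<Rightarrow> bool" where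
  "has_rank_array n r \<phi> \<longleftrightarrow>
     \<phi> \<in> Hom n (\<lambda>i. r i i) \<and> (\<forall>i j. i \<le> j \<and> j \<le> n \<longrightarrow> rank_array (\<lambda>i. r i i) \<phi> i j = r i j)"

definition can_occur :: "'k::field itself \<Rightarrow> nat \<Rightarrow> (nat \<Rightarrow> nat \<Rightarrow> nat) \<Rightarrow> bool" where
  "can_occur _ n r \<longleftrightarrow> (\<exists>\<phi> :: 'k mat list. has_rank_array n r \<phi>)"


section \<open>The Zelevinsky permutation\<close>

definition total_dim :: "nat \<Rightarrow> (nat \<Rightarrow> nat \<Rightarrow> nat) \<Rightarrow> nat" where
  "total_dim n r = (\<Sum>i\<le>n. r i i)"

text \<open>The number of rows above block row \<open>j\<close>, and of columns in block columns \<open>n, \<dots>, i\<close>.\<close>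

definition row_offset :: "(nat \<Rightarrow> nat \<Rightarrow> nat) \<Rightarrow> nat \<Rightarrow> nat" where
  "row_offset r j = (\<Sum>i<j. r i i)"

definition col_end :: "nat \<Rightarrow> (nat \<Rightarrow> nat \<Rightarrow> nat) \<Rightarrow> nat \<Rightarrow> nat" where
  "col_end n r i = (\<Sum>k=i..n. r k k)"

definition block_row :: "(nat \<Rightarrow> nat \<Rightarrow> nat) \<Rightarrow> nat \<Rightarrow> nat set" where
  "block_row r j = {row_offset r j <.. row_offset r (Suc j)}"

definition block_col :: "nat \<Rightarrow> (nat \<Rightarrow> nat \<Rightarrow> nat) \<Rightarrow> nat \<Rightarrow> nat set" where
  "block_col n r i = {col_end n r (Suc i) <.. col_end n r i}"

definition rank_ext :: "nat \<Rightarrow> (nat \<Rightarrow> nat \<Rightarrow> nat) \<Rightarrow> int \<Rightarrow> int \<Rightarrow> int" where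
  "rank_ext n r a b =
     (if 0 \<le> a \<and> a \<le> int n \<and> 0 \<le> b \<and> b \<le> int n then int (r (nat a) (nat b)) else 0)"

definition lace_count :: "nat \<Rightarrow> (nat \<Rightarrow> nat \<Rightarrow> nat) \<Rightarrow> int \<Rightarrow> int \<Rightarrow> int" where
  "lace_count n r i j =
     rank_ext n r i j - rank_ext n r (i - 1) j - rank_ext n r i (j + 1) + rank_ext n r (i - 1) (j + 1)"

definition is_zelevinsky_perm :: "nat \<Rightarrow> (nat \<Rightarrow> nat \<Rightarrow> nat) \<Rightarrow> (nat \<Rightarrow> nat) \<Rightarrow> bool" where
  "is_zelevinsky_perm n r v \<longleftrightarrow>
     v permutes {1..total_dim n r} \<and>
     (\<forall>i\<le>n. \<forall>j\<le>n. int (card {q \<in> block_row r j. v q \<in> block_col n r i}) =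
        (if i \<le> j then lace_count n r (int i) (int j)
         else if i = j + 1 then int (r j (j + 1)) else 0)) \<and>
     (\<forall>j\<le>n. \<forall>q\<in>block_row r j. \<forall>q'\<in>block_row r j. q < q' \<longrightarrow> v q < v q') \<and>
     (\<forall>i\<le>n. \<forall>q q'. v q \<in> block_col n r i \<and> v q' \<in> block_col n r i \<and> q < q' \<longrightarrow> v q < v q')"

definition zelevinsky_perm :: "nat \<Rightarrow> (nat \<Rightarrow> nat \<Rightarrow> nat) \<Rightarrow> nat \<Rightarrow> nat" where
  "zelevinsky_perm n r = (THE v. is_zelevinsky_perm n r v)"


section \<open>Pipe dreams\<close>

definition pipe_dream :: "nat \<Rightarrow> (nat \<times> nat) set \<Rightarrow> bool" where
  "pipe_dream d D \<longleftrightarrow> D \<subseteq> {(q, p). 1 \<le> q \<and> 1 \<le> p \<and> q + p \<le> d}"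

datatype side = West | South

text \<open>
  \<open>pipe D t s q p\<close>: the pipe that enters the grid from the west in row \<open>t\<close> enters the box
  \<open>(q, p)\<close> through its side \<open>s\<close>.  Row \<open>0\<close> lies outside the grid, so \<open>pipe D t South 0 p\<close> says
  that the pipe exits at the top of column \<open>p\<close>; more generally \<open>pipe D t South q p\<close> says that
  the pipe passes through the top edge of the box \<open>(q + 1, p)\<close>.
\<close>

inductive pipe :: "(nat \<times> nat) set \<Rightarrow> nat \<Rightarrow> side \<Rightarrow> nat \<Rightarrow> nat \<Rightarrow> bool"
  for D :: "(nat \<times> nat) set" and t :: nat where
  start: "pipe D t West t 1"
| west_cross: "pipe D t West (Suc q) p \<Longrightarrow> (Suc q, p) \<in> D \<Longrightarrow> pipe D t West (Suc q) (Suc p)"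
| west_elbow: "pipe D t West (Suc q) p \<Longrightarrow> (Suc q, p) \<notin> D \<Longrightarrow> pipe D t South q p"
| south_cross: "pipe D t South (Suc q) p \<Longrightarrow> (Suc q, p) \<in> D \<Longrightarrow> pipe D t South q p"
| south_elbow: "pipe D t South (Suc q) p \<Longrightarrow> (Suc q, p) \<notin> D \<Longrightarrow> pipe D t West (Suc q) (Suc p)"

definition crossings :: "(nat \<times> nat) set \<Rightarrow> nat \<Rightarrow> nat \<Rightarrow> (nat \<times> nat) set" where
  "crossings D t t' = {(q, p) \<in> D. pipe D t West q p \<and> pipe D t' South q p \<or>
                                  pipe D t South q p \<and> pipe D t' West q p}"

definition reduced :: "nat \<Rightarrow> (nat \<times> nat) set \<Rightarrow> bool" where
  "reduced d D \<longleftrightarrow> (\<forall>t\<in>{1..d}. \<forall>t'\<in>{1..d}. t \<noteq> t' \<longrightarrow> card (crossings D t t') \<le> 1)"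

definition reduced_pipe_dreams :: "nat \<Rightarrow> (nat \<Rightarrow> nat) \<Rightarrow> (nat \<times> nat) set set" where
  "reduced_pipe_dreams d v =
     {D. pipe_dream d D \<and> reduced d D \<and> (\<forall>q\<in>{1..d}. pipe D q South 0 (v q))}"

text \<open>
  The pipe \<open>t\<close> passes through the top edge of the \<open>p\<close>-th column from the right (\<open>p = 0\<close> is the
  rightmost one) of the \<open>j\<close>-th antidiagonal block.  Pipes are directed towards the northeast
  above, so this edge is the one by which the pipe enters the block when it is followed
  from northeast to southwest.
\<close>

definition meets_block_top ::
  "nat \<Rightarrow> (nat \<Rightarrow> nat \<Rightarrow> nat) \<Rightarrow> (nat \<times> nat) set \<Rightarrow> nat \<Rightarrow> nat \<Rightarrow> nat \<Rightarrow> bool" where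
  "meets_block_top n r D t j p \<longleftrightarrow> pipe D t South (row_offset r j) (col_end n r j - p)"

definition pipe_lacing_mat ::
  "nat \<Rightarrow> (nat \<Rightarrow> nat \<Rightarrow> nat) \<Rightarrow> (nat \<times> nat) set \<Rightarrow> nat \<Rightarrow> 'k::field mat" where
  "pipe_lacing_mat n r D j = mat (r (j - 1) (j - 1)) (r j j)
     (\<lambda>(p, q). if \<exists>t\<in>{1..total_dim n r}. meets_block_top n r D t (j - 1) p \<and> meets_block_top n r D t j q
               then 1 else 0)"

definition pipe_lacing :: "nat \<Rightarrow> (nat \<Rightarrow> nat \<Rightarrow> nat) \<Rightarrow> (nat \<times> nat) set \<Rightarrow> 'k::field mat list" where
  "pipe_lacing n r D = map (pipe_lacing_mat n r D) [1..<Suc n]"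

definition W_RP :: "nat \<Rightarrow> (nat \<Rightarrow> nat \<Rightarrow> nat) \<Rightarrow> 'k::field mat list set" where
  "W_RP n r = {pipe_lacing n r D | D. D \<in> reduced_pipe_dreams (total_dim n r) (zelevinsky_perm n r)}"


section \<open>Minimal length lacing diagrams\<close>

definition partial_perm_mat :: "'k::field mat \<Rightarrow> bool" where
  "partial_perm_mat w \<longleftrightarrow>
     (\<forall>i<dim_row w. \<forall>j<dim_col w. w $$ (i, j) \<in> {0, 1}) \<and>
     (\<forall>i<dim_row w. \<forall>j<dim_col w. \<forall>j'<dim_col w.
        w $$ (i, j) = 1 \<and> w $$ (i, j') = 1 \<longrightarrow> j = j') \<and>
     (\<forall>i<dim_row w. \<forall>i'<dim_row w. \<forall>j<dim_col w.
        w $$ (i, j) = 1 \<and> w $$ (i', j) = 1 \<longrightarrow> i = i')"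

definition perm_length :: "(nat \<Rightarrow> nat) \<Rightarrow> nat" where
  "perm_length v = card {(i, j). i < j \<and> v j < v i}"

definition extends_partial_perm :: "'k::field mat \<Rightarrow> (nat \<Rightarrow> nat) \<Rightarrow> bool" where
  "extends_partial_perm w v \<longleftrightarrow>
     (\<exists>N. v permutes {1..N}) \<and>
     (\<forall>i<dim_row w. \<forall>j<dim_col w. w $$ (i, j) = 1 \<longleftrightarrow> v (i + 1) = j + 1)"

text \<open>
  The minimum is attained by a unique permutation, the extension of \<open>w\<close> whose 1's proceed from
  northwest to southeast in the rows below and in the columns to the right of \<open>w\<close>.
\<close>

definition completion :: "'k::field mat \<Rightarrow> nat \<Rightarrow> nat" where
  "completion w = arg_min perm_length (extends_partial_perm w)"

definition lacing_length :: "'k::field mat list \<Rightarrow> nat" where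
  "lacing_length ws = (\<Sum>w\<leftarrow>ws. perm_length (completion w))"

definition lacing_diagrams :: "nat \<Rightarrow> (nat \<Rightarrow> nat) \<Rightarrow> 'k::field mat list set" where
  "lacing_diagrams n ds = {ws \<in> Hom n ds. \<forall>w\<in>set ws. partial_perm_mat w}"

definition quiver_codim :: "nat \<Rightarrow> (nat \<Rightarrow> nat \<Rightarrow> nat) \<Rightarrow> int" where
  "quiver_codim n r = (\<Sum>(i, j) \<in> {(i, j). i < j \<and> j \<le> n}.
     (int (r i (j - 1)) - int (r i j)) * (int (r (i + 1) j) - int (r i j)))"

definition W :: "nat \<Rightarrow> (nat \<Rightarrow> nat \<Rightarrow> nat) \<Rightarrow> 'k::field mat list set" where
  "W n r = {ws \<in> lacing_diagrams n (\<lambda>i. r i i).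
     has_rank_array n r ws \<and> int (lacing_length ws) = quiver_codim n r}"

end

theory Submission
  imports Defs
begin

text \<open>
  The proof is purely combinatorial.  Let \<open>H\<close> be the set of boxes strictly northwest of the
  superantidiagonal blocks.  If a pipe dream \<open>D\<close> contains \<open>H\<close>, then a pipe passes through the
  antidiagonal blocks \<open>i \<le> j\<close> iff it starts below block row \<open>j - 1\<close> and exits to the right of block
  column \<open>i + 1\<close>; hence the rank array of \<open>w(D)\<close> is read off from the pipe permutation \<open>u\<close> of \<open>D\<close>,
  and it equals \<open>r\<close> iff \<open>u\<close> has the block counts of \<open>v(r)\<close>.  Every such \<open>u\<close> has exactly \<open>d(r) + |H|\<close>
  inversions between different block rows and columns, so \<open>\<ell>(u) \<ge> d(r) + |H|\<close> with equality iff
  \<open>u = v(r)\<close>.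

  Given a lacing diagram \<open>w\<close> with rank array \<open>r\<close>, let \<open>D\<close> consist of \<open>H\<close> and, in each superantidiagonal
  block, of the half-turn of a pipe dream for \<open>w\<^sub>j\<close> with \<open>\<ell>(w\<^sub>j)\<close> crossings.  Then \<open>w(D) = w\<close> and
  \<open>d(r) + |H| \<le> \<ell>(u) \<le> |D| \<le> |H| + \<ell>(w)\<close>; so \<open>\<ell>(w) \<ge> d(r)\<close>, and equality forces \<open>u = v(r)\<close> and \<open>D\<close> reduced.
  Conversely, \<open>D \<in> RP(v(r))\<close> contains \<open>H\<close> and has \<open>d(r) + |H|\<close> crossings, and the \<open>w\<^sub>j(D)\<close> use disjoint sets
  of crossings outside \<open>H\<close>, whence \<open>\<ell>(w(D)) \<le> d(r)\<close>.
\<close>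

section \<open>Pipes and inversions\<close>

text \<open>No theory of reduced words enters. Two pipes form an inversion iff they cross an odd
  number of times, so the length of the pipe permutation is at most the number of boxes in
  \<open>D\<close>, and \<open>D\<close> is reduced iff the two numbers agree. Reducedness is thus
  decided by counting boxes. The completion of a partial permutation is never computed either. Its
  length is a minimum, so any extension read off from a pipe dream bounds it from above, while a
  code that every extension has to pay for bounds it from below. The boxes drawn for a lacing
  diagram are counted by exactly this code. Since \<open>zelevinsky_perm\<close> is a definite
  description, existence and uniqueness have to be proved. When a pipe dream is built from a minimal
  lacing diagram, its own pipe permutation is the witness. In the other direction the witness needs
  nonnegative block counts; for rank arrays of arbitrary matrices this is the Frobenius rank
  inequality, the one place where linear algebra goes beyond partial permutation matrices.\<close>

definition pipe_step :: "(nat \<times> nat) set \<Rightarrow> ((side \<times> nat \<times> nat) \<times> (side \<times> nat \<times> nat)) set" where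
  "pipe_step D = {((s, Suc q, p), if (s = West) = ((Suc q, p) \<in> D) then (West, Suc q, Suc p) else (South, q, p)) | s q p. True}"

lemma single_valued_pipe_step: "single_valued (pipe_step D)"
  by (auto simp: single_valued_def pipe_step_def)

lemma side_neq [simp]: "s \<noteq> West \<longleftrightarrow> s = South" "s \<noteq> South \<longleftrightarrow> s = West"
  by (cases s; simp)+

lemma pipe_step_cases:
  assumes "((s, q, p), (s', q', p')) \<in> pipe_step D"
  obtains "s = West" "(q, p) \<in> D" "s' = West" "q' = q" "p' = Suc p" "q > 0"
    | "s = West" "(q, p) \<notin> D" "s' = South" "q = Suc q'" "p' = p"
    | "s = South" "(q, p) \<in> D" "s' = South" "q = Suc q'" "p' = p"
    | "s = South" "(q, p) \<notin> D" "s' = West" "q' = q" "p' = Suc p" "q > 0"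
  using assms by (cases s) (auto simp: pipe_step_def split: if_splits)

lemma pipe_step_iff:
  "((s, q, p), (s', q', p')) \<in> pipe_step D \<longleftrightarrow>
     q > 0 \<and> (if (s = West) = ((q, p) \<in> D) then s' = West \<and> q' = q \<and> p' = Suc p
              else s' = South \<and> Suc q' = q \<and> p' = p)"
  by (cases q) (auto simp: pipe_step_def)

lemma pipe_iff_steps: "pipe D t s q p \<longleftrightarrow> ((West, t, 1), (s, q, p)) \<in> (pipe_step D)\<^sup>*"
proof
  show "((West, t, 1), (s, q, p)) \<in> (pipe_step D)\<^sup>*" if "pipe D t s q p"
    using that
  proof induction
    case start
    then show ?case by simp
  qed (erule rtrancl_into_rtrancl, simp add: pipe_step_iff)+
next
  have "pipe D t (fst e) (fst (snd e)) (snd (snd e))" if "((West, t, 1), e) \<in> (pipe_step D)\<^sup>*" for e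
    using that
  proof induction
    case base
    then show ?case using pipe.start by simp
  next
    case (step e e')
    obtain s q p s' q' p' where "e = (s, q, p)" "e' = (s', q', p')" by (metis prod_cases3)
    with step show ?case
      by (cases q) (auto simp: pipe_step_iff split: if_splits intro: pipe.intros)
  qed
  from this[of "(s, q, p)"] show "pipe D t s q p" if "((West, t, 1), (s, q, p)) \<in> (pipe_step D)\<^sup>*"
    using that by simp
qed

text \<open>Every step goes one row up or one column right, and a \<open>South\<close> state is
  entered only by going up. Hence a pipe uses at most one horizontal edge on each level. Uniqueness
  facts follow by comparing two states of one pipe through confluence of the single-valued step
  relation.\<close>

lemma steps_mono:
  assumes "((s, q, p), (s', q', p')) \<in> (pipe_step D)\<^sup>*"
  shows "(s', q', p') = (s, q, p) \<or> q' \<le> q \<and> p \<le> p' \<and> q + p' > q' + p \<and> (s' = South \<longrightarrow> q' < q)"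
proof -
  have "case e of (s', q', p') \<Rightarrow> (s', q', p') = (s, q, p) \<or>
      q' \<le> q \<and> p \<le> p' \<and> q + p' > q' + p \<and> (s' = South \<longrightarrow> q' < q)"
    if "((s, q, p), e) \<in> (pipe_step D)\<^sup>*" for e
    using that
  proof induction
    case (step e e')
    obtain s1 q1 p1 s2 q2 p2 where "e = (s1, q1, p1)" "e' = (s2, q2, p2)" by (metis prod_cases3)
    with step(2,3) show ?case by (auto elim!: pipe_step_cases)
  qed simp
  from this[OF assms] show ?thesis by simp
qed

lemma pipe_level_unique:
  assumes "pipe D t South q p" "pipe D t South q p'"
  shows "p = p'"
proof -
  have "((South, q, p), (South, q, p')) \<in> (pipe_step D)\<^sup>* \<or> ((South, q, p'), (South, q, p)) \<in> (pipe_step D)\<^sup>*"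
    using single_valued_confluent[OF single_valued_pipe_step] assms by (simp add: pipe_iff_steps)
  then show ?thesis by (auto dest!: steps_mono)
qed

lemma pipe_West_South_False:
  assumes "pipe D t West q p" "pipe D t South q p"
  shows False
proof -
  have "((West, q, p), (South, q, p)) \<in> (pipe_step D)\<^sup>* \<or> ((South, q, p), (West, q, p)) \<in> (pipe_step D)\<^sup>*"
    using single_valued_confluent[OF single_valued_pipe_step] assms by (simp add: pipe_iff_steps)
  then show ?thesis by (auto dest!: steps_mono)
qed

lemma pipe_bounds:
  assumes "pipe D t s q p"
  shows "1 \<le> p \<and> q \<le> t \<and> (s = South \<longrightarrow> q < t) \<and> (s = West \<longrightarrow> 0 < t \<longrightarrow> 0 < q)"
  using assms by induction auto

text \<open>The tiles are reversible: an edge and the tile before it determine the previous edge, so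
  tracing back from a common edge leads to the same start. A start in column 1 has no predecessor
  because columns are positive.\<close>

lemma pipe_edge_unique:
  assumes "pipe D t s q p" "pipe D t' s q p"
  shows "t = t'"
  using assms
proof (induction arbitrary: t')
  case start
  from start show ?case
  proof cases
    case (west_cross q p)
    then show ?thesis using pipe_bounds by fastforce
  next
    case (south_elbow q p)
    then show ?thesis using pipe_bounds by fastforce
  qed simp
next
  case (west_cross q p)
  note p = pipe_bounds[OF west_cross.hyps(1)]
  from west_cross.prems show ?case
  proof cases
    case start
    then show ?thesis using p by simp
  next
    case west_cross
    then show ?thesis by (intro \<open>\<And>t'. pipe D t' West (Suc q) p \<Longrightarrow> t = t'\<close>)
  next
    case south_elbow
    then show ?thesis using \<open>(Suc q, p) \<in> D\<close> by simp
  qed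
next
  case (west_elbow q p)
  from west_elbow.prems show ?case
  proof cases
    case west_elbow
    then show ?thesis by (intro \<open>\<And>t'. pipe D t' West (Suc q) p \<Longrightarrow> t = t'\<close>)
  next
    case south_cross
    then show ?thesis using \<open>(Suc q, p) \<notin> D\<close> by simp
  qed
next
  case (south_cross q p)
  from south_cross.prems show ?case
  proof cases
    case west_elbow
    then show ?thesis using \<open>(Suc q, p) \<in> D\<close> by simp
  next
    case south_cross
    then show ?thesis by (intro \<open>\<And>t'. pipe D t' South (Suc q) p \<Longrightarrow> t = t'\<close>)
  qed
next
  case (south_elbow q p)
  note p = pipe_bounds[OF south_elbow.hyps(1)]
  from south_elbow.prems show ?case
  proof cases
    case start
    then show ?thesis using p by simp
  next
    case west_cross
    then show ?thesis using \<open>(Suc q, p) \<notin> D\<close> by simp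
  next
    case south_elbow
    then show ?thesis by (intro \<open>\<And>t'. pipe D t' South (Suc q) p \<Longrightarrow> t = t'\<close>)
  qed
qed

text \<open>
  Numbering the edges along each antidiagonal, a crossing in the box \<open>(q, p)\<close> acts as the simple
  transposition of \<open>q + p - 1\<close> and \<open>q + p\<close>, and an elbow acts trivially.
\<close>

definition edge_index :: "side \<Rightarrow> nat \<Rightarrow> nat \<Rightarrow> nat" where
  "edge_index s q p = (if s = West then q + p - 1 else q + p)"

text \<open>All crossings lie in boxes with \<open>q + p \<le> d\<close>, so they only exchange
  antidiagonals up to \<open>d\<close>; a pipe starting beyond \<open>d\<close> keeps its own. This
  is how a pipe through a given edge is shown to start in \<open>{1..d}\<close>.\<close>

lemma pipe_edge_index:
  assumes "pipe D t s q p" "pipe_dream d D"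
  shows "if t \<le> d then edge_index s q p \<le> d else edge_index s q p = t"
  using assms
proof induction
  case (west_cross q p)
  then have "Suc q + p \<le> d" by (auto simp: pipe_dream_def)
  with west_cross show ?case by (auto simp: edge_index_def split: if_splits)
next
  case (south_cross q p)
  then have "Suc q + p \<le> d" by (auto simp: pipe_dream_def)
  with south_cross show ?case by (auto simp: edge_index_def split: if_splits)
qed (auto simp: edge_index_def split: if_splits)

text \<open>Tracing backwards terminates: a \<open>South\<close> edge leads down its column through
  crossings, which end at the antidiagonal, to an elbow and hence to a \<open>West\<close> edge of
  the same column; a \<open>West\<close> edge leads to the previous column.\<close>

lemma pipe_edge_exists:
  assumes "pipe_dream d D" "1 \<le> p" "s = West \<Longrightarrow> 1 \<le> q"
  shows "\<exists>t\<ge>1. pipe D t s q p"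
proof -
  have south: "\<exists>t\<ge>1. pipe D t South q p" if W: "\<And>q. 1 \<le> q \<Longrightarrow> \<exists>t\<ge>1. pipe D t West q p" for q p
  proof (induction "d - q" arbitrary: q rule: less_induct)
    case less
    show ?case
    proof (cases "(Suc q, p) \<in> D")
      case True
      then have "d - Suc q < d - q" using assms(1) by (auto simp: pipe_dream_def)
      from less[OF this] obtain t where "t \<ge> 1" "pipe D t South (Suc q) p" by blast
      with True show ?thesis by (blast intro: pipe.intros)
    next
      case False
      obtain t where "t \<ge> 1" "pipe D t West (Suc q) p" using W[of "Suc q"] by auto
      with False show ?thesis by (blast intro: pipe.intros)
    qed
  qed
  have west: "\<exists>t\<ge>1. pipe D t West q p" if "1 \<le> q" "1 \<le> p" for q p
    using that(2,1)
  proof (induction p arbitrary: q rule: nat_induct_at_least)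
    case base
    then show ?case using pipe.start by auto
  next
    case (Suc p)
    obtain q' where q: "q = Suc q'" using Suc.prems by (cases q) auto
    show ?case
    proof (cases "(q, p) \<in> D")
      case True
      then show ?thesis using Suc pipe.west_cross unfolding q by blast
    next
      case False
      then show ?thesis using south[OF Suc.IH] pipe.south_elbow unfolding q by blast
    qed
  qed
  show ?thesis using south[OF west] west assms by (cases s) auto
qed

lemma pipe_dream_finite: "pipe_dream d D \<Longrightarrow> finite D"
  by (rule finite_subset[of _ "{..d} \<times> {..d}"]) (auto simp: pipe_dream_def)

text \<open>The crossings of a row end at the antidiagonal, so a pipe running east eventually turns
  north and leaves every row that it enters through the top.\<close>

lemma pipe_level_exists:
  assumes "pipe_dream d D" "q < t"
  shows "\<exists>p. pipe D t South q p"
proof -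
  have west: "\<exists>p. pipe D t South q p" if "pipe D t West (Suc q) p" for q p
    using that
  proof (induction "d - p" arbitrary: p rule: less_induct)
    case less
    show ?case
    proof (cases "(Suc q, p) \<in> D")
      case True
      then have "d - Suc p < d - p" using assms(1) by (auto simp: pipe_dream_def)
      from less(1)[OF this] show ?thesis using True less(2) by (blast intro: pipe.intros)
    next
      case False
      with less(2) show ?thesis by (blast intro: pipe.intros)
    qed
  qed
  have "\<exists>p. pipe D t South (t - Suc k) p" if "k < t" for k
    using that
  proof (induction k)
    case 0
    then show ?case using west[of "t - 1" 1] pipe.start by auto
  next
    case (Suc k)
    then obtain p where p: "pipe D t South (Suc (t - Suc (Suc k))) p"
      by (auto simp: Suc_diff_Suc)
    then show ?case
      by (cases "(Suc (t - Suc (Suc k)), p) \<in> D") (blast intro: pipe.intros west)+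
  qed
  from this[of "t - Suc q"] show ?thesis using assms(2) by simp
qed

lemma pipe_elbows_tail:
  assumes "pipe D t South q p" "\<And>q' p'. q' \<le> q \<Longrightarrow> (q', p') \<notin> D"
  shows "pipe D t South 0 (q + p)"
  using assms
proof (induction q arbitrary: p)
  case 0
  then show ?case by simp
next
  case (Suc q)
  then have "pipe D t South q (Suc p)" by (intro pipe.west_elbow[OF pipe.south_elbow]) auto
  from Suc.IH[OF this] Suc.prems(2) show ?case by simp
qed

text \<open>The condition on the state is inherited by all earlier states of the pipe, and the box
  passed to arrive at such a state is never \<open>(a, b)\<close>. The tile in that box therefore
  cannot have been used yet.\<close>

lemma pipe_cong_before:
  assumes "\<And>q p. (q, p) \<noteq> (a, b) \<Longrightarrow> (q, p) \<in> D \<longleftrightarrow> (q, p) \<in> E"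
    and "pipe D t s q p" "a < q \<or> a = q \<and> p \<le> b"
  shows "pipe E t s q p"
  using assms(2,3)
proof induction
  case start
  show ?case by (rule pipe.start)
next
  case (west_cross q p)
  then show ?case using assms(1)[of "Suc q" p] by - (rule pipe.west_cross, auto)
next
  case (west_elbow q p)
  then show ?case using assms(1)[of "Suc q" p] by - (rule pipe.west_elbow, auto)
next
  case (south_cross q p)
  then show ?case using assms(1)[of "Suc q" p] by - (rule pipe.south_cross, auto)
next
  case (south_elbow q p)
  then show ?case using assms(1)[of "Suc q" p] by - (rule pipe.south_elbow, auto)
qed

lemma pipe_cong_avoid:
  assumes "\<And>q p. (q, p) \<noteq> (a, b) \<Longrightarrow> (q, p) \<in> D \<longleftrightarrow> (q, p) \<in> E"
    and "pipe D t s q p" "\<And>s. \<not> pipe D t s a b"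
  shows "pipe E t s q p"
  using assms(2)
proof induction
  case start
  show ?case by (rule pipe.start)
next
  case (west_cross q p)
  then have "(Suc q, p) \<noteq> (a, b)" using assms(3) by blast
  with west_cross assms(1) show ?case by (metis pipe.west_cross)
next
  case (west_elbow q p)
  then have "(Suc q, p) \<noteq> (a, b)" using assms(3) by blast
  with west_elbow assms(1) show ?case by (metis pipe.west_elbow)
next
  case (south_cross q p)
  then have "(Suc q, p) \<noteq> (a, b)" using assms(3) by blast
  with south_cross assms(1) show ?case by (metis pipe.south_cross)
next
  case (south_elbow q p)
  then have "(Suc q, p) \<noteq> (a, b)" using assms(3) by blast
  with south_elbow assms(1) show ?case by (metis pipe.south_elbow)
qed

lemma pipe_no_crossings:
  assumes "1 \<le> t" shows "pipe {} t South 0 t"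
proof -
  have "pipe {} t South (t - 1) 1" using pipe.start[of "{}" t] assms
    pipe.west_elbow[of "{}" t "t - 1" 1] by simp
  from pipe_elbows_tail[OF this] show ?thesis using assms by simp
qed

lemma last_box:
  assumes "finite D" "D \<noteq> {}"
  obtains a b :: nat where "(a, b) \<in> D" "\<And>q p. (q, p) \<in> D \<Longrightarrow> a < q \<or> a = q \<and> p \<le> (b::nat)"
proof -
  define a where "a = Min (fst ` D)"
  define b where "b = Max {p. (a, p) \<in> D}"
  have fin: "finite {p. (a, p) \<in> D}"
    by (rule finite_subset[of _ "snd ` D"]) (use assms in force)+
  have "a \<in> fst ` D" unfolding a_def using assms by (intro Min_in) auto
  then have "{p. (a, p) \<in> D} \<noteq> {}" by auto
  from Max_in[OF fin this] have "(a, b) \<in> D" by (auto simp: b_def)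
  moreover have "a < q \<or> a = q \<and> p \<le> b" if "(q, p) \<in> D" for q p
  proof -
    have "a \<le> q" unfolding a_def using assms that by (force intro: Min_le)
    moreover have "p \<le> b" if "a = q" using \<open>(q, p) \<in> D\<close> that unfolding b_def by (intro Max_ge fin) auto
    ultimately show ?thesis by auto
  qed
  ultimately show ?thesis using that by blast
qed

section \<open>Inversions and the parity of the number of crossings\<close>

lemma transpose_Suc_less_iff:
  assumes "x \<noteq> y"
  shows "transpose i (Suc i) x < transpose i (Suc i) y \<longleftrightarrow>
    (if {x, y} = {i, Suc i} then y < x else x < y)"
  unfolding doubleton_eq_iff
  using assms by (cases "x = i"; cases "x = Suc i"; cases "y = i"; cases "y = Suc i") (auto simp add: transpose_def)

text \<open>
  Induction on the number of crossings: removing the rightmost crossing of the topmost nonempty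
  row leaves all pipes unchanged up to that box, and behind it there are only elbows.
\<close>

lemma pipe_permutation_exists:
  assumes "pipe_dream d D"
  shows "\<exists>u. u permutes {1..d} \<and> (\<forall>t\<in>{1..d}. pipe D t South 0 (u t)) \<and>
    (\<forall>t\<in>{1..d}. \<forall>t'\<in>{1..d}. t < t' \<longrightarrow> (u t' < u t \<longleftrightarrow> odd (card (crossings D t t'))))"
  using assms
proof (induction "card D" arbitrary: D rule: less_induct)
  case less
  note fin = pipe_dream_finite[OF less.prems]
  show ?case
  proof (cases "D = {}")
    case True
    show ?thesis
      by (rule exI[of _ id]) (auto simp: True permutes_id crossings_def pipe_no_crossings)
  next
    case False
    obtain a b where ab: "(a, b) \<in> D" and last: "\<And>q p. (q, p) \<in> D \<Longrightarrow> a < q \<or> a = q \<and> p \<le> b"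
      using last_box[OF fin False] by metis
    define E where "E = D - {(a, b)}"
    have agree: "\<And>q p. (q, p) \<noteq> (a, b) \<Longrightarrow> (q, p) \<in> D \<longleftrightarrow> (q, p) \<in> E"
      by (auto simp: E_def)
    have abE: "(a, b) \<notin> E" by (simp add: E_def)
    have D: "D = insert (a, b) E" using ab by (auto simp: E_def)
    have finE: "finite E" using fin by (simp add: E_def)
    have E: "pipe_dream d E" using less.prems by (auto simp: E_def pipe_dream_def)
    have "card E < card D" unfolding E_def by (rule card_Diff1_less[OF fin ab])
    from less.hyps[OF this E] obtain u where u: "u permutes {1..d}"
      and u_pipe: "\<And>t. t \<in> {1..d} \<Longrightarrow> pipe E t South 0 (u t)"
      and u_inv: "\<And>t t'. t \<in> {1..d} \<Longrightarrow> t' \<in> {1..d} \<Longrightarrow> t < t' \<Longrightarrow>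
           u t' < u t \<longleftrightarrow> odd (card (crossings E t t'))" by blast
    have bounds: "1 \<le> a" "1 \<le> b" "a + b \<le> d" using less.prems ab by (auto simp: pipe_dream_def)
    then obtain a' where a': "a = Suc a'" by (cases a) auto
    obtain tW where "1 \<le> tW" and tW: "pipe E tW West a b"
      using pipe_edge_exists[OF E, of b West a] bounds by auto
    obtain tS where "1 \<le> tS" and tS: "pipe E tS South a b"
      using pipe_edge_exists[OF E, of b South a] bounds by auto
    have "tW \<le> d" using pipe_edge_index[OF tW E] bounds by (auto simp: edge_index_def split: if_splits)
    moreover have "tS \<le> d" using pipe_edge_index[OF tS E] bounds by (auto simp: edge_index_def split: if_splits)
    ultimately have tWS: "tW \<in> {1..d}" "tS \<in> {1..d}" using \<open>1 \<le> tW\<close> \<open>1 \<le> tS\<close> by auto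
    have neq: "tW \<noteq> tS" using tW tS pipe_West_South_False by blast
    have agree': "\<And>q p. (q, p) \<noteq> (a, b) \<Longrightarrow> (q, p) \<in> E \<longleftrightarrow> (q, p) \<in> D" using agree by blast
    have before: "pipe D t s q p \<longleftrightarrow> pipe E t s q p" if "a < q \<or> a = q \<and> p \<le> b" for t s q p
      using pipe_cong_before[of a b D E t s q p, OF agree] pipe_cong_before[of a b E D t s q p, OF agree'] that
      by blast
    have above: "(q', p') \<notin> D" if "q' \<le> a'" for q' p' using last[of q' p'] that by (auto simp: a')
    have right: "(Suc a', Suc b) \<notin> D" using last[of a "Suc b"] by (auto simp: a')
    have aboveE: "(q', p') \<notin> E" if "q' \<le> a'" for q' p' using above[OF that] by (auto simp: E_def)
    have rightE: "(Suc a', Suc b) \<notin> E" using right by (auto simp: E_def)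
    have "pipe E tW South a' b" using tW abE by (auto simp: a' intro: pipe.intros)
    from pipe_elbows_tail[OF this aboveE] have exW: "pipe E tW South 0 (a' + b)" .
    have "pipe E tS South a' (Suc b)" using tS abE rightE by (auto simp: a' intro: pipe.intros)
    from pipe_elbows_tail[OF this aboveE] have exS: "pipe E tS South 0 (Suc (a' + b))" by simp
    have tWD: "pipe D tW West a b" and tSD: "pipe D tS South a b" using before tW tS by auto
    have "pipe D tW South a' (Suc b)" using tWD ab right by (auto simp: a' intro: pipe.intros)
    from pipe_elbows_tail[OF this above] have exWD: "pipe D tW South 0 (Suc (a' + b))" by simp
    have "pipe D tS South a' b" using tSD ab by (auto simp: a' intro: pipe.intros)
    from pipe_elbows_tail[OF this above] have exSD: "pipe D tS South 0 (a' + b)" by simp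
    \<comment> \<open>Behind \<open>(a, b)\<close> there are only elbows, so the two pipes of this
      box run along adjacent antidiagonals to the columns \<open>i\<close> and \<open>Suc i\<close>;
      the tile in the box decides which pipe takes which.\<close>
    define i where "i = a' + b"
    have uW: "u tW = i" using pipe_level_unique[OF exW u_pipe[OF tWS(1)]] by (simp add: i_def)
    have uS: "u tS = Suc i" using pipe_level_unique[OF exS u_pipe[OF tWS(2)]] by (simp add: i_def)
    define v where "v = transpose i (Suc i) \<circ> u"
    have i: "i \<in> {1..d}" "Suc i \<in> {1..d}" using bounds by (auto simp: i_def a')
    have "v permutes {1..d}" unfolding v_def
      by (intro permutes_compose[OF u] permutes_swap_id i)
    moreover have "pipe D t South 0 (v t)" if t: "t \<in> {1..d}" for t
    proof -
      consider "t = tW" | "t = tS" | "t \<noteq> tW" "t \<noteq> tS" by blast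
      then show ?thesis
      proof cases
        case 1
        then show ?thesis using exWD by (simp add: v_def uW i_def)
      next
        case 2
        then show ?thesis using exSD by (simp add: v_def uS i_def)
      next
        case 3
        have "\<not> pipe E t s a b" for s
          using 3 tW tS pipe_edge_unique[of E t s a b] by (cases s) auto
        from pipe_cong_avoid[of a b E D, OF agree' u_pipe[OF t] this] have "pipe D t South 0 (u t)" .
        moreover have "u t \<noteq> i" "u t \<noteq> Suc i"
          using 3 uW uS permutes_inj[OF u] by (metis injD)+
        ultimately show ?thesis by (simp add: v_def transpose_def)
      qed
    qed
    moreover have "v t' < v t \<longleftrightarrow> odd (card (crossings D t t'))"
      if t: "t \<in> {1..d}" "t' \<in> {1..d}" "t < t'" for t t'
    proof -
      \<comment> \<open>All other boxes of \<open>D\<close> come before \<open>(a, b)\<close>, where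
        the pipes of \<open>D\<close> and \<open>E\<close> agree. Restoring the box thus adds one
        crossing to one pair and leaves every other pair alone, which matches the effect of the
        transposition on inversions.\<close>
      have cr: "crossings D t t' = (if {t, t'} = {tW, tS} then insert (a, b) (crossings E t t') else crossings E t t')"
      proof (rule Set.set_eqI)
        fix x :: "nat \<times> nat"
        obtain q p where x: "x = (q, p)" by (cases x)
        show "x \<in> crossings D t t' \<longleftrightarrow> x \<in> (if {t, t'} = {tW, tS} then insert (a, b) (crossings E t t') else crossings E t t')"
        proof (cases "(q, p) = (a, b)")
          case True
          have W: "\<And>s. pipe D s West a b \<longleftrightarrow> s = tW" using tWD pipe_edge_unique by blast
          have S: "\<And>s. pipe D s South a b \<longleftrightarrow> s = tS" using tSD pipe_edge_unique by blast
          have "x \<in> crossings D t t' \<longleftrightarrow> {t, t'} = {tW, tS}"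
            using True ab unfolding x crossings_def doubleton_eq_iff by (simp add: W S)
          moreover have "x \<notin> crossings E t t'" using True abE by (simp add: x crossings_def)
          ultimately show ?thesis using True by (simp add: x)
        next
          case False
          then have "(q, p) \<in> D \<longleftrightarrow> (q, p) \<in> E" by (rule agree)
          moreover have "pipe D t s q p \<longleftrightarrow> pipe E t s q p" if "(q, p) \<in> D" for t s
            using before last[OF that] by blast
          ultimately have "x \<in> crossings D t t' \<longleftrightarrow> x \<in> crossings E t t'"
            unfolding x crossings_def by blast
          then show ?thesis using False by (auto simp: x)
        qed
      qed
      have fc: "finite (crossings E t t')" by (rule finite_subset[OF _ finE]) (auto simp: crossings_def)
      have nin: "(a, b) \<notin> crossings E t t'" using abE by (auto simp: crossings_def)
      have inj: "u x = u y \<longleftrightarrow> x = y" for x y using permutes_inj[OF u] by (auto dest: injD)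
      have eq: "{u t', u t} = {i, Suc i} \<longleftrightarrow> {t, t'} = {tW, tS}"
        unfolding doubleton_eq_iff using uW uS inj by metis
      have "u t' \<noteq> u t" using t by (simp add: inj)
      then have "v t' < v t \<longleftrightarrow> (if {t, t'} = {tW, tS} then u t < u t' else u t' < u t)"
        using transpose_Suc_less_iff[of "u t'" "u t" i] unfolding eq by (simp add: v_def)
      moreover have "u t < u t' \<longleftrightarrow> \<not> odd (card (crossings E t t'))"
        using u_inv[OF t] \<open>u t' \<noteq> u t\<close> by linarith
      moreover have "card (crossings D t t') = (if {t, t'} = {tW, tS} then Suc (card (crossings E t t')) else card (crossings E t t'))"
        unfolding cr using fc nin by simp
      ultimately show ?thesis using u_inv[OF t] by simp
    qed
    ultimately show ?thesis by blast
  qed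
qed

definition pipe_perm :: "nat \<Rightarrow> (nat \<times> nat) set \<Rightarrow> nat \<Rightarrow> nat" where
  "pipe_perm d D = (SOME u. u permutes {1..d} \<and> (\<forall>t\<in>{1..d}. pipe D t South 0 (u t)) \<and>
    (\<forall>t\<in>{1..d}. \<forall>t'\<in>{1..d}. t < t' \<longrightarrow> (u t' < u t \<longleftrightarrow> odd (card (crossings D t t')))))"

lemma
  assumes "pipe_dream d D"
  shows pipe_perm_permutes: "pipe_perm d D permutes {1..d}"
    and pipe_perm_exit: "t \<in> {1..d} \<Longrightarrow> pipe D t South 0 p \<longleftrightarrow> p = pipe_perm d D t"
    and pipe_perm_inversion: "t \<in> {1..d} \<Longrightarrow> t' \<in> {1..d} \<Longrightarrow> t < t' \<Longrightarrow>
      pipe_perm d D t' < pipe_perm d D t \<longleftrightarrow> odd (card (crossings D t t'))"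
proof -
  note * = someI_ex[OF pipe_permutation_exists[OF assms], folded pipe_perm_def]
  show "pipe_perm d D permutes {1..d}" using * by blast
  show "t \<in> {1..d} \<Longrightarrow> pipe D t South 0 p \<longleftrightarrow> p = pipe_perm d D t"
    using * pipe_level_unique by blast
  show "t \<in> {1..d} \<Longrightarrow> t' \<in> {1..d} \<Longrightarrow> t < t' \<Longrightarrow>
      pipe_perm d D t' < pipe_perm d D t \<longleftrightarrow> odd (card (crossings D t t'))"
    using * by blast
qed

section \<open>Reducedness as an equality between a number of boxes and a length\<close>

lemma crossings_sym: "crossings D t t' = crossings D t' t"
  by (auto simp: crossings_def)

definition pairs_upto :: "nat \<Rightarrow> (nat \<times> nat) set" where
  "pairs_upto d = {(t, t'). 1 \<le> t \<and> t < t' \<and> t' \<le> d}"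

lemma finite_pairs_upto [simp]: "finite (pairs_upto d)"
  by (rule finite_subset[of _ "{..d} \<times> {..d}"]) (auto simp: pairs_upto_def)

text \<open>Each box of \<open>D\<close> is the crossing of exactly one pair: the pipes on its
  \<open>West\<close> and \<open>South\<close> edges exist, start in \<open>{1..d}\<close>, are
  unique, and differ because a pipe does not enter a box twice.\<close>

lemma card_pipe_dream_eq_sum_crossings:
  assumes "pipe_dream d D"
  shows "card D = (\<Sum>(t, t')\<in>pairs_upto d. card (crossings D t t'))"
proof -
  have fin: "finite (crossings D t t')" for t t'
    by (rule finite_subset[OF _ pipe_dream_finite[OF assms]]) (auto simp: crossings_def)
  have eq: "D = (\<Union>(t, t')\<in>pairs_upto d. crossings D t t')"
  proof (intro equalityI subsetI)
    fix x assume "x \<in> D"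
    obtain a b where x: "x = (a, b)" by (cases x)
    have bounds: "1 \<le> a" "1 \<le> b" "a + b \<le> d" using assms \<open>x \<in> D\<close> by (auto simp: pipe_dream_def x)
    obtain tW where "1 \<le> tW" and tW: "pipe D tW West a b"
      using pipe_edge_exists[OF assms, of b West a] bounds by auto
    obtain tS where "1 \<le> tS" and tS: "pipe D tS South a b"
      using pipe_edge_exists[OF assms, of b South a] bounds by auto
    have "tW \<le> d" using pipe_edge_index[OF tW assms] bounds by (auto simp: edge_index_def split: if_splits)
    moreover have "tS \<le> d" using pipe_edge_index[OF tS assms] bounds by (auto simp: edge_index_def split: if_splits)
    moreover have "tW \<noteq> tS" using tW tS pipe_West_South_False by blast
    ultimately have "(min tW tS, max tW tS) \<in> pairs_upto d" using \<open>1 \<le> tW\<close> \<open>1 \<le> tS\<close>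
      by (auto simp: pairs_upto_def)
    moreover have "x \<in> crossings D (min tW tS) (max tW tS)"
      using tW tS \<open>x \<in> D\<close> by (auto simp: crossings_def x min_def max_def)
    ultimately show "x \<in> (\<Union>(t, t')\<in>pairs_upto d. crossings D t t')" by blast
  qed (auto simp: crossings_def)
  have "crossings D t t' \<inter> crossings D s s' = {}"
    if "(t, t') \<in> pairs_upto d" "(s, s') \<in> pairs_upto d" "(t, t') \<noteq> (s, s')" for t t' s s'
  proof (rule ccontr)
    assume "crossings D t t' \<inter> crossings D s s' \<noteq> {}"
    then obtain a b where "(a, b) \<in> crossings D t t'" "(a, b) \<in> crossings D s s'" by auto
    then have "t = s \<and> t' = s' \<or> t = s' \<and> t' = s"
      unfolding crossings_def using pipe_edge_unique[of D _ West a b] pipe_edge_unique[of D _ South a b]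
      by blast
    then show False using that by (auto simp: pairs_upto_def)
  qed
  then have "\<forall>x\<in>pairs_upto d. \<forall>y\<in>pairs_upto d. x \<noteq> y \<longrightarrow>
      (case x of (t, t') \<Rightarrow> crossings D t t') \<inter> (case y of (t, t') \<Rightarrow> crossings D t t') = {}"
    by (metis (no_types, lifting) case_prod_conv surj_pair)
  then have "card (\<Union>(t, t')\<in>pairs_upto d. crossings D t t') = (\<Sum>x\<in>pairs_upto d. card (case x of (t, t') \<Rightarrow> crossings D t t'))"
    by (intro card_UN_disjoint) (simp_all add: fin split: prod.splits)
  also have "\<dots> = (\<Sum>(t, t')\<in>pairs_upto d. card (crossings D t t'))"
    by (intro sum.cong) auto
  finally show ?thesis using eq by simp
qed

lemma permutes_le:
  assumes "u permutes {1..d}" "t \<le> d"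
  shows "u t \<le> d"
proof (cases "t \<in> {1..d}")
  case True
  then show ?thesis using permutes_in_image[OF assms(1), of t] by simp
next
  case False
  then show ?thesis using permutes_not_in[OF assms(1) False] assms(2) by simp
qed

text \<open>Needed because \<open>perm_length\<close> counts pairs among all natural
  numbers.\<close>

lemma inversion_in_range:
  fixes d :: nat
  assumes "u permutes {1..d}" "i < k" "u k < u i"
  shows "i \<in> {1..d}" "k \<in> {1..d}"
proof -
  have i: "1 \<le> i"
  proof (rule ccontr)
    assume "\<not> 1 \<le> i"
    then show False using permutes_not_in[OF assms(1), of i] assms(3) by simp
  qed
  have k: "k \<le> d"
  proof (rule ccontr)
    assume "\<not> k \<le> d"
    then show False using permutes_not_in[OF assms(1), of k] permutes_not_in[OF assms(1), of i]
        permutes_le[OF assms(1), of i] assms(2,3) by (cases "i \<le> d") auto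
  qed
  show "i \<in> {1..d}" "k \<in> {1..d}" using i k assms(2) by auto
qed

lemma finite_inversions:
  assumes "u permutes {1..d::nat}"
  shows "finite {(i, k). i < k \<and> u k < u i}"
proof (rule finite_subset[of _ "{1..d} \<times> {1..d}"])
  show "{(i, k). i < k \<and> u k < u i} \<subseteq> {1..d} \<times> {1..d}"
    using inversion_in_range[OF assms] by blast
qed simp

lemma perm_length_eq:
  assumes "u permutes {1..d}"
  shows "perm_length u = (\<Sum>(t, t')\<in>pairs_upto d. if u t' < u t then 1 else 0)"
proof -
  have "{(i, j). i < j \<and> u j < u i} = {(t, t')\<in>pairs_upto d. u t' < u t}"
    using inversion_in_range[OF assms] by (fastforce simp: pairs_upto_def)
  then have "perm_length u = card {(t, t')\<in>pairs_upto d. u t' < u t}"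
    by (simp add: perm_length_def)
  also have "{(t, t')\<in>pairs_upto d. u t' < u t} = pairs_upto d \<inter> {(t, t'). u t' < u t}" by auto
  also have "card \<dots> = (\<Sum>x\<in>pairs_upto d. if x \<in> {(t, t'). u t' < u t} then 1 else 0)"
    by (simp add: sum.If_cases)
  also have "\<dots> = (\<Sum>(t, t')\<in>pairs_upto d. if u t' < u t then 1 else 0)"
    by (intro sum.cong) auto
  finally show ?thesis .
qed

text \<open>Compared pair by pair: the indicator of an inversion is the parity of the number of
  crossings, hence at most that number, with equality iff the pair crosses at most once. Equal sums
  force equality in every summand.\<close>

lemma
  assumes "pipe_dream d D"
  shows perm_length_pipe_perm_le: "perm_length (pipe_perm d D) \<le> card D"
    and reduced_iff_card: "reduced d D \<longleftrightarrow> card D = perm_length (pipe_perm d D)"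
proof -
  note len = perm_length_eq[OF pipe_perm_permutes[OF assms]]
  let ?f = "\<lambda>(t, t'). if pipe_perm d D t' < pipe_perm d D t then 1 else 0 :: nat"
  let ?g = "\<lambda>(t, t'). card (crossings D t t')"
  have odd: "?f x = (if odd (?g x) then 1 else 0)" if "x \<in> pairs_upto d" for x
    using that pipe_perm_inversion[OF assms] by (auto simp: pairs_upto_def)
  have le: "?f x \<le> ?g x" if "x \<in> pairs_upto d" for x
    using odd[OF that] by (cases "?g x") auto
  show "perm_length (pipe_perm d D) \<le> card D"
    unfolding len card_pipe_dream_eq_sum_crossings[OF assms] by (rule sum_mono[OF le])
  have "card D = perm_length (pipe_perm d D) \<longleftrightarrow> (\<forall>x\<in>pairs_upto d. ?f x = ?g x)"
  proof
    assume "card D = perm_length (pipe_perm d D)"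
    then have eq: "sum ?f (pairs_upto d) = sum ?g (pairs_upto d)"
      unfolding len card_pipe_dream_eq_sum_crossings[OF assms] by simp
    show "\<forall>x\<in>pairs_upto d. ?f x = ?g x"
    proof
      fix x assume "x \<in> pairs_upto d"
      from sum_mono_inv[OF eq le this] show "?f x = ?g x" by simp
    qed
  next
    assume "\<forall>x\<in>pairs_upto d. ?f x = ?g x"
    then show "card D = perm_length (pipe_perm d D)"
      unfolding len card_pipe_dream_eq_sum_crossings[OF assms] by (intro sum.cong) auto
  qed
  also have "\<dots> \<longleftrightarrow> (\<forall>x\<in>pairs_upto d. ?g x \<le> 1)"
  proof (intro ball_cong refl)
    fix x assume "x \<in> pairs_upto d"
    have "(if odd k then 1 else 0) = k \<longleftrightarrow> k \<le> 1" for k :: nat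
      by (cases k; cases "k - 1") auto
    then show "?f x = ?g x \<longleftrightarrow> ?g x \<le> 1" unfolding odd[OF \<open>x \<in> pairs_upto d\<close>] .
  qed
  also have "\<dots> \<longleftrightarrow> reduced d D"
  proof
    assume *: "\<forall>x\<in>pairs_upto d. ?g x \<le> 1"
    show "reduced d D" unfolding reduced_def
    proof (intro ballI impI)
      fix t t' assume "t \<in> {1..d}" "t' \<in> {1..d}" "t \<noteq> t'"
      then show "card (crossings D t t') \<le> 1"
        using *[rule_format, of "(t, t')"] *[rule_format, of "(t', t)"]
        by (cases "t < t'") (auto simp: pairs_upto_def crossings_sym[of D t t'])
    qed
  qed (auto simp: reduced_def pairs_upto_def)
  finally show "reduced d D \<longleftrightarrow> card D = perm_length (pipe_perm d D)" by blast
qed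

lemma reduced_pipe_dreams_iff:
  assumes "v permutes {1..d}"
  shows "D \<in> reduced_pipe_dreams d v \<longleftrightarrow>
    pipe_dream d D \<and> pipe_perm d D = v \<and> card D = perm_length v"
proof (cases "pipe_dream d D")
  case True
  note u = pipe_perm_permutes[OF True]
  have "(\<forall>q\<in>{1..d}. pipe D q South 0 (v q)) \<longleftrightarrow> (\<forall>q\<in>{1..d}. v q = pipe_perm d D q)"
    using pipe_perm_exit[OF True] by blast
  also have "\<dots> \<longleftrightarrow> pipe_perm d D = v"
  proof
    assume "\<forall>q\<in>{1..d}. v q = pipe_perm d D q"
    then show "pipe_perm d D = v"
      using permutes_not_in[OF u] permutes_not_in[OF assms] by (metis ext)
  qed auto
  finally show ?thesis using reduced_iff_card[OF True] True
    by (auto simp: reduced_pipe_dreams_def)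
qed (simp add: reduced_pipe_dreams_def)

section \<open>Ranks\<close>

lemma (in vec_space) indep_empty: "lin_indpt {}"
  by (rule finite_lin_indpt2) auto

lemma (in vec_space) rank_le_card_spanning:
  assumes "A \<in> carrier_mat n nc" "finite B" "B \<subseteq> carrier_vec n" "set (cols A) \<subseteq> span B"
  shows "rank A \<le> card B"
proof -
  obtain S where S: "finite S" "maximal S (\<lambda>T. T \<subseteq> set (cols A) \<and> lin_indpt T)"
    using maximal_exists_superset[of "set (cols A)" "\<lambda>T. T \<subseteq> set (cols A) \<and> lin_indpt T" "{}"]
    using indep_empty by auto
  then have "S \<subseteq> span B" "lin_indpt S" using assms(4) by (auto simp: maximal_def)
  from replacement[OF S(1) assms(2) _ this(2,1)] assms(3)
  have "card S \<le> card B" by auto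
  then show ?thesis using rank_card_indpt[OF assms(1) S(2)] by simp
qed

lemma (in vec_space) indep_superset_spanning:
  assumes "finite X" "X \<subseteq> carrier_vec n" "U \<subseteq> X" "lin_indpt U"
  shows "\<exists>W. U \<subseteq> W \<and> W \<subseteq> X \<and> lin_indpt W \<and> X \<subseteq> span W \<and>
    maximal W (\<lambda>T. T \<subseteq> X \<and> lin_indpt T)"
proof -
  obtain W where W: "finite W" "maximal W (\<lambda>T. T \<subseteq> X \<and> lin_indpt T)" "U \<subseteq> W"
    using maximal_exists_superset[of X "\<lambda>T. T \<subseteq> X \<and> lin_indpt T" U] assms by blast
  then have WX: "W \<subseteq> X" and li: "lin_indpt W" by (auto simp: maximal_def)
  have Wc: "W \<subseteq> carrier_vec n" using WX assms(2) by blast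
  have "x \<in> span W" if x: "x \<in> X" for x
  proof (cases "x \<in> W")
    case True
    then show ?thesis using in_own_span[of W] Wc by auto
  next
    case False
    show ?thesis
    proof (rule ccontr)
      assume "x \<notin> span W"
      then have "lin_indpt (W \<union> {x})"
        using lin_dep_iff_in_span[of W x] Wc li False x assms(2) by auto
      then have "W \<union> {x} = W" using W(2) WX x unfolding maximal_def by blast
      then show False using False by blast
    qed
  qed
  then show ?thesis using W WX li by blast
qed

lemma (in vec_space) mem_span_cols_iff:
  assumes "A \<in> carrier_mat n nc"
  shows "x \<in> span (set (cols A)) \<longleftrightarrow> (\<exists>y\<in>carrier_vec nc. A *\<^sub>v y = x)"
  using col_space_eq[OF assms] assms by (auto simp: col_space_def)

text \<open>With the elements of \<open>X\<close> as the columns of a matrix \<open>M\<close>,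
  membership in the span reads \<open>x = M *\<^sub>v y\<close>, and the claim becomes associativity
  of multiplication.\<close>

lemma mult_mat_vec_in_span_image:
  fixes A :: "'k::field mat"
  assumes A: "A \<in> carrier_mat a b" and X: "finite X" "X \<subseteq> carrier_vec b"
    and x: "x \<in> LinearCombinations.module.span class_ring (module_vec TYPE('k) b) X"
  shows "A *\<^sub>v x \<in> LinearCombinations.module.span class_ring (module_vec TYPE('k) a) ((*\<^sub>v) A ` X)"
proof -
  interpret Va: vec_space "TYPE('k)" a .
  interpret Vb: vec_space "TYPE('k)" b .
  obtain xs where xs: "set xs = X" using finite_list[OF X(1)] by blast
  define M where "M = mat_of_cols b xs"
  have M: "M \<in> carrier_mat b (length xs)" by (simp add: M_def)
  have cols: "cols M = xs" using X(2) xs by (simp add: M_def)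
  obtain y where y: "y \<in> carrier_vec (length xs)" "M *\<^sub>v y = x"
    using x Vb.mem_span_cols_iff[OF M] by (auto simp: cols xs)
  have AM: "A * M \<in> carrier_mat a (length xs)" using A M by simp
  have "(A * M) *\<^sub>v y = A *\<^sub>v x" using y A M by (simp add: assoc_mult_mat_vec)
  then have "A *\<^sub>v x \<in> Va.span (set (cols (A * M)))"
    using Va.mem_span_cols_iff[OF AM] y(1) by blast
  moreover have "set (cols (A * M)) = (*\<^sub>v) A ` X"
  proof -
    have "cols (A * M) = map (\<lambda>j. A *\<^sub>v col M j) [0..<length xs]"
      using A M by (auto simp: cols_def intro!: nth_equalityI)
    also have "set \<dots> = (*\<^sub>v) A ` set (cols M)" using M by (auto simp: cols_def)
    finally show ?thesis by (simp add: cols xs)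
  qed
  ultimately show ?thesis by simp
qed

lemma mem_cols_mult:
  assumes "A \<in> carrier_mat a b" "B \<in> carrier_mat b c" "x \<in> set (cols (A * B))"
  obtains j where "j < c" "x = A *\<^sub>v col B j"
proof -
  obtain j where j: "j < dim_col (A * B)" "x = col (A * B) j"
    using assms(3) by (metis cols_length cols_nth in_set_conv_nth)
  then have "j < c" using assms(2) by simp
  with that col_mult2[OF assms(1,2) this] j(2) show ?thesis by simp
qed

text \<open>
  A basis \<open>U\<close> of the columns of \<open>B C\<close> extends to a basis \<open>W\<close> of the column space of \<open>B\<close>;
  the image under \<open>A\<close> of \<open>U\<close> lies in the column space of \<open>A B C\<close>, and \<open>W - U\<close> has
  \<open>rank B - rank (B C)\<close> elements.
\<close>

lemma Frobenius_rank_inequality: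
  fixes A B C :: "'k::field mat"
  assumes A: "A \<in> carrier_mat a b" and B: "B \<in> carrier_mat b c" and C: "C \<in> carrier_mat c e"
  shows "vec_space.rank a (A * B) + vec_space.rank b (B * C) \<le> vec_space.rank b B + vec_space.rank a (A * B * C)"
proof -
  interpret Va: vec_space "TYPE('k)" a .
  interpret Vb: vec_space "TYPE('k)" b .
  have carr: "A * B \<in> carrier_mat a c" "B * C \<in> carrier_mat b e" "A * B * C \<in> carrier_mat a e"
    using A B C by auto
  have cols_sub: "set (cols M) \<subseteq> carrier_vec p" if "M \<in> carrier_mat p q" for M :: "'k mat" and p q
    using cols_dim[of M] that by auto
  obtain U where U: "U \<subseteq> set (cols (B * C))" "Vb.lin_indpt U"
    "maximal U (\<lambda>T. T \<subseteq> set (cols (B * C)) \<and> Vb.lin_indpt T)"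
    using Vb.indep_superset_spanning[OF finite_set cols_sub[OF carr(2)] empty_subsetI Vb.indep_empty] by (elim exE conjE) (rule that)
  obtain V0 where V0: "V0 \<subseteq> set (cols B)" "set (cols B) \<subseteq> Vb.span V0"
    "maximal V0 (\<lambda>T. T \<subseteq> set (cols B) \<and> Vb.lin_indpt T)"
    using Vb.indep_superset_spanning[OF finite_set cols_sub[OF B] empty_subsetI Vb.indep_empty] by (elim exE conjE) (rule that)
  obtain V where V: "V \<subseteq> set (cols (A * B * C))" "set (cols (A * B * C)) \<subseteq> Va.span V"
    "maximal V (\<lambda>T. T \<subseteq> set (cols (A * B * C)) \<and> Va.lin_indpt T)"
    using Va.indep_superset_spanning[OF finite_set cols_sub[OF carr(3)] empty_subsetI Va.indep_empty] by (elim exE conjE) (rule that)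
  \<comment> \<open>An extension of \<open>U\<close> may have to mix columns of \<open>B * C\<close>
    with columns of \<open>B\<close>, so \<open>W\<close> is not a set of columns of
    \<open>B\<close>. Its size is compared with \<open>rank B\<close> through \<open>V0\<close>,
    which spans the same columns.\<close>
  let ?X = "set (cols (B * C)) \<union> set (cols B)"
  have X: "finite ?X" "?X \<subseteq> carrier_vec b" using cols_sub[OF carr(2)] cols_sub[OF B] by auto
  obtain W where W: "U \<subseteq> W" "W \<subseteq> ?X" "Vb.lin_indpt W" "?X \<subseteq> Vb.span W"
    using Vb.indep_superset_spanning[OF X le_supI1[OF U(1)] U(2)] by (elim exE conjE) (rule that)
  have finW: "finite W" using W(2) X(1) by (rule finite_subset)
  have Wc: "W \<subseteq> carrier_vec b" using W(2) X(2) by blast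
  have V0c: "V0 \<subseteq> carrier_vec b" using V0(1) cols_sub[OF B] by blast
  have Vc: "V \<subseteq> carrier_vec a" using V(1) cols_sub[OF carr(3)] by blast
  have "set (cols (B * C)) \<subseteq> Vb.span (set (cols B))"
  proof
    fix x assume "x \<in> set (cols (B * C))"
    with B C obtain j where "j < e" "x = B *\<^sub>v col C j" by (rule mem_cols_mult)
    then show "x \<in> Vb.span (set (cols B))" using Vb.mem_span_cols_iff[OF B] C by auto
  qed
  also have "\<dots> \<subseteq> Vb.span V0"
    using Vb.span_is_subset[OF V0(2) Vb.span_is_submodule] V0c by auto
  finally have "W \<subseteq> Vb.span V0" using W(2) V0(2) by blast
  from Vb.replacement[OF finW _ _ W(3) this] V0c have "card W \<le> card V0"
    using finite_subset[OF V0(1)] by auto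
  then have cardW: "card W \<le> Vb.rank B" using Vb.rank_card_indpt[OF B V0(3)] by simp
  let ?Y = "V \<union> (*\<^sub>v) A ` (W - U)"
  have Yc: "?Y \<subseteq> carrier_vec a" using Vc Wc A by auto
  have sub: "Va.span ?Y \<supseteq> Va.span ((*\<^sub>v) A ` W)"
  proof (rule Va.span_is_subset)
    show "(*\<^sub>v) A ` W \<subseteq> Va.span ?Y"
    proof (rule image_subsetI)
      fix w assume w: "w \<in> W"
      show "A *\<^sub>v w \<in> Va.span ?Y"
      proof (cases "w \<in> U")
        case True
        then have "w \<in> set (cols (B * C))" using U(1) by blast
        with B C obtain j where j: "j < e" "w = B *\<^sub>v col C j" by (rule mem_cols_mult)
        have "col (A * B * C) j = (A * B) *\<^sub>v col C j" by (rule col_mult2[OF carr(1) C j(1)])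
        also have "\<dots> = A *\<^sub>v w" unfolding j(2) using C j(1) by (intro assoc_mult_mat_vec[OF A B]) auto
        finally have "A *\<^sub>v w = col (A * B * C) j" ..
        then have "A *\<^sub>v w \<in> set (cols (A * B * C))" using j C by (auto simp: cols_def)
        then have "A *\<^sub>v w \<in> Va.span V" using V(2) by blast
        then show ?thesis using Va.span_is_monotone[of V ?Y] by auto
      next
        case False
        then show ?thesis using w Va.in_own_span[of ?Y] Yc by auto
      qed
    qed
    show "submodule class_ring (Va.span ?Y) (module_vec TYPE('k) a)"
      using Va.span_is_submodule Yc by simp
  qed
  have "set (cols (A * B)) \<subseteq> Va.span ?Y"
  proof
    fix x assume "x \<in> set (cols (A * B))"
    with A B obtain j where j: "j < c" "x = A *\<^sub>v col B j" by (rule mem_cols_mult)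
    then have "col B j \<in> Vb.span W" using W(4) B by (auto simp: cols_def)
    from mult_mat_vec_in_span_image[OF A finW Wc this] show "x \<in> Va.span ?Y" using j sub by auto
  qed
  moreover have finV: "finite V" using V(1) by (rule finite_subset) simp
  ultimately have "Va.rank (A * B) \<le> card ?Y"
    using Va.rank_le_card_spanning[OF carr(1) _ Yc] finW by auto
  also have "\<dots> \<le> card V + card (W - U)"
    using card_Un_le[of V] card_image_le[of "W - U" "(*\<^sub>v) A"] finW by (meson finite_Diff add_left_mono le_trans)
  also have "\<dots> = card V + (card W - card U)" using W(1) finW finite_subset by (subst card_Diff_subset) auto
  finally have "Va.rank (A * B) \<le> card V + (card W - card U)" .
  moreover have "card U \<le> card W" using W(1) finW by (rule card_mono[rotated])
  ultimately show ?thesis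
    using cardW Vb.rank_card_indpt[OF carr(2) U(3)] Va.rank_card_indpt[OF carr(3) V(3)] by simp
qed

lemma (in vec_space) rank_one: "rank (1\<^sub>m n) = n"
  using det_rank_iff[of "1\<^sub>m n"] by simp

text \<open>
  The columns of a partial permutation matrix are distinct unit vectors and zero vectors.
\<close>

lemma rank_indicator_mat:
  fixes P :: "nat \<Rightarrow> nat \<Rightarrow> bool"
  assumes inj: "\<And>p p' q. p < a \<Longrightarrow> p' < a \<Longrightarrow> q < b \<Longrightarrow> P p q \<Longrightarrow> P p' q \<Longrightarrow> p = p'"
    and inj': "\<And>p q q'. p < a \<Longrightarrow> q < b \<Longrightarrow> q' < b \<Longrightarrow> P p q \<Longrightarrow> P p q' \<Longrightarrow> q = q'"
  shows "vec_space.rank a (mat a b (\<lambda>(p, q). if P p q then 1 else 0) :: 'k::field mat) =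
    card {(p, q). p < a \<and> q < b \<and> P p q}"
proof -
  interpret V: vec_space "TYPE('k)" a .
  let ?M = "mat a b (\<lambda>(p, q). if P p q then 1 else 0) :: 'k mat"
  let ?I = "{(p, q). p < a \<and> q < b \<and> P p q}"
  define S :: "'k vec set" where "S = unit_vec a ` fst ` ?I"
  have col1: "col ?M q = unit_vec a p" if "p < a" "q < b" "P p q" for p q
    using that inj by (intro eq_vecI) (auto simp: unit_vec_def)
  have col0: "col ?M q = 0\<^sub>v a" if "q < b" "\<And>p. p < a \<Longrightarrow> \<not> P p q" for q
    using that by (intro eq_vecI) auto
  have cols: "set (cols ?M) = col ?M ` {..<b}" by (auto simp: cols_def)
  have S_sub: "S \<subseteq> set (cols ?M)" unfolding S_def cols using col1 by force
  have cols_sub: "set (cols ?M) \<subseteq> insert (0\<^sub>v a) S"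
    unfolding S_def cols
  proof (rule image_subsetI)
    fix q assume "q \<in> {..<b}"
    then show "col ?M q \<in> insert (0\<^sub>v a) (unit_vec a ` fst ` ?I)"
      using col1 col0[of q] by (cases "\<exists>p<a. P p q") (force, auto)
  qed
  have "S \<subseteq> set (unit_vecs a)" by (auto simp: S_def unit_vecs_def)
  then have li: "V.lin_indpt S"
    using V.unit_vecs_basis V.subset_li_is_li unfolding V.basis_def by blast
  have "maximal S (\<lambda>T. T \<subseteq> set (cols ?M) \<and> V.lin_indpt T)"
    unfolding maximal_def
  proof (intro conjI allI impI S_sub li)
    fix T assume T: "S \<subseteq> T \<and> T \<subseteq> set (cols ?M) \<and> V.lin_indpt T"
    have "T \<subseteq> carrier_vec a" using T cols_dim[of ?M] by auto
    then have "0\<^sub>v a \<notin> T" using V.vs_zero_lin_dep[of T] T by auto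
    then show "T = S" using T cols_sub by blast
  qed
  then have "V.rank ?M = card S" by (rule V.rank_card_indpt[rotated, where nc = b]) simp
  also have "\<dots> = card (fst ` ?I)" unfolding S_def
    by (rule card_image) (auto simp: inj_on_def)
  also have "\<dots> = card ?I"
    using inj' by (intro card_image) (auto simp: inj_on_def)
  finally show ?thesis .
qed

section \<open>Products along paths and nonnegativity of the lace counts\<close>

lemma path_prod_Suc:
  assumes "i \<le> j"
  shows "path_prod \<phi> i (Suc j) = path_prod \<phi> i j * \<phi> ! j"
  using assms by (simp add: path_prod_def)

lemma HomD:
  assumes "\<phi> \<in> Hom n ds" "i < n"
  shows "\<phi> ! i \<in> carrier_mat (ds i) (ds (Suc i))"
  using assms unfolding Hom_def by (auto dest!: bspec[of _ _ "Suc i"])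

lemma path_prod_self:
  assumes "\<phi> \<in> Hom n ds" "i < n"
  shows "path_prod \<phi> i i = 1\<^sub>m (ds i)"
  using HomD[OF assms] by (simp add: path_prod_def)

lemma path_prod_carrier:
  assumes "\<phi> \<in> Hom n ds" "i \<le> j" "j \<le> n" "i < n"
  shows "path_prod \<phi> i j \<in> carrier_mat (ds i) (ds j)"
  using assms(2,3)
proof (induction j rule: dec_induct)
  case base
  then show ?case using path_prod_self[OF assms(1,4)] by simp
next
  case (step j)
  then show ?case using HomD[OF assms(1), of j] by (auto simp: path_prod_Suc)
qed

lemma path_prod_append:
  assumes "\<phi> \<in> Hom n ds" "i \<le> j" "j \<le> k" "k \<le> n" "j < n"
  shows "path_prod \<phi> i k = path_prod \<phi> i j * path_prod \<phi> j k"
  using assms(3,4)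
proof (induction k rule: dec_induct)
  case base
  then show ?case
    using path_prod_self[OF assms(1,5)] path_prod_carrier[OF assms(1,2)] assms by simp
next
  case (step k)
  have "path_prod \<phi> i (Suc k) = path_prod \<phi> i j * path_prod \<phi> j k * \<phi> ! k"
    using step assms(2) by (simp add: path_prod_Suc)
  also have "\<dots> = path_prod \<phi> i j * (path_prod \<phi> j k * \<phi> ! k)"
    using path_prod_carrier[OF assms(1,2)] path_prod_carrier[OF assms(1) step(1)] HomD[OF assms(1), of k] step assms
    by (intro assoc_mult_mat) auto
  finally show ?case using step by (simp add: path_prod_Suc)
qed

text \<open>This is the Frobenius inequality for the product of the matrices along
  \<open>i - 1 \<rightarrow> i \<rightarrow> j \<rightarrow> j + 1\<close>. The zeros of
  \<open>rank_ext\<close> outside the range are the ranks of matrices without rows or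
  columns.\<close>

lemma lace_count_nonneg:
  assumes "can_occur TYPE('k::field) n r" "1 \<le> n" "i \<le> j" "j \<le> n"
  shows "0 \<le> lace_count n r (int i) (int j)"
proof -
  define ds where "ds = (\<lambda>i. r i i)"
  obtain \<phi> :: "'k mat list" where phi: "\<phi> \<in> Hom n ds"
    and r: "\<And>i j. i \<le> j \<Longrightarrow> j \<le> n \<Longrightarrow> rank_array ds \<phi> i j = r i j"
    using assms(1) unfolding can_occur_def has_rank_array_def ds_def by blast
  \<comment> \<open>For \<open>i = n\<close>, \<open>path_prod\<close> would take the size of its
    identity matrix from \<open>\<phi> ! n\<close>, which lies beyond the list; the identity is
    supplied by hand.\<close>
  define Q where "Q i j = (if i < n then path_prod \<phi> i j else 1\<^sub>m (ds n))" for i j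
  have Q: "Q i j \<in> carrier_mat (ds i) (ds j)" if "i \<le> j" "j \<le> n" for i j
  proof (cases "i < n")
    case False
    then have "i = n" "j = n" using that by simp_all
    then show ?thesis by (simp add: Q_def)
  qed (use path_prod_carrier[OF phi that] in \<open>simp add: Q_def\<close>)
  have rank_Q: "vec_space.rank (ds i) (Q i j) = r i j" if "i \<le> j" "j \<le> n" for i j
  proof (cases "i = j")
    case True
    then have "i < n \<or> i = n" using that by linarith
    then have "Q i j = 1\<^sub>m (ds i)" using True path_prod_self[OF phi, of i]
      by (cases "i < n") (simp_all add: Q_def)
    then show ?thesis using True by (simp add: vec_space.rank_one) (simp add: ds_def)
  next
    case False
    then show ?thesis using r[OF that] that by (simp add: rank_array_def Q_def)
  qed
  have Q_mult: "Q i j * Q j k = Q i k" if "i \<le> j" "j \<le> k" "k \<le> n" for i j k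
  proof (cases "j < n")
    case True
    then show ?thesis using path_prod_append[OF phi that True] that by (simp add: Q_def)
  next
    case False
    then have "j = n" "k = n" using that by simp_all
    moreover have "Q n n = 1\<^sub>m (ds n)" by (simp add: Q_def)
    ultimately show ?thesis using Q[of i n] that by simp
  qed
  define A where "A = (if i = 0 then 0\<^sub>m 0 (ds i) else Q (i - 1) i)"
  define a where "a = (if i = 0 then 0 else ds (i - 1))"
  define C where "C = (if j = n then 0\<^sub>m (ds j) 0 else Q j (Suc j))"
  define e where "e = (if j = n then 0 else ds (Suc j))"
  have A: "A \<in> carrier_mat a (ds i)" using Q[of "i - 1" i] assms by (auto simp: A_def a_def)
  have C: "C \<in> carrier_mat (ds j) e" using Q[of j "Suc j"] assms by (auto simp: C_def e_def)
  note B = Q[OF assms(3,4)]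
  have AB: "int (vec_space.rank a (A * Q i j)) = rank_ext n r (int i - 1) (int j)"
  proof (cases "i = 0")
    case True
    then have "A * Q i j = 0\<^sub>m 0 (ds j)" using B by (simp add: A_def)
    then show ?thesis using True by (simp add: a_def rank_ext_def vec_space.rank_0I)
  next
    case False
    then have "A * Q i j = Q (i - 1) j" using Q_mult[of "i - 1" i j] assms by (simp add: A_def)
    then show ?thesis using False rank_Q[of "i - 1" j] assms
      by (simp add: a_def rank_ext_def nat_diff_distrib)
  qed
  have BC: "int (vec_space.rank (ds i) (Q i j * C)) = rank_ext n r (int i) (int j + 1)"
  proof (cases "j = n")
    case True
    then have "Q i j * C = 0\<^sub>m (ds i) 0" using B by (simp add: C_def)
    then show ?thesis using True by (simp add: rank_ext_def vec_space.rank_0I)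
  next
    case False
    then have "Q i j * C = Q i (Suc j)" using Q_mult[of i j "Suc j"] assms by (simp add: C_def)
    then show ?thesis using False rank_Q[of i "Suc j"] assms
      by (simp add: rank_ext_def nat_add_distrib)
  qed
  have ABC: "int (vec_space.rank a (A * Q i j * C)) = rank_ext n r (int i - 1) (int j + 1)"
  proof (cases "i = 0 \<or> j = n")
    case True
    then have "A * Q i j * C = 0\<^sub>m a e" using A B C by (auto simp: A_def C_def a_def e_def)
    then show ?thesis using True by (auto simp: rank_ext_def vec_space.rank_0I)
  next
    case False
    then have "A * Q i j * C = Q (i - 1) (Suc j)"
      using Q_mult[of "i - 1" i j] Q_mult[of "i - 1" j "Suc j"] assms by (simp add: A_def C_def)
    then show ?thesis using False rank_Q[of "i - 1" "Suc j"] assms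
      by (simp add: a_def rank_ext_def nat_diff_distrib nat_add_distrib)
  qed
  have "int (vec_space.rank (ds i) (Q i j)) = rank_ext n r (int i) (int j)"
    using rank_Q assms by (simp add: rank_ext_def)
  with Frobenius_rank_inequality[OF A B C] AB BC ABC show ?thesis
    by (simp add: lace_count_def)
qed

section \<open>The rank array of the lacing diagram of a pipe dream\<close>

lemma row_offset_0 [simp]: "row_offset r 0 = 0"
  by (simp add: row_offset_def)

lemma row_offset_Suc: "row_offset r (Suc j) = row_offset r j + r j j"
  by (simp add: row_offset_def)

lemma col_end_step: "i \<le> n \<Longrightarrow> col_end n r i = r i i + col_end n r (Suc i)"
  unfolding col_end_def by (rule sum.atLeast_Suc_atMost)

lemma col_end_beyond [simp]: "n < i \<Longrightarrow> col_end n r i = 0"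
  by (simp add: col_end_def)

lemma row_offset_total: "row_offset r (Suc n) = total_dim n r"
  by (simp add: row_offset_def total_dim_def lessThan_Suc_atMost)

lemma col_end_total: "col_end n r 0 = total_dim n r"
  by (simp add: col_end_def total_dim_def atMost_atLeast0)

lemma row_offset_plus_col_end:
  "j \<le> Suc n \<Longrightarrow> row_offset r j + col_end n r j = total_dim n r"
proof (induction j)
  case 0
  then show ?case by (simp add: col_end_total)
next
  case (Suc j)
  then show ?case using col_end_step[of j n r] by (simp add: row_offset_Suc)
qed

lemma row_offset_mono: "i \<le> j \<Longrightarrow> row_offset r i \<le> row_offset r j"
  unfolding row_offset_def by (rule sum_mono2) auto

lemma col_end_antimono: "i \<le> j \<Longrightarrow> col_end n r j \<le> col_end n r i"
  unfolding col_end_def by (rule sum_mono2) auto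

lemma block_row_below:
  assumes "1 \<le> q" "q \<le> row_offset r j"
  obtains k where "k < j" "q \<in> block_row r k"
proof -
  have "\<exists>k<j. q \<in> block_row r k" using assms(2)
  proof (induction j)
    case 0
    then show ?case using assms(1) by simp
  next
    case (Suc j)
    show ?case
    proof (cases "q \<le> row_offset r j")
      case True
      with Suc.IH show ?thesis by (auto intro: less_SucI)
    next
      case False
      with Suc.prems show ?thesis by (auto simp: block_row_def)
    qed
  qed
  with that show ?thesis by blast
qed

lemma block_col_right:
  assumes "1 \<le> p" "p \<le> col_end n r i"
  obtains k where "i \<le> k" "k \<le> n" "p \<in> block_col n r k"
proof -
  have "\<exists>k\<ge>i. k \<le> n \<and> p \<in> block_col n r k" if "i \<le> Suc n" using that assms(2)
  proof (induction i rule: inc_induct)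
    case base
    then show ?case using assms(1) by simp
  next
    case (step i)
    show ?case
    proof (cases "p \<le> col_end n r (Suc i)")
      case True
      with step.IH show ?thesis by (meson Suc_leD)
    next
      case False
      with step show ?thesis by (auto simp: block_col_def)
    qed
  qed
  moreover have "i \<le> Suc n" using assms by (cases "n < i") auto
  ultimately show ?thesis using that by blast
qed

lemma block_row_unique:
  assumes "q \<in> block_row r j" "q \<in> block_row r k"
  shows "j = k"
  using assms row_offset_mono[of "Suc j" k r] row_offset_mono[of "Suc k" j r]
  by (cases j k rule: linorder_cases) (auto simp: block_row_def)

lemma block_col_unique:
  assumes "q \<in> block_col n r j" "q \<in> block_col n r k"
  shows "j = k"
  using assms col_end_antimono[of "Suc j" k n r] col_end_antimono[of "Suc k" j n r]
  by (cases j k rule: linorder_cases) (auto simp: block_col_def)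

text \<open>The boxes strictly northwest of the superantidiagonal blocks.\<close>

definition hom_boxes :: "nat \<Rightarrow> (nat \<Rightarrow> nat \<Rightarrow> nat) \<Rightarrow> (nat \<times> nat) set" where
  "hom_boxes n r = {(q, p). \<exists>j\<le>n. q \<in> block_row r j \<and> 1 \<le> p \<and> p \<le> col_end n r (j + 2)}"

text \<open>The region is a staircase whose higher rows reach further right, so it contains the
  whole rectangle northwest of the \<open>j\<close>-th antidiagonal block.\<close>

lemma hom_boxesI:
  assumes "1 \<le> q" "q \<le> row_offset r j" "j \<le> Suc n" "1 \<le> p" "p \<le> col_end n r (Suc j)"
  shows "(q, p) \<in> hom_boxes n r"
proof -
  obtain k where "k < j" "q \<in> block_row r k" using block_row_below[OF assms(1,2)] .
  then show ?thesis using assms col_end_antimono[of "k + 2" "Suc j" n r]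
    by (auto simp: hom_boxes_def intro!: exI[of _ k])
qed

definition corner_count :: "nat \<Rightarrow> (nat \<Rightarrow> nat \<Rightarrow> nat) \<Rightarrow> (nat \<Rightarrow> nat) \<Rightarrow> nat \<Rightarrow> nat \<Rightarrow> nat" where
  "corner_count n r u i j =
     card {t. row_offset r j < t \<and> t \<le> total_dim n r \<and> col_end n r (Suc i) < u t}"

lemma pipe_levels_steps:
  assumes "pipe D t South q p" "pipe D t South q' p'" "q' \<le> q"
  shows "((South, q, p), (South, q', p')) \<in> (pipe_step D)\<^sup>*"
proof -
  have "((South, q, p), (South, q', p')) \<in> (pipe_step D)\<^sup>* \<or> ((South, q', p'), (South, q, p)) \<in> (pipe_step D)\<^sup>*"
    using single_valued_confluent[OF single_valued_pipe_step] assms by (simp add: pipe_iff_steps)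
  then show ?thesis using assms(3) by (auto dest!: steps_mono)
qed

lemma pipe_column_mono:
  assumes "pipe D t South q p" "pipe D t South q' p'" "q' \<le> q"
  shows "p \<le> p'"
  using steps_mono[OF pipe_levels_steps[OF assms]] by auto

lemma pipe_straight_up:
  assumes "pipe D t South q p" "\<And>q'. 1 \<le> q' \<Longrightarrow> q' \<le> q \<Longrightarrow> (q', p) \<in> D"
  shows "pipe D t South 0 p"
  using assms
proof (induction q)
  case (Suc q)
  have "pipe D t South q p" using Suc.prems by (auto intro: pipe.south_cross[OF Suc.prems(1)])
  with Suc show ?case by simp
qed

lemma meets_block_top_pipe_unique:
  "meets_block_top n r D t j p \<Longrightarrow> meets_block_top n r D t' j p \<Longrightarrow> t = t'"
  unfolding meets_block_top_def by (rule pipe_edge_unique)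

lemma meets_block_top_pos_unique:
  assumes "meets_block_top n r D t j p" "meets_block_top n r D t j p'"
    "p < r j j" "p' < r j j" "j \<le> n"
  shows "p = p'"
proof -
  have "col_end n r j - p = col_end n r j - p'"
    using assms(1,2) unfolding meets_block_top_def by (rule pipe_level_unique)
  then show ?thesis using assms(3-5) col_end_step[of j n r] by linarith
qed

text \<open>At most one summand is nonzero, so the entries of the product stay 0 or 1 in every
  characteristic.\<close>

lemma sum_indicator_mult:
  fixes m :: nat
  assumes "\<And>k k'. k < m \<Longrightarrow> k' < m \<Longrightarrow> P k \<Longrightarrow> P k' \<Longrightarrow> k = k'"
  shows "(\<Sum>k = 0..<m. (if P k then 1 else 0) * (if Q k then 1 else 0)) =
    (if \<exists>k<m. P k \<and> Q k then 1 else (0 :: 'k :: field))"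
proof -
  have *: "(\<Sum>k = 0..<m. (if P k then 1 else 0) * (if Q k then 1 else 0)) = (\<Sum>k = 0..<m. if P k \<and> Q k then 1 else (0::'k))"
    by (intro sum.cong) auto
  show ?thesis
  proof (cases "\<exists>k<m. P k \<and> Q k")
    case True
    then obtain k where k: "k < m" "P k" "Q k" by blast
    have "(if P l \<and> Q l then 1 else (0::'k)) = (if l = k then 1 else 0)" if "l \<in> {0..<m}" for l
      using assms[OF _ k(1) _ k(2), of l] k(2,3) that by (cases "l = k") auto
    then have "(\<Sum>k = 0..<m. if P k \<and> Q k then 1 else (0::'k)) = (\<Sum>l = 0..<m. if l = k then 1 else 0)"
      by (intro sum.cong refl) blast
    also have "\<dots> = 1" using k(1) by simp
    finally show ?thesis unfolding * using True by simp
  next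
    case False
    then show ?thesis unfolding * by (auto intro!: sum.neutral)
  qed
qed

section \<open>Pipes through the antidiagonal blocks\<close>

locale hom_pipe_dream =
  fixes n :: nat and r :: "nat \<Rightarrow> nat \<Rightarrow> nat" and D :: "(nat \<times> nat) set"
  assumes pd: "pipe_dream (total_dim n r) D" and hom: "hom_boxes n r \<subseteq> D"
begin

abbreviation "u \<equiv> pipe_perm (total_dim n r) D"

text \<open>Northwest of the block there are only crossings, so a pipe that reaches level
  \<open>row_offset r j\<close> to the left of the block goes straight up and exits to the left of
  it. A pipe that is further right stays right, since columns never decrease. The right boundary of
  the block is the antidiagonal, beyond which pipes with \<open>t \<le> d\<close> do not go.\<close>

lemma meets_block_top_iff:
  assumes "j \<le> n" "t \<in> {1..total_dim n r}"
  shows "(\<exists>p<r j j. meets_block_top n r D t j p) \<longleftrightarrow> row_offset r j < t \<and> col_end n r (Suc j) < u t"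
proof
  assume "\<exists>p<r j j. meets_block_top n r D t j p"
  then obtain p where p: "p < r j j" "pipe D t South (row_offset r j) (col_end n r j - p)"
    by (auto simp: meets_block_top_def)
  have "col_end n r (Suc j) < col_end n r j - p"
    using p(1) col_end_step[OF assms(1), of r] by linarith
  also have "pipe D t South 0 (u t)" using pipe_perm_exit[OF pd assms(2)] by blast
  then have "col_end n r j - p \<le> u t" using pipe_column_mono[OF p(2)] by simp
  finally show "row_offset r j < t \<and> col_end n r (Suc j) < u t" using pipe_bounds[OF p(2)] by simp
next
  assume *: "row_offset r j < t \<and> col_end n r (Suc j) < u t"
  then obtain x where x: "pipe D t South (row_offset r j) x"
    using pipe_level_exists[OF pd] by blast
  have xpos: "1 \<le> x" using pipe_bounds[OF x] by simp
  have "col_end n r (Suc j) < x"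
  proof (rule ccontr)
    assume "\<not> col_end n r (Suc j) < x"
    then have "pipe D t South 0 x"
      using hom xpos assms(1) by (intro pipe_straight_up[OF x]) (auto intro!: hom_boxesI[of _ r j, THEN subsetD[OF hom]])
    then have "u t = x" using pipe_perm_exit[OF pd assms(2), of x] by simp
    with \<open>\<not> col_end n r (Suc j) < x\<close> * show False by simp
  qed
  moreover have "x \<le> col_end n r j"
    using pipe_edge_index[OF x pd] assms row_offset_plus_col_end[of j n r] by (auto simp: edge_index_def)
  ultimately have "col_end n r j - x < r j j" "col_end n r j - (col_end n r j - x) = x"
    using col_end_step[OF assms(1), of r] by linarith+
  with x show "\<exists>p<r j j. meets_block_top n r D t j p" unfolding meets_block_top_def
    by (intro exI[of _ "col_end n r j - x"]) simp
qed

lemma meets_block_top_exists: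
  assumes "j \<le> n" "p < r j j"
  shows "\<exists>t\<in>{1..total_dim n r}. meets_block_top n r D t j p"
proof -
  have "1 \<le> col_end n r j - p" using assms col_end_step[of j n r] by linarith
  then obtain t where t: "1 \<le> t" "pipe D t South (row_offset r j) (col_end n r j - p)"
    using pipe_edge_exists[OF pd, of _ South] by blast
  have "t \<le> total_dim n r"
    using pipe_edge_index[OF t(2) pd] row_offset_plus_col_end[of j n r] assms(1)
    by (auto simp: edge_index_def split: if_splits)
  with t show ?thesis by (auto simp: meets_block_top_def)
qed

definition joined :: "nat \<Rightarrow> nat \<Rightarrow> nat \<Rightarrow> nat \<Rightarrow> bool" where
  "joined i j p q \<longleftrightarrow> (\<exists>t\<in>{1..total_dim n r}. meets_block_top n r D t i p \<and> meets_block_top n r D t j q)"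

lemma joined_inj:
  assumes "joined i j p q" "joined i j p' q" "i \<le> n" "j \<le> n" "p < r i i" "p' < r i i" "q < r j j"
  shows "p = p'"
proof -
  obtain t t' where "meets_block_top n r D t i p" "meets_block_top n r D t j q"
    "meets_block_top n r D t' i p'" "meets_block_top n r D t' j q"
    using assms(1,2) unfolding joined_def by blast
  moreover from this have "t = t'" by (metis meets_block_top_pipe_unique)
  ultimately show ?thesis using meets_block_top_pos_unique[of n r D t i p p'] assms by simp
qed

lemma joined_fun:
  assumes "joined i j p q" "joined i j p q'" "i \<le> n" "j \<le> n" "p < r i i" "q < r j j" "q' < r j j"
  shows "q = q'"
proof -
  obtain t t' where "meets_block_top n r D t i p" "meets_block_top n r D t j q"
    "meets_block_top n r D t' i p" "meets_block_top n r D t' j q'"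
    using assms(1,2) unfolding joined_def by blast
  moreover from this have "t = t'" by (metis meets_block_top_pipe_unique)
  ultimately show ?thesis using meets_block_top_pos_unique[of n r D t j q q'] assms by simp
qed

text \<open>Both thresholds of \<open>meets_block_top_iff\<close> are monotone in the block, so a
  pipe through two blocks also enters every block between them. Hence products of the lacing
  matrices compose the relations \<open>joined\<close>.\<close>

lemma joined_split:
  assumes "i \<le> k" "k \<le> j" "j \<le> n" "p < r i i" "q < r j j"
  shows "joined i j p q \<longleftrightarrow> (\<exists>x<r k k. joined i k p x \<and> joined k j x q)"
proof
  assume "joined i j p q"
  then obtain t where t: "t \<in> {1..total_dim n r}" "meets_block_top n r D t i p" "meets_block_top n r D t j q"
    by (auto simp: joined_def)
  have "row_offset r j < t" "col_end n r (Suc i) < u t"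
    using meets_block_top_iff[of i t] meets_block_top_iff[of j t] t assms by auto
  then have "row_offset r k < t" "col_end n r (Suc k) < u t"
    using row_offset_mono[of k j r] col_end_antimono[of "Suc i" "Suc k" n r] assms by auto
  then obtain x where "x < r k k" "meets_block_top n r D t k x"
    using meets_block_top_iff[of k t] assms t by auto
  with t show "\<exists>x<r k k. joined i k p x \<and> joined k j x q" unfolding joined_def by blast
next
  assume "\<exists>x<r k k. joined i k p x \<and> joined k j x q"
  then show "joined i j p q" unfolding joined_def by (metis meets_block_top_pipe_unique)
qed

text \<open>An edge lies on a single pipe and a pipe crosses a level once, so pairs of joined
  positions correspond to the pipes through both blocks.\<close>

lemma card_joined:
  assumes "i \<le> j" "j \<le> n"
  shows "card {(p, q). p < r i i \<and> q < r j j \<and> joined i j p q} = corner_count n r u i j"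
proof -
  let ?A = "{(p, q). p < r i i \<and> q < r j j \<and> joined i j p q}"
  let ?B = "{t. row_offset r j < t \<and> t \<le> total_dim n r \<and> col_end n r (Suc i) < u t}"
  have B: "t \<in> ?B \<longleftrightarrow> t \<in> {1..total_dim n r} \<and> (\<exists>p<r i i. meets_block_top n r D t i p) \<and> (\<exists>q<r j j. meets_block_top n r D t j q)" for t
  proof (cases "t \<in> {1..total_dim n r}")
    case True
    then show ?thesis using meets_block_top_iff[OF assms(2) True] meets_block_top_iff[of i t] assms
        row_offset_mono[of i j r] col_end_antimono[of "Suc i" "Suc j" n r] by auto
  qed auto
  define f where "f x = (case x of (p, q) \<Rightarrow> SOME t. t \<in> {1..total_dim n r} \<and> meets_block_top n r D t i p \<and> meets_block_top n r D t j q)" for x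
  have f: "f (p, q) \<in> {1..total_dim n r} \<and> meets_block_top n r D (f (p, q)) i p \<and> meets_block_top n r D (f (p, q)) j q"
    if "joined i j p q" for p q
    using someI_ex[OF that[unfolded joined_def Bex_def]] unfolding f_def prod.case .
  have "bij_betw f ?A ?B"
  proof (rule bij_betw_imageI)
    show "inj_on f ?A"
    proof (rule inj_onI)
      fix x y assume x: "x \<in> ?A" and y: "y \<in> ?A" and eq: "f x = f y"
      obtain p q p' q' where xy: "x = (p, q)" "y = (p', q')" by (cases x, cases y)
      have "p = p'" using meets_block_top_pos_unique[of n r D "f x" i p p'] f[of p q] f[of p' q'] x y eq assms
        by (simp add: xy)
      moreover have "q = q'" using meets_block_top_pos_unique[of n r D "f x" j q q'] f[of p q] f[of p' q'] x y eq assms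
        by (simp add: xy)
      ultimately show "x = y" by (simp add: xy)
    qed
    show "f ` ?A = ?B"
    proof (intro equalityI subsetI)
      fix t assume "t \<in> f ` ?A"
      then obtain p q where "t = f (p, q)" "p < r i i" "q < r j j" "joined i j p q" by auto
      then show "t \<in> ?B" unfolding B using f by blast
    next
      fix t assume "t \<in> ?B"
      then obtain p q where t: "t \<in> {1..total_dim n r}" "p < r i i" "q < r j j"
        "meets_block_top n r D t i p" "meets_block_top n r D t j q" unfolding B by blast
      then have j: "joined i j p q" by (auto simp: joined_def)
      then have "f (p, q) = t" using f meets_block_top_pipe_unique t(4) by blast
      then show "t \<in> f ` ?A" using t j by force
    qed
  qed
  then show ?thesis unfolding corner_count_def by (rule bij_betw_same_card)
qed

lemma pipe_lacing_nth:
  "j < n \<Longrightarrow> pipe_lacing n r D ! j = mat (r j j) (r (Suc j) (Suc j)) (\<lambda>(p, q). if joined j (Suc j) p q then 1 else 0)"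
  by (simp add: pipe_lacing_def pipe_lacing_mat_def joined_def del: upt_Suc)

lemma pipe_lacing_Hom: "(pipe_lacing n r D :: 'k::field mat list) \<in> Hom n (\<lambda>i. r i i)"
proof -
  have "(pipe_lacing n r D :: 'k mat list) ! (i - 1) \<in> carrier_mat (r (i - 1) (i - 1)) (r i i)" if "i \<in> {1..n}" for i
    using that pipe_lacing_nth[of "i - 1", where 'a = 'k] by auto
  then show ?thesis unfolding Hom_def by (simp add: pipe_lacing_def)
qed

lemma path_prod_pipe_lacing:
  assumes "Suc i \<le> j" "j \<le> n"
  shows "path_prod (pipe_lacing n r D :: 'k::field mat list) i j =
    mat (r i i) (r j j) (\<lambda>(p, q). if joined i j p q then 1 else 0)"
  using assms
proof (induction j rule: dec_induct)
  case base
  then show ?case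
    using path_prod_Suc[of i i "pipe_lacing n r D :: 'k mat list"] path_prod_self[OF pipe_lacing_Hom[where 'k = 'k], of i]
      pipe_lacing_nth[of i, where 'a = 'k]
    by simp
next
  case (step j)
  let ?M = "\<lambda>i j. mat (r i i) (r j j) (\<lambda>(p, q). if joined i j p q then 1 else 0) :: 'k mat"
  have "path_prod (pipe_lacing n r D :: 'k mat list) i (Suc j) = ?M i j * ?M j (Suc j)"
    using step by (simp add: path_prod_Suc pipe_lacing_nth)
  also have "\<dots> = ?M i (Suc j)"
  proof (rule eq_matI)
    fix p q assume "p < dim_row (?M i (Suc j))" "q < dim_col (?M i (Suc j))"
    then have pq: "p < r i i" "q < r (Suc j) (Suc j)" by simp_all
    have "(?M i j * ?M j (Suc j)) $$ (p, q) =
        (\<Sum>k = 0..<r j j. (if joined i j p k then 1 else 0) * (if joined j (Suc j) k q then 1 else 0))"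
      using pq by (simp add: scalar_prod_def)
    also have "\<dots> = (if \<exists>k<r j j. joined i j p k \<and> joined j (Suc j) k q then 1 else 0)"
      using joined_fun[of i j p] step pq by (intro sum_indicator_mult) auto
    also have "\<dots> = ?M i (Suc j) $$ (p, q)"
      using joined_split[of i j "Suc j" p q] step pq by simp
    finally show "(?M i j * ?M j (Suc j)) $$ (p, q) = ?M i (Suc j) $$ (p, q)" .
  qed simp_all
  finally show ?case .
qed

lemma rank_array_pipe_lacing:
  assumes "i < j" "j \<le> n"
  shows "rank_array (\<lambda>i. r i i) (pipe_lacing n r D :: 'k::field mat list) i j = corner_count n r u i j"
proof -
  have "rank_array (\<lambda>i. r i i) (pipe_lacing n r D :: 'k mat list) i j =
      vec_space.rank (r i i) (mat (r i i) (r j j) (\<lambda>(p, q). if joined i j p q then 1 else 0) :: 'k mat)"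
    using assms path_prod_pipe_lacing[where 'k = 'k, of i j] by (simp add: rank_array_def)
  also have "\<dots> = card {(p, q). p < r i i \<and> q < r j j \<and> joined i j p q}"
    using assms joined_inj[of i j] joined_fun[of i j] by (intro rank_indicator_mat) auto
  also have "\<dots> = corner_count n r u i j" using card_joined[of i j] assms by simp
  finally show ?thesis .
qed

lemma has_rank_array_pipe_lacing_iff:
  "has_rank_array n r (pipe_lacing n r D :: 'k::field mat list) \<longleftrightarrow>
     (\<forall>i j. i < j \<and> j \<le> n \<longrightarrow> corner_count n r u i j = r i j)"
proof -
  have "rank_array (\<lambda>i. r i i) (pipe_lacing n r D :: 'k mat list) i i = r i i" for i
    by (simp add: rank_array_def)
  then show ?thesis
    using rank_array_pipe_lacing[where 'k = 'k] pipe_lacing_Hom[where 'k = 'k]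
    unfolding has_rank_array_def by (metis le_neq_implies_less less_imp_le)
qed

lemma pipe_lacing_in_lacing_diagrams:
  "(pipe_lacing n r D :: 'k::field mat list) \<in> lacing_diagrams n (\<lambda>i. r i i)"
proof -
  have "partial_perm_mat w" if "w \<in> set (pipe_lacing n r D :: 'k mat list)" for w
  proof -
    have "length (pipe_lacing n r D :: 'k mat list) = n" by (simp add: pipe_lacing_def)
    with that obtain j where j: "j < n" "w = pipe_lacing n r D ! j"
      by (metis in_set_conv_nth)
    then have w: "w = mat (r j j) (r (Suc j) (Suc j)) (\<lambda>(p, q). if joined j (Suc j) p q then 1 else 0)"
      using pipe_lacing_nth by simp
    have nz: "(if b then 1 else 0 :: 'k) = 1 \<longleftrightarrow> b" for b by simp
    have "\<forall>p<r j j. \<forall>q<r (Suc j) (Suc j). \<forall>q'<r (Suc j) (Suc j). joined j (Suc j) p q \<and> joined j (Suc j) p q' \<longrightarrow> q = q'"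
      using joined_fun[of j "Suc j"] j(1) by (meson less_imp_le Suc_leI)
    moreover have "\<forall>p<r j j. \<forall>p'<r j j. \<forall>q<r (Suc j) (Suc j). joined j (Suc j) p q \<and> joined j (Suc j) p' q \<longrightarrow> p = p'"
      using joined_inj[of j "Suc j"] j(1) by (meson less_imp_le Suc_leI)
    ultimately show ?thesis unfolding partial_perm_mat_def w by (simp add: nz cong: conj_cong)
  qed
  then show ?thesis using pipe_lacing_Hom by (auto simp: lacing_diagrams_def)
qed

end

text \<open>By hypothesis, all values up to \<open>col_end n r (Suc j)\<close> are taken below row
  \<open>row_offset r j\<close>. Removing them from the rows there leaves \<open>r j j\<close> rows,
  because \<open>row_offset\<close> and \<open>col_end\<close> at \<open>j\<close> add up to the
  total dimension.\<close>

lemma corner_count_diag: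
  assumes "u permutes {1..total_dim n r}" "j \<le> n"
    and "\<And>t. 1 \<le> t \<Longrightarrow> t \<le> row_offset r j \<Longrightarrow> col_end n r (Suc j) < u t"
  shows "corner_count n r u j j = r j j"
proof -
  let ?d = "total_dim n r"
  define A where "A = {t. row_offset r j < t \<and> t \<le> ?d \<and> col_end n r (Suc j) < u t}"
  define B where "B = {t \<in> {1..?d}. u t \<le> col_end n r (Suc j)}"
  have cd: "col_end n r (Suc j) \<le> ?d" using col_end_antimono[of 0 "Suc j" n r] by (simp add: col_end_total)
  have "u ` B = u ` {1..?d} \<inter> {..col_end n r (Suc j)}" unfolding B_def by auto
  also have "\<dots> = {1..?d} \<inter> {..col_end n r (Suc j)}" unfolding permutes_image[OF assms(1)] ..
  also have "\<dots> = {1..col_end n r (Suc j)}" using cd by auto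
  finally have "card (u ` B) = col_end n r (Suc j)" by simp
  then have B: "card B = col_end n r (Suc j)"
    using card_image[of u B] inj_on_subset[OF permutes_inj[OF assms(1)]] by simp
  have "{row_offset r j<..?d} = A \<union> B"
  proof (rule Set.set_eqI)
    fix t
    show "t \<in> {row_offset r j<..?d} \<longleftrightarrow> t \<in> A \<union> B"
      using assms(3)[of t] by (cases "t \<le> row_offset r j") (auto simp: A_def B_def)
  qed
  moreover have "finite A" "finite B" "A \<inter> B = {}" by (auto simp: A_def B_def)
  ultimately have "card {row_offset r j<..?d} = card A + card B"
    by (simp add: card_Un_disjoint)
  then show ?thesis using B row_offset_plus_col_end[of j n r] col_end_step[OF assms(2), of r] assms(2)
    by (simp add: corner_count_def A_def)
qed

section \<open>Zelevinsky permutations\<close>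

definition corner :: "nat \<Rightarrow> (nat \<Rightarrow> nat) \<Rightarrow> nat \<Rightarrow> nat \<Rightarrow> nat" where
  "corner d u a c = card {t. a < t \<and> t \<le> d \<and> c < u t}"

lemma corner_count_eq: "corner_count n r u i j = corner (total_dim n r) u (row_offset r j) (col_end n r (Suc i))"
  by (simp add: corner_count_def corner_def)

lemma finite_corner [simp]: "finite {t. a < t \<and> t \<le> d \<and> P t}" for a d :: nat
  by (rule finite_subset[of _ "{..d}"]) auto

lemma corner_rows:
  assumes "a \<le> b" "b \<le> d"
  shows "corner d u a c = card {t. a < t \<and> t \<le> b \<and> c < u t} + corner d u b c"
  unfolding corner_def using assms
  by (subst card_Un_disjoint[symmetric]) (auto intro!: arg_cong[where f = card])

lemma corner_cols:
  assumes "c \<le> e"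
  shows "corner d u a c = card {t. a < t \<and> t \<le> d \<and> c < u t \<and> u t \<le> e} + corner d u a e"
  unfolding corner_def using assms
  by (subst card_Un_disjoint[symmetric]) (auto intro!: arg_cong[where f = card])

lemma corner_rect:
  assumes "a \<le> b" "b \<le> d" "c \<le> e"
  shows "int (card {t. a < t \<and> t \<le> b \<and> c < u t \<and> u t \<le> e}) =
    int (corner d u a c) - int (corner d u b c) - int (corner d u a e) + int (corner d u b e)"
proof -
  have "card {t. a < t \<and> t \<le> b \<and> c < u t} =
    card {t. a < t \<and> t \<le> b \<and> c < u t \<and> u t \<le> e} + card {t. a < t \<and> t \<le> b \<and> e < u t}"
    using assms by (subst card_Un_disjoint[symmetric]) (auto intro!: arg_cong[where f = card])
  then show ?thesis using corner_rows[OF assms(1,2), of u c] corner_rows[OF assms(1,2), of u e] by simp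
qed

text \<open>The block counts of \<open>is_zelevinsky_perm\<close> in cumulative form.\<close>

definition zel_ranks :: "nat \<Rightarrow> (nat \<Rightarrow> nat \<Rightarrow> nat) \<Rightarrow> (nat \<Rightarrow> nat) \<Rightarrow> bool" where
  "zel_ranks n r u \<longleftrightarrow> u permutes {1..total_dim n r} \<and>
     (\<forall>i j. i < j \<and> j \<le> n \<longrightarrow> corner_count n r u i j = r i j) \<and>
     (\<forall>j\<le>n. \<forall>t\<in>block_row r j. col_end n r (j + 2) < u t)"

lemma zel_ranks_row: "zel_ranks n r u \<Longrightarrow> j \<le> n \<Longrightarrow> t \<in> block_row r j \<Longrightarrow> col_end n r (j + 2) < u t"
  unfolding zel_ranks_def by blast

definition block_mono :: "nat \<Rightarrow> (nat \<Rightarrow> nat \<Rightarrow> nat) \<Rightarrow> (nat \<Rightarrow> nat) \<Rightarrow> bool" where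
  "block_mono n r v \<longleftrightarrow>
     (\<forall>j\<le>n. \<forall>q\<in>block_row r j. \<forall>q'\<in>block_row r j. q < q' \<longrightarrow> v q < v q') \<and>
     (\<forall>i\<le>n. \<forall>q q'. v q \<in> block_col n r i \<and> v q' \<in> block_col n r i \<and> q < q' \<longrightarrow> v q < v q')"

lemma row_offset_le_total: "j \<le> Suc n \<Longrightarrow> row_offset r j \<le> total_dim n r"
  using row_offset_plus_col_end[of j n r] by simp

lemma col_end_le_total: "col_end n r i \<le> total_dim n r"
  using col_end_antimono[of 0 i n r] by (simp add: col_end_total)

lemma block_row_subset: "j \<le> n \<Longrightarrow> block_row r j \<subseteq> {1..total_dim n r}"
  using row_offset_le_total[of "Suc j" n r] by (auto simp: block_row_def)

lemma block_col_subset: "block_col n r i \<subseteq> {1..total_dim n r}"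
  using col_end_le_total[of n r i] by (auto simp: block_col_def)

lemma card_block_row: "card (block_row r j) = r j j"
  by (simp add: block_row_def row_offset_Suc)

lemma card_block_col: "i \<le> n \<Longrightarrow> card (block_col n r i) = r i i"
  by (simp add: block_col_def col_end_step)

lemma corner_beyond_rows: "corner (total_dim n r) u (row_offset r (Suc n)) c = 0"
  by (auto simp: corner_def row_offset_total)

lemma corner_beyond_cols: "u permutes {1..total_dim n r} \<Longrightarrow> corner (total_dim n r) u a (col_end n r 0) = 0"
  using permutes_le[of u "total_dim n r"] by (auto simp: corner_def col_end_total not_less)

text \<open>The shift by one in \<open>i\<close> accommodates the index \<open>-1\<close> of the extended rank array.\<close>

lemma zel_ranks_corner:
  assumes "zel_ranks n r u" "i \<le> Suc j" "j \<le> Suc n" "i \<le> Suc n"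
  shows "int (corner (total_dim n r) u (row_offset r j) (col_end n r i)) = rank_ext n r (int i - 1) (int j)"
proof -
  have u: "u permutes {1..total_dim n r}" using assms(1) by (simp add: zel_ranks_def)
  consider "i = 0" | "j = Suc n" | i' where "i = Suc i'" "j \<le> n" using assms by (cases i) (auto simp: le_Suc_eq)
  then show ?thesis
  proof cases
    case 1
    then show ?thesis using corner_beyond_cols[OF u] by (simp add: rank_ext_def)
  next
    case 2
    then show ?thesis using corner_beyond_rows[of n r u] by (simp add: rank_ext_def)
  next
    case 3
    have "corner_count n r u i' j = r i' j"
    proof (cases "i' < j")
      case True
      then show ?thesis using assms(1) 3 by (simp add: zel_ranks_def)
    next
      case False
      then have [simp]: "i' = j" using 3 assms by simp
      have "corner_count n r u j j = r j j"
      proof (rule corner_count_diag[OF u 3(2)])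
        fix t assume "1 \<le> t" "t \<le> row_offset r j"
        then obtain k where "k < j" "t \<in> block_row r k" by (rule block_row_below)
        moreover have "col_end n r (Suc j) \<le> col_end n r (k + 2)" using \<open>k < j\<close> by (intro col_end_antimono) simp
        moreover have "col_end n r (k + 2) < u t" using zel_ranks_row[OF assms(1), of k t] calculation 3(2) by simp
        ultimately show "col_end n r (Suc j) < u t" by linarith
      qed
      then show ?thesis by simp
    qed
    then show ?thesis using 3 assms by (simp add: corner_count_eq rank_ext_def)
  qed
qed

lemma block_eq_rect:
  assumes "j \<le> n"
  shows "{q \<in> block_row r j. u q \<in> block_col n r i} =
    {t. row_offset r j < t \<and> t \<le> row_offset r (Suc j) \<and> col_end n r (Suc i) < u t \<and> u t \<le> col_end n r i}"
  by (auto simp: block_row_def block_col_def)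

lemma card_block_rect:
  assumes "j \<le> n"
  shows "int (card {q \<in> block_row r j. u q \<in> block_col n r i}) =
    int (corner (total_dim n r) u (row_offset r j) (col_end n r (Suc i)))
    - int (corner (total_dim n r) u (row_offset r (Suc j)) (col_end n r (Suc i)))
    - int (corner (total_dim n r) u (row_offset r j) (col_end n r i))
    + int (corner (total_dim n r) u (row_offset r (Suc j)) (col_end n r i))"
  unfolding block_eq_rect[OF assms]
  using assms row_offset_mono[of j "Suc j" r] col_end_antimono[of i "Suc i" n r] row_offset_le_total[of "Suc j" n r]
  by (intro corner_rect) auto

text \<open>A block count is a second difference of corner counts, and a lace count is the same
  second difference of the extended rank array.\<close>

lemma zel_ranks_iff_block_counts:
  "zel_ranks n r v \<longleftrightarrow> v permutes {1..total_dim n r} \<and>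
     (\<forall>i\<le>n. \<forall>j\<le>n. int (card {q \<in> block_row r j. v q \<in> block_col n r i}) =
        (if i \<le> j then lace_count n r (int i) (int j)
         else if i = j + 1 then int (r j (j + 1)) else 0))"
  (is "_ \<longleftrightarrow> _ \<and> ?counts")
proof -
  let ?d = "total_dim n r"
  let ?K = "\<lambda>j i. int (corner ?d v (row_offset r j) (col_end n r i))"
  show ?thesis
  proof
    assume z: "zel_ranks n r v"
    then have v: "v permutes {1..?d}" by (simp add: zel_ranks_def)
    have K: "?K j i = rank_ext n r (int i - 1) (int j)" if "i \<le> Suc j" "j \<le> Suc n" "i \<le> Suc n" for i j
      using zel_ranks_corner[OF z that] .
    have ?counts
    proof (intro allI impI)
      fix i j assume ij: "i \<le> n" "j \<le> n"
      note rect = card_block_rect[OF ij(2), of r v i]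
      consider "i \<le> j" | "i = Suc j" | "j + 2 \<le> i" by linarith
      then show "int (card {q \<in> block_row r j. v q \<in> block_col n r i}) =
        (if i \<le> j then lace_count n r (int i) (int j)
         else if i = j + 1 then int (r j (j + 1)) else 0)"
      proof cases
        case 1
        then show ?thesis unfolding rect using ij K[of i j] K[of i "Suc j"] K[of "Suc i" j] K[of "Suc i" "Suc j"]
          by (simp add: lace_count_def add.commute)
      next
        case 2
        \<comment> \<open>The column index \<open>Suc i = j + 2\<close> is outside the range of
          \<open>zel_ranks_corner\<close>. The missing difference is the size of the block row, all
          of which lies to the right of that column bound.\<close>
        have "block_row r j = {t. row_offset r j < t \<and> t \<le> row_offset r (Suc j) \<and> col_end n r (Suc i) < v t}"
          using zel_ranks_row[OF z ij(2)] 2 by (auto simp: block_row_def)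
        then have "?K j (Suc i) - ?K (Suc j) (Suc i) = int (r j j)"
          using corner_rows[of "row_offset r j" "row_offset r (Suc j)" ?d v "col_end n r (Suc i)"]
            row_offset_mono[of j "Suc j" r] row_offset_le_total[of "Suc j" n r] ij card_block_row[of r j] by simp
        then show ?thesis unfolding rect using 2 ij K[of i j] K[of i "Suc j"]
          by (simp add: rank_ext_def nat_add_distrib)
      next
        case 3
        have "{q \<in> block_row r j. v q \<in> block_col n r i} = {}"
          using zel_ranks_row[OF z ij(2)] col_end_antimono[OF 3, of n r] by (force simp: block_col_def)
        then show ?thesis using 3 by (simp only: card.empty) simp
      qed
    qed
    with v show "v permutes {1..?d} \<and> ?counts" by blast
  next
    assume *: "v permutes {1..?d} \<and> ?counts"
    then have v: "v permutes {1..?d}" and c: ?counts by blast+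
    \<comment> \<open>\<open>F\<close> is the error of the corner counts. It vanishes on the borders
      \<open>i = 0\<close> and \<open>j = Suc n\<close>, and its second differences vanish, so it is
      zero by induction inwards from these borders.\<close>
    define F where "F i j = ?K j i - rank_ext n r (int i - 1) (int j)" for i j
    have F0: "F 0 j = 0" for j using corner_beyond_cols[OF v] by (simp add: F_def rank_ext_def)
    have Fn: "F i (Suc n) = 0" for i using corner_beyond_rows[of n r v] by (simp add: F_def rank_ext_def)
    have F: "F (Suc i) j - F (Suc i) (Suc j) - F i j + F i (Suc j) = 0" if "i \<le> j" "j \<le> n" for i j
      using c[rule_format, of i j] card_block_rect[OF that(2), of r v i] that
      by (simp add: F_def lace_count_def add.commute)
    have Fz: "F i j = 0" if "i \<le> Suc j" "j \<le> Suc n" "i \<le> Suc n" for i j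
      using that
    proof (induction i arbitrary: j)
      case 0
      then show ?case using F0 by simp
    next
      case (Suc i)
      from Suc.prems(2,1) show ?case
      proof (induction j rule: inc_induct)
        case base
        then show ?case using Fn by simp
      next
        case (step j)
        have "F i j = 0" "F i (Suc j) = 0" using Suc.IH[of j] Suc.IH[of "Suc j"] step Suc.prems by auto
        then show ?case using F[of i j] step by simp
      qed
    qed
    have "corner_count n r v i j = r i j" if "i < j" "j \<le> n" for i j
      using Fz[of "Suc i" j] that by (simp add: F_def corner_count_eq rank_ext_def)
    moreover have "col_end n r (j + 2) < v t" if j: "j \<le> n" and t: "t \<in> block_row r j" for j t
    proof (rule ccontr)
      assume "\<not> col_end n r (j + 2) < v t"
      moreover have "1 \<le> v t" using permutes_in_image[OF v, of t] block_row_subset[OF j, of r] t by auto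
      ultimately obtain k where k: "j + 2 \<le> k" "k \<le> n" "v t \<in> block_col n r k"
        using block_col_right[of "v t" n r "j + 2"] by (metis not_less)
      then have "card {q \<in> block_row r j. v q \<in> block_col n r k} = 0"
        using c[rule_format, of k j] j by simp
      moreover have "finite {q \<in> block_row r j. v q \<in> block_col n r k}" by (simp add: block_row_def)
      ultimately show False using t k(3) by auto
    qed
    ultimately show "zel_ranks n r v" using v by (simp add: zel_ranks_def)
  qed
qed

lemma is_zelevinsky_perm_iff:
  "is_zelevinsky_perm n r v \<longleftrightarrow> zel_ranks n r v \<and> block_mono n r v"
  unfolding is_zelevinsky_perm_def zel_ranks_iff_block_counts block_mono_def by blast

text \<open>At the first position \<open>q\<close> with, say, \<open>v q < w q\<close>, the
  permutation \<open>w\<close> takes the value \<open>v q\<close> only later. Monotonicity of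
  \<open>w\<close> in the block column then puts \<open>w q\<close> into a block column further
  right. So, in the block row of \<open>q\<close>, \<open>w\<close> has its 1's of the block of
  \<open>v q\<close> before \<open>q\<close>, where it agrees with \<open>v\<close>, and has one
  fewer of them.\<close>

lemma zelevinsky_perm_unique:
  assumes "is_zelevinsky_perm n r v" "is_zelevinsky_perm n r w"
  shows "v = w"
proof -
  let ?d = "total_dim n r"
  have v: "v permutes {1..?d}" and w: "w permutes {1..?d}"
    using assms by (simp_all add: is_zelevinsky_perm_def)
  have no_less: False
    if P: "is_zelevinsky_perm n r v" and Q: "is_zelevinsky_perm n r w"
      and q: "q \<in> {1..?d}" and below: "\<And>t. t < q \<Longrightarrow> v t = w t" and less: "v q < w q" for v w q
  proof -
    have v: "v permutes {1..?d}" and w: "w permutes {1..?d}"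
      using P Q by (simp_all add: is_zelevinsky_perm_def)
    have wm: "block_mono n r w" using Q by (simp add: is_zelevinsky_perm_iff)
    have vq: "1 \<le> v q" "v q \<le> ?d" using permutes_in_image[OF v, of q] q by auto
    have wq: "1 \<le> w q" "w q \<le> ?d" using permutes_in_image[OF w, of q] q by auto
    obtain j where j: "j \<le> n" "q \<in> block_row r j"
      using block_row_below[of q r "Suc n"] q by (auto simp: row_offset_total less_Suc_eq_le)
    obtain i where i: "i \<le> n" "v q \<in> block_col n r i"
      using block_col_right[of "v q" n r 0] vq by (auto simp: col_end_total)
    obtain i' where i': "i' \<le> n" "w q \<in> block_col n r i'"
      using block_col_right[of "w q" n r 0] wq by (auto simp: col_end_total)
    obtain q' where q': "w q' = v q" using permutes_surj[OF w] by (metis surjD)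
    have "q < q'"
    proof (rule ccontr)
      assume "\<not> q < q'"
      then have "q' < q" using q' less by (cases "q' = q") auto
      then have "v q' = v q" using below q' by simp
      then show False using permutes_inj[OF v] \<open>q' < q\<close> by (auto dest: injD)
    qed
    have "i' \<noteq> i"
      using wm i i' q' \<open>q < q'\<close> less unfolding block_mono_def by (metis not_less_iff_gr_or_eq)
    moreover have "i' \<le> i"
    proof (rule ccontr)
      assume "\<not> i' \<le> i"
      then have "col_end n r i' \<le> col_end n r (Suc i)" by (intro col_end_antimono) simp
      then show False using i i' less by (auto simp: block_col_def)
    qed
    ultimately have "i' < i" by simp
    then have ii: "col_end n r i \<le> col_end n r (Suc i')" by (intro col_end_antimono) simp
    let ?S = "\<lambda>v. {t \<in> block_row r j. v t \<in> block_col n r i}"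
    have "?S w \<subset> ?S v"
    proof
      show "?S w \<subseteq> ?S v"
      proof
        fix t assume t: "t \<in> ?S w"
        have "t < q"
        proof (rule ccontr)
          assume "\<not> t < q"
          then have "w q \<le> w t" using wm j t unfolding block_mono_def by (cases "t = q") (auto intro: less_imp_le)
          then show False using t i' ii by (auto simp: block_col_def)
        qed
        then show "t \<in> ?S v" using t below by simp
      qed
      have "q \<in> ?S v" using i j by simp
      moreover have "q \<notin> ?S w" using i' block_col_unique[OF i'(2), of i] \<open>i' \<noteq> i\<close> by auto
      ultimately show "?S w \<noteq> ?S v" by blast
    qed
    moreover have "finite (?S v)" by (simp add: block_row_def)
    ultimately have "card (?S w) < card (?S v)" by (rule psubset_card_mono[rotated])
    moreover have "int (card (?S w)) = int (card (?S v))"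
      using P Q i(1) j(1) unfolding is_zelevinsky_perm_def by presburger
    ultimately show False by simp
  qed
  have "v q = w q" for q
  proof (induction q rule: less_induct)
    case (less q)
    show ?case
    proof (cases "q \<in> {1..?d}")
      case True
      then show ?thesis using no_less[OF assms(1,2) True] no_less[OF assms(2,1) True] less
        by (metis linorder_neqE_nat)
    next
      case False
      then show ?thesis using permutes_not_in[OF v False] permutes_not_in[OF w False] by simp
    qed
  qed
  then show ?thesis by blast
qed

section \<open>Inversions of permutations with the given ranks\<close>

lemma card_hom_boxes: "card (hom_boxes n r) = (\<Sum>j\<le>n. r j j * col_end n r (j + 2))"
proof -
  have eq: "hom_boxes n r = (\<Union>j\<in>{..n}. block_row r j \<times> {1..col_end n r (j + 2)})"
    by (auto simp: hom_boxes_def)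
  have "card (hom_boxes n r) = (\<Sum>j\<in>{..n}. card (block_row r j \<times> {1..col_end n r (j + 2)}))"
    unfolding eq
  proof (rule card_UN_disjoint)
    show "\<forall>i\<in>{..n}. finite (block_row r i \<times> {1..col_end n r (i + 2)})" by (simp add: block_row_def)
    show "\<forall>i\<in>{..n}. \<forall>j\<in>{..n}. i \<noteq> j \<longrightarrow>
      (block_row r i \<times> {1..col_end n r (i + 2)}) \<inter> (block_row r j \<times> {1..col_end n r (j + 2)}) = {}"
      using block_row_unique by (metis (no_types, lifting) SigmaE2 disjoint_iff_not_equal old.prod.exhaust)
  qed simp
  then show ?thesis by (simp add: card_cartesian_product card_block_row)
qed

text \<open>
  The inversions between different block rows and different block columns, sorted by the block in
  the block row of the first and the block column of the second position: this is the Rothe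
  diagram of a permutation without inversions inside the blocks.
\<close>

definition block_inversions :: "nat \<Rightarrow> (nat \<Rightarrow> nat \<Rightarrow> nat) \<Rightarrow> (nat \<Rightarrow> nat) \<Rightarrow> (nat \<times> nat) set" where
  "block_inversions n r u = (\<Union>(j, i)\<in>{..n} \<times> {..n}.
     {t \<in> block_row r j. col_end n r i < u t} \<times>
     {t. row_offset r (Suc j) < t \<and> t \<le> total_dim n r \<and> u t \<in> block_col n r i})"

lemma block_inversions_subset:
  "block_inversions n r u \<subseteq> {(t, t'). t < t' \<and> u t' < u t}"
  by (auto simp: block_inversions_def block_row_def block_col_def)

lemma card_block_inversions_sum:
  "card (block_inversions n r u) = (\<Sum>(j, i)\<in>{..n} \<times> {..n}.
     card {t \<in> block_row r j. col_end n r i < u t} *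
     card {t. row_offset r (Suc j) < t \<and> t \<le> total_dim n r \<and> u t \<in> block_col n r i})"
proof -
  let ?X = "\<lambda>j i. {t \<in> block_row r j. col_end n r i < u t}"
  let ?Y = "\<lambda>j i. {t. row_offset r (Suc j) < t \<and> t \<le> total_dim n r \<and> u t \<in> block_col n r i}"
  have "card (block_inversions n r u) = (\<Sum>x\<in>{..n} \<times> {..n}. card (case x of (j, i) \<Rightarrow> ?X j i \<times> ?Y j i))"
    unfolding block_inversions_def
  proof (rule card_UN_disjoint)
    show "\<forall>x\<in>{..n} \<times> {..n}. finite (case x of (j, i) \<Rightarrow> ?X j i \<times> ?Y j i)"
      by (auto simp: block_row_def)
    show "\<forall>x\<in>{..n} \<times> {..n}. \<forall>y\<in>{..n} \<times> {..n}. x \<noteq> y \<longrightarrow>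
       (case x of (j, i) \<Rightarrow> ?X j i \<times> ?Y j i) \<inter> (case y of (j, i) \<Rightarrow> ?X j i \<times> ?Y j i) = {}"
    proof (intro ballI impI)
      fix x y :: "nat \<times> nat" assume "x \<noteq> y"
      obtain j i j' i' where xy: "x = (j, i)" "y = (j', i')" by (cases x, cases y)
      show "(case x of (j, i) \<Rightarrow> ?X j i \<times> ?Y j i) \<inter> (case y of (j, i) \<Rightarrow> ?X j i \<times> ?Y j i) = {}"
      proof (rule ccontr)
        assume "\<not> ?thesis"
        then obtain t t' where "t \<in> block_row r j" "t \<in> block_row r j'" "u t' \<in> block_col n r i" "u t' \<in> block_col n r i'"
          unfolding xy prod.case by blast
        then have "j = j'" "i = i'" using block_row_unique block_col_unique by metis+
        then show False using \<open>x \<noteq> y\<close> xy by simp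
      qed
    qed
  qed simp
  also have "\<dots> = (\<Sum>(j, i)\<in>{..n} \<times> {..n}. card (?X j i) * card (?Y j i))"
    by (intro sum.cong refl) (auto simp: card_cartesian_product split: prod.split)
  finally show ?thesis .
qed

text \<open>The inversions at block row \<open>j\<close> and block column \<open>i\<close> form a
  product of two sets. For \<open>j + 2 \<le> i\<close> these are the whole block row and the whole
  block column, and the products add up to the number of boxes in \<open>hom_boxes\<close>. The
  other products are the summands of \<open>quiver_codim\<close> with indices \<open>i - 1\<close>
  and \<open>j + 1\<close>, or vanish at the borders \<open>i = 0\<close> and
  \<open>j = n\<close>.\<close>

lemma card_block_inversions:
  assumes z: "zel_ranks n r u"
  shows "int (card (block_inversions n r u)) = quiver_codim n r + int (card (hom_boxes n r))"
proof -
  let ?d = "total_dim n r"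
  let ?X = "\<lambda>j i. card {t \<in> block_row r j. col_end n r i < u t}"
  let ?Y = "\<lambda>j i. card {t. row_offset r (Suc j) < t \<and> t \<le> ?d \<and> u t \<in> block_col n r i}"
  let ?K = "\<lambda>j i. int (corner ?d u (row_offset r j) (col_end n r i))"
  have u: "u permutes {1..?d}" using z by (simp add: zel_ranks_def)
  have X: "int (?X j i) = ?K j i - ?K (Suc j) i" if "j \<le> n" for j i
  proof -
    have "{t \<in> block_row r j. col_end n r i < u t} = {t. row_offset r j < t \<and> t \<le> row_offset r (Suc j) \<and> col_end n r i < u t}"
      by (auto simp: block_row_def)
    then show ?thesis
      using corner_rows[of "row_offset r j" "row_offset r (Suc j)" ?d u "col_end n r i"]
        row_offset_mono[of j "Suc j" r] row_offset_le_total[of "Suc j" n r] that by simp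
  qed
  have Y: "int (?Y j i) = ?K (Suc j) (Suc i) - ?K (Suc j) i" for j i
    using corner_cols[of "col_end n r (Suc i)" "col_end n r i" ?d u "row_offset r (Suc j)"] col_end_antimono[of i "Suc i" n r]
    by (simp add: block_col_def)
  have far: "?X j i * ?Y j i = r j j * r i i" if "j + 2 \<le> i" "i \<le> n" for j i
  proof -
    have jn: "j \<le> n" using that by simp
    have "{t \<in> block_row r j. col_end n r i < u t} = block_row r j"
      using zel_ranks_row[OF z jn] col_end_antimono[OF that(1), of n r] by force
    moreover have "{t. row_offset r (Suc j) < t \<and> t \<le> ?d \<and> u t \<in> block_col n r i} = u -` block_col n r i"
    proof (intro equalityI subsetI)
      fix t assume t: "t \<in> u -` block_col n r i"
      then have "u t \<in> {1..?d}" using block_col_subset by blast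
      then have td: "t \<in> {1..?d}" using permutes_in_image[OF u] by blast
      moreover have "row_offset r (Suc j) < t"
      proof (rule ccontr)
        assume "\<not> row_offset r (Suc j) < t"
        then obtain k where k: "k < Suc j" "t \<in> block_row r k" using td block_row_below[of t r "Suc j"] by auto
        then have "col_end n r (k + 2) < u t" using zel_ranks_row[OF z, of k t] jn by simp
        moreover have "col_end n r i \<le> col_end n r (k + 2)" using k that by (intro col_end_antimono) simp
        ultimately show False using t by (simp add: block_col_def)
      qed
      ultimately show "t \<in> {t. row_offset r (Suc j) < t \<and> t \<le> ?d \<and> u t \<in> block_col n r i}" using t by simp
    qed auto
    moreover have "card (u -` block_col n r i) = r i i"
      using card_vimage_inj[OF permutes_inj[OF u], of "block_col n r i"] permutes_surj[OF u] card_block_col[OF that(2)] by simp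
    ultimately show ?thesis by (simp add: card_block_row)
  qed
  have near: "int (?X j (Suc i)) * int (?Y j (Suc i)) =
      (int (r i j) - int (r i (Suc j))) * (int (r (Suc i) (Suc j)) - int (r i (Suc j)))" if "i < Suc j" "Suc j \<le> n" for i j
  proof -
    have "?K j (Suc i) = int (r i j)" "?K (Suc j) (Suc i) = int (r i (Suc j))" "?K (Suc j) (Suc (Suc i)) = int (r (Suc i) (Suc j))"
      using zel_ranks_corner[OF z, of "Suc i" j] zel_ranks_corner[OF z, of "Suc i" "Suc j"]
        zel_ranks_corner[OF z, of "Suc (Suc i)" "Suc j"] that by (auto simp: rank_ext_def nat_add_distrib)
    then show ?thesis using X[of j "Suc i"] Y[of j "Suc i"] that by simp
  qed
  have X0: "?X j 0 = 0" if "j \<le> n" for j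
    using X[OF that, of 0] corner_beyond_cols[OF u] by simp
  have Yn: "?Y n i = 0" for i
    using Y[of n i] corner_beyond_rows[of n r u] by simp
  define f where "f = (\<lambda>(j, i). int (?X j i) * int (?Y j i))"
  let ?A = "{(j, i). j + 2 \<le> i \<and> i \<le> n}" and ?B = "(\<lambda>(i, j). (j - 1, Suc i)) ` {(i, j). i < j \<and> j \<le> n}"
  have finA: "finite ?A" by (rule finite_subset[of _ "{..n} \<times> {..n}"]) auto
  have finB: "finite {(i, j). i < j \<and> j \<le> n}" by (rule finite_subset[of _ "{..n} \<times> {..n}"]) auto
  have "int (card (block_inversions n r u)) = sum f ({..n} \<times> {..n})"
    unfolding card_block_inversions_sum f_def by (simp add: case_prod_unfold)
  also have "\<dots> = sum f (?A \<union> ?B)"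
  proof (rule sum.mono_neutral_right)
    show "\<forall>x\<in>{..n} \<times> {..n} - (?A \<union> ?B). f x = 0"
    proof
      fix x assume x: "x \<in> {..n} \<times> {..n} - (?A \<union> ?B)"
      obtain j i where xji: "x = (j, i)" by (cases x)
      \<comment> \<open>Every other pair of blocks lies in \<open>?A\<close> or is the image of
        \<open>(i - 1, Suc j)\<close> in \<open>?B\<close>.\<close>
      have "i = 0 \<or> j = n"
      proof (rule ccontr)
        assume "\<not> (i = 0 \<or> j = n)"
        moreover from this have "x = (\<lambda>(i, j). (j - 1, Suc i)) (i - 1, Suc j)" by (simp add: xji)
        then have "(i - 1, Suc j) \<notin> {(i, j). i < j \<and> j \<le> n}" using x by blast
        ultimately show False using x xji by auto
      qed
      then show "f x = 0" using X0[of j] Yn[of i] x by (auto simp: f_def xji)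
    qed
  qed auto
  also have "\<dots> = sum f ?A + sum f ?B"
    using finA finB by (intro sum.union_disjoint) auto
  also have "sum f ?B = quiver_codim n r"
  proof -
    have "inj_on (\<lambda>(i, j). (j - 1, Suc i)) {(i, j). i < j \<and> j \<le> n}" by (auto simp: inj_on_def)
    then have "sum f ?B = (\<Sum>(i, j)\<in>{(i, j). i < j \<and> j \<le> n}. f (j - 1, Suc i))"
      by (simp add: sum.reindex case_prod_unfold)
    also have "\<dots> = quiver_codim n r" unfolding quiver_codim_def
    proof (intro sum.cong refl)
      fix x assume "x \<in> {(i, j). i < j \<and> j \<le> n}"
      then obtain i j where x: "x = (i, Suc j)" "i < Suc j" "Suc j \<le> n" by (cases x; cases "snd x") auto
      then show "(case x of (i, j) \<Rightarrow> f (j - 1, Suc i)) = (case x of (i, j) \<Rightarrow>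
          (int (r i (j - 1)) - int (r i j)) * (int (r (i + 1) j) - int (r i j)))"
        using near[OF x(2,3)] by (simp add: f_def)
    qed
    finally show ?thesis .
  qed
  also have "sum f ?A = int (card (hom_boxes n r))"
  proof -
    have "sum f ?A = (\<Sum>(j, i)\<in>?A. int (r j j * r i i))"
      using far by (intro sum.cong refl) (auto simp: f_def of_nat_mult[symmetric] simp del: of_nat_mult)
    also have "\<dots> = (\<Sum>(j, i)\<in>Sigma {..n} (\<lambda>j. {j + 2..n}). int (r j j * r i i))"
      by (intro sum.cong) auto
    also have "\<dots> = (\<Sum>j\<le>n. \<Sum>i\<in>{j + 2..n}. int (r j j * r i i))"
      by (rule sum.Sigma[symmetric]) auto
    also have "\<dots> = int (card (hom_boxes n r))"
      unfolding card_hom_boxes col_end_def by (simp add: sum_distrib_left)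
    finally show ?thesis .
  qed
  finally show ?thesis by simp
qed

lemma perm_length_zel_ranks:
  assumes z: "zel_ranks n r u"
  shows "quiver_codim n r + int (card (hom_boxes n r)) \<le> int (perm_length u)"
    and "block_mono n r u \<longleftrightarrow> int (perm_length u) = quiver_codim n r + int (card (hom_boxes n r))"
proof -
  let ?d = "total_dim n r"
  have u: "u permutes {1..?d}" using z by (simp add: zel_ranks_def)
  define I where "I = {(t, t'). t < t' \<and> u t' < u t}"
  have I_mem: "t \<in> {1..?d} \<and> t' \<in> {1..?d}" if "(t, t') \<in> I" for t t'
    using inversion_in_range[OF u, of t t'] that by (simp add: I_def)
  have finI: "finite I" unfolding I_def by (rule finite_inversions[OF u])
  have sub: "block_inversions n r u \<subseteq> I" using block_inversions_subset by (simp add: I_def)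
  have len: "perm_length u = card I" by (simp add: perm_length_def I_def)
  have "card (block_inversions n r u) \<le> perm_length u" unfolding len by (rule card_mono[OF finI sub])
  then show "quiver_codim n r + int (card (hom_boxes n r)) \<le> int (perm_length u)"
    using card_block_inversions[OF z] by simp
  have "int (perm_length u) = quiver_codim n r + int (card (hom_boxes n r)) \<longleftrightarrow> card I = card (block_inversions n r u)"
    using card_block_inversions[OF z] len by linarith
  also have "\<dots> \<longleftrightarrow> I \<subseteq> block_inversions n r u"
    using card_subset_eq[OF finI sub] sub by auto
  also have "\<dots> \<longleftrightarrow> block_mono n r u"
  proof
    assume IG: "I \<subseteq> block_inversions n r u"
    have neq: "u q \<noteq> u q'" if "q < q'" for q q' using permutes_inj[OF u] that by (auto dest: injD)
    show "block_mono n r u" unfolding block_mono_def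
    proof (intro conjI allI impI ballI)
      fix j q q' assume *: "j \<le> n" "q \<in> block_row r j" "q' \<in> block_row r j" "q < q'"
      show "u q < u q'"
      proof (rule ccontr)
        assume "\<not> u q < u q'"
        then have "(q, q') \<in> I" using neq[OF *(4)] *(4) by (auto simp: I_def)
        then obtain k where "q \<in> block_row r k" "row_offset r (Suc k) < q'"
          using IG by (auto simp: block_inversions_def)
        then show False using block_row_unique[OF *(2)] *(3) by (auto simp: block_row_def)
      qed
    next
      fix i q q' assume i: "i \<le> n" and *: "u q \<in> block_col n r i \<and> u q' \<in> block_col n r i \<and> q < q'"
      show "u q < u q'"
      proof (rule ccontr)
        assume "\<not> u q < u q'"
        then have "(q, q') \<in> I" using neq[of q q'] * by (auto simp: I_def)
        then obtain k where "col_end n r k < u q" "u q' \<in> block_col n r k"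
          using IG by (auto simp: block_inversions_def)
        then show False using block_col_unique[of "u q'" n r k i] * by (auto simp: block_col_def)
      qed
    qed
  next
    assume m: "block_mono n r u"
    show "I \<subseteq> block_inversions n r u"
    proof
      fix x assume x: "x \<in> I"
      obtain t t' where xt: "x = (t, t')" by (cases x)
      have t: "t \<in> {1..?d}" "t' \<in> {1..?d}" "t < t'" "u t' < u t"
        using I_mem[of t t'] x by (simp_all add: I_def xt)
      have ut: "u t \<in> {1..?d}" "u t' \<in> {1..?d}"
        using permutes_in_image[OF u, of t] permutes_in_image[OF u, of t'] t(1,2) by blast+
      obtain j where j: "j \<le> n" "t \<in> block_row r j"
        using block_row_below[of t r "Suc n"] t by (auto simp: row_offset_total less_Suc_eq_le)
      obtain i where i: "i \<le> n" "u t' \<in> block_col n r i"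
        using block_col_right[of "u t'" n r 0] ut by (auto simp: col_end_total)
      have "row_offset r (Suc j) < t'"
      proof (rule ccontr)
        assume "\<not> row_offset r (Suc j) < t'"
        then have "t' \<in> block_row r j" using j t by (auto simp: block_row_def)
        then have "u t < u t'" using m j t unfolding block_mono_def by blast
        then show False using t by simp
      qed
      moreover have "col_end n r i < u t"
      proof (rule ccontr)
        assume "\<not> col_end n r i < u t"
        then have "u t \<in> block_col n r i" using i t by (auto simp: block_col_def)
        then have "u t < u t'" using m i t unfolding block_mono_def by blast
        then show False using t by simp
      qed
      ultimately show "x \<in> block_inversions n r u" using i j t by (auto simp: block_inversions_def xt)
    qed
  qed
  finally show "block_mono n r u \<longleftrightarrow> int (perm_length u) = quiver_codim n r + int (card (hom_boxes n r))" by blast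
qed

section \<open>Existence of the Zelevinsky permutation\<close>

lemma same_block_row_offset:
  assumes "q \<in> block_row r j" "q' \<in> block_row r j"
  shows "row_offset r k < q \<longleftrightarrow> row_offset r k < q'"
proof (cases "k \<le> j")
  case True
  then show ?thesis using assms row_offset_mono[OF True, of r] by (auto simp: block_row_def)
next
  case False
  then show ?thesis using assms row_offset_mono[of "Suc j" k r] by (auto simp: block_row_def)
qed

lemma same_block_col_end:
  assumes "p \<in> block_col n r i" "p' \<in> block_col n r i"
  shows "col_end n r k < p \<longleftrightarrow> col_end n r k < p'"
proof (cases "k \<le> i")
  case True
  then show ?thesis using assms col_end_antimono[OF True, of n r] by (auto simp: block_col_def)
next
  case False
  then show ?thesis using assms col_end_antimono[of "Suc i" k n r] by (auto simp: block_col_def)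
qed

lemma swap_in_block_row:
  assumes z: "zel_ranks n r u" and j: "j \<le> n" "q \<in> block_row r j" "q' \<in> block_row r j"
  shows "zel_ranks n r (u \<circ> transpose q q')"
proof -
  let ?d = "total_dim n r"
  let ?s = "transpose q q'"
  have u: "u permutes {1..?d}" using z by (simp add: zel_ranks_def)
  have q: "q \<in> {1..?d}" "q' \<in> {1..?d}" using block_row_subset[OF j(1)] j by blast+
  have row: "row_offset r k < ?s t \<longleftrightarrow> row_offset r k < t" for k t
    using same_block_row_offset[OF j(2,3), of k] by (auto simp: transpose_def)
  have top: "?s t \<le> ?d \<longleftrightarrow> t \<le> ?d" for t using q by (auto simp: transpose_def)
  have s: "inj ?s" "range ?s = UNIV" using permutes_inj[OF permutes_swap_id[OF q]] permutes_surj[OF permutes_swap_id[OF q]] by blast+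
  have "corner_count n r (u \<circ> ?s) i k = corner_count n r u i k" for i k
  proof -
    have eq: "{t. row_offset r k < t \<and> t \<le> ?d \<and> col_end n r (Suc i) < (u \<circ> ?s) t} =
      ?s -` {t. row_offset r k < t \<and> t \<le> ?d \<and> col_end n r (Suc i) < u t}"
      using row top by auto
    show ?thesis unfolding corner_count_def eq by (rule card_vimage_inj) (use s in simp_all)
  qed
  moreover have "?s t \<in> block_row r k" if "t \<in> block_row r k" for t k
    using that row[of k t] row[of "Suc k" t] unfolding block_row_def greaterThanAtMost_iff
    by (metis linorder_not_less)
  ultimately show ?thesis
    using z permutes_compose[OF permutes_swap_id[OF q] u] by (auto simp: zel_ranks_def)
qed

lemma swap_in_block_col:
  assumes z: "zel_ranks n r u" and i: "u q \<in> block_col n r i" "u q' \<in> block_col n r i"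
  shows "zel_ranks n r (u \<circ> transpose q q')"
proof -
  let ?d = "total_dim n r"
  have u: "u permutes {1..?d}" using z by (simp add: zel_ranks_def)
  have q: "q \<in> {1..?d}" "q' \<in> {1..?d}"
    using block_col_subset i permutes_in_image[OF u, of q] permutes_in_image[OF u, of q'] by blast+
  have col: "col_end n r k < (u \<circ> transpose q q') t \<longleftrightarrow> col_end n r k < u t" for k t
    using same_block_col_end[OF i, of k] by (auto simp: transpose_def)
  show ?thesis
    using z permutes_compose[OF permutes_swap_id[OF q] u]
    unfolding zel_ranks_def corner_count_def col by blast
qed

text \<open>A permutation maximising \<open>\<Sum> t u(t)\<close> among those with the given ranks has no inversions inside blocks.\<close>

lemma zelevinsky_perm_exists_of_ranks:
  assumes "zel_ranks n r u0"
  shows "\<exists>u. is_zelevinsky_perm n r u"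
proof -
  let ?d = "total_dim n r"
  define f where "f u = (\<Sum>t\<in>{1..?d}. t * u t)" for u :: "nat \<Rightarrow> nat"
  have bound: "f u \<le> (\<Sum>t\<in>{1..?d}. t * ?d)" if "zel_ranks n r u" for u
  proof -
    have "u permutes {1..?d}" using that by (simp add: zel_ranks_def)
    then have "u t \<le> ?d" if "t \<in> {1..?d}" for t using permutes_le[of u ?d t] that by simp
    then show ?thesis unfolding f_def by (intro sum_mono mult_le_mono2)
  qed
  have "\<exists>u. zel_ranks n r u \<and> (\<forall>v. zel_ranks n r v \<longrightarrow> f v \<le> f u)"
    using bound by (intro ex_has_greatest_nat[of "zel_ranks n r" u0 f "Suc (\<Sum>t\<in>{1..?d}. t * ?d)"] assms)
      (auto simp: less_Suc_eq_le)
  then obtain u where z: "zel_ranks n r u" and mx: "\<And>v. zel_ranks n r v \<Longrightarrow> f v \<le> f u" by blast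
  have u: "u permutes {1..?d}" using z by (simp add: zel_ranks_def)
  have no_swap: "u q < u q'" if q: "q \<in> {1..?d}" "q' \<in> {1..?d}" "q < q'"
      and zs: "zel_ranks n r (u \<circ> transpose q q')" for q q'
  proof (rule ccontr)
    assume "\<not> u q < u q'"
    moreover have "u q \<noteq> u q'" using q permutes_inj[OF u] by (auto dest: injD)
    ultimately have "u q' < u q" by simp
    then obtain a b where ab: "q' = q + Suc a" "u q = u q' + Suc b"
      using q(3) by (metis less_iff_Suc_add add_Suc_right)
    have split: "f v = (\<Sum>t\<in>{1..?d} - {q, q'}. t * v t) + (q * v q + q' * v q')" for v
      unfolding f_def using q by (subst sum.subset_diff[of "{q, q'}"]) auto
    have "f (u \<circ> transpose q q') = (\<Sum>t\<in>{1..?d} - {q, q'}. t * u t) + (q * u q' + q' * u q)"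
      unfolding split by (intro arg_cong2[where f = plus] sum.cong) (auto simp: transpose_def)
    \<comment> \<open>The swap gains the product of the two differences,
      \<open>Suc a * Suc b\<close>.\<close>
    also have "\<dots> > f u" unfolding split[of u] ab by (simp add: algebra_simps)
    finally show False using mx[OF zs] by simp
  qed
  have "block_mono n r u" unfolding block_mono_def
  proof (intro conjI allI impI ballI)
    fix j q q' assume "j \<le> n" "q \<in> block_row r j" "q' \<in> block_row r j" "q < q'"
    then show "u q < u q'" using no_swap swap_in_block_row[OF z] block_row_subset by blast
  next
    fix i q q' assume *: "i \<le> n" "u q \<in> block_col n r i \<and> u q' \<in> block_col n r i \<and> q < q'"
    then have "q \<in> {1..?d}" "q' \<in> {1..?d}"
      using block_col_subset permutes_in_image[OF u, of q] permutes_in_image[OF u, of q'] by blast+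
    then show "u q < u q'" using no_swap swap_in_block_col[OF z] * by blast
  qed
  then show ?thesis using z is_zelevinsky_perm_iff by blast
qed

lemma fibrewise_bijection:
  fixes f :: "'a \<Rightarrow> 'l" and g :: "'b \<Rightarrow> 'l"
  assumes "finite A" "finite B" "\<And>l. card {a \<in> A. f a = l} = card {b \<in> B. g b = l}"
  obtains h where "bij_betw h A B" "\<And>a. a \<in> A \<Longrightarrow> g (h a) = f a"
proof -
  have "\<exists>h. bij_betw h {a \<in> A. f a = l} {b \<in> B. g b = l}" for l
    by (rule finite_same_card_bij) (use assms in auto)
  then obtain H where H: "\<And>l. bij_betw (H l) {a \<in> A. f a = l} {b \<in> B. g b = l}" by metis
  define h where "h a = H (f a) a" for a
  have h: "h a \<in> B \<and> g (h a) = f a" if "a \<in> A" for a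
    using bij_betwE[OF H[of "f a"]] that by (auto simp: h_def)
  have "bij_betw h A B"
  proof (rule bij_betw_imageI)
    show "inj_on h A"
    proof (rule inj_onI)
      fix x y assume xy: "x \<in> A" "y \<in> A" "h x = h y"
      then have "f x = f y" using h by metis
      then show "x = y" using bij_betw_imp_inj_on[OF H[of "f x"]] xy by (auto simp: h_def inj_on_def)
    qed
    show "h ` A = B"
    proof (intro equalityI subsetI)
      fix b assume "b \<in> B"
      then have "b \<in> H (g b) ` {a \<in> A. f a = g b}" using bij_betw_imp_surj_on[OF H[of "g b"]] by simp
      then obtain a where a: "a \<in> A" "f a = g b" "b = H (g b) a" by auto
      then have "h a = b" by (simp add: h_def)
      then show "b \<in> h ` A" using a(1) by blast
    qed (use h in auto)
  qed
  with h that show ?thesis by blast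
qed

text \<open>\<open>Z\<close> holds one token for each 1 to be placed. The row sums allow rows to be
  matched with tokens of their block row, the column sums allow tokens to be matched with columns of
  their block column, and the permutation is the composite.\<close>

lemma permutation_with_block_counts:
  fixes N :: "nat \<Rightarrow> nat \<Rightarrow> nat"
  assumes rows: "\<And>j. j \<le> n \<Longrightarrow> (\<Sum>i\<le>n. N j i) = r j j"
    and cols: "\<And>i. i \<le> n \<Longrightarrow> (\<Sum>j\<le>n. N j i) = r i i"
  obtains u where "u permutes {1..total_dim n r}"
    "\<And>i j. i \<le> n \<Longrightarrow> j \<le> n \<Longrightarrow> card {q \<in> block_row r j. u q \<in> block_col n r i} = N j i"
proof -
  let ?d = "total_dim n r"
  define Z where "Z = Sigma {..n} (\<lambda>j. Sigma {..n} (\<lambda>i. {..<N j i}))"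
  have finZ: "finite Z" by (simp add: Z_def)
  define \<rho> where "\<rho> q = (THE j. j \<le> n \<and> q \<in> block_row r j)" for q
  define \<gamma> where "\<gamma> p = (THE i. i \<le> n \<and> p \<in> block_col n r i)" for p
  have rho_eq: "\<rho> q = j" if "j \<le> n" "q \<in> block_row r j" for q j
    unfolding \<rho>_def using that block_row_unique by (intro the_equality) auto
  have gamma_eq: "\<gamma> p = i" if "i \<le> n" "p \<in> block_col n r i" for p i
    unfolding \<gamma>_def using that block_col_unique by (intro the_equality) auto
  have rho: "\<rho> q \<le> n \<and> q \<in> block_row r (\<rho> q)" if "q \<in> {1..?d}" for q
  proof -
    have "1 \<le> q" "q \<le> row_offset r (Suc n)" using that by (simp_all add: row_offset_total)
    then obtain j where "j < Suc n" "q \<in> block_row r j" by (rule block_row_below)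
    then show ?thesis using rho_eq[of j q] by simp
  qed
  have gamma: "\<gamma> p \<le> n \<and> p \<in> block_col n r (\<gamma> p)" if "p \<in> {1..?d}" for p
  proof -
    have "1 \<le> p" "p \<le> col_end n r 0" using that by (simp_all add: col_end_total)
    then obtain i where "i \<le> n" "p \<in> block_col n r i" by (rule block_col_right)
    then show ?thesis using gamma_eq[of i p] by simp
  qed
  have row_fib: "card {q \<in> {1..?d}. \<rho> q = j} = card {z \<in> Z. fst z = j}" for j
  proof (cases "j \<le> n")
    case True
    have "{q \<in> {1..?d}. \<rho> q = j} = block_row r j"
      using rho rho_eq[OF True] block_row_subset[OF True, of r] by blast
    moreover have "{z \<in> Z. fst z = j} = {j} \<times> Sigma {..n} (\<lambda>i. {..<N j i})"
      using True by (auto simp: Z_def)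
    then have "card {z \<in> Z. fst z = j} = r j j" using rows[OF True] by (simp add: card_cartesian_product)
    ultimately show ?thesis by (simp add: card_block_row)
  next
    case False
    then have "{q \<in> {1..?d}. \<rho> q = j} = {}" "{z \<in> Z. fst z = j} = {}" using rho by (auto simp: Z_def)
    then show ?thesis by (simp only: card.empty)
  qed
  have col_fib: "card {p \<in> {1..?d}. \<gamma> p = i} = card {z \<in> Z. fst (snd z) = i}" for i
  proof (cases "i \<le> n")
    case True
    have "{p \<in> {1..?d}. \<gamma> p = i} = block_col n r i"
      using gamma gamma_eq[OF True] block_col_subset[of n r i] by blast
    moreover have "card {z \<in> Z. fst (snd z) = i} = card (Sigma {..n} (\<lambda>j. {..<N j i}))"
    proof (rule bij_betw_same_card)
      show "bij_betw (\<lambda>(j, i, k). (j, k)) {z \<in> Z. fst (snd z) = i} (Sigma {..n} (\<lambda>j. {..<N j i}))"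
        by (rule bij_betw_byWitness[where f' = "\<lambda>(j, k). (j, i, k)"]) (use True in \<open>auto simp: Z_def\<close>)
    qed
    ultimately show ?thesis using cols[OF True] True by (simp add: card_block_col)
  next
    case False
    then have "{p \<in> {1..?d}. \<gamma> p = i} = {}" "{z \<in> Z. fst (snd z) = i} = {}" using gamma by (auto simp: Z_def)
    then show ?thesis by (simp only: card.empty)
  qed
  obtain g where g: "bij_betw g {1..?d} Z" "\<And>q. q \<in> {1..?d} \<Longrightarrow> fst (g q) = \<rho> q"
    using fibrewise_bijection[OF _ finZ row_fib] by auto
  obtain h where h: "bij_betw h Z {1..?d}" "\<And>z. z \<in> Z \<Longrightarrow> \<gamma> (h z) = fst (snd z)"
    using fibrewise_bijection[OF finZ _ col_fib[symmetric]] by auto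
  define u where "u q = (if q \<in> {1..?d} then h (g q) else q)" for q
  have "bij_betw (h \<circ> g) {1..?d} {1..?d}" using g(1) h(1) by (rule bij_betw_trans)
  then have "bij_betw u {1..?d} {1..?d}" by (rule bij_betw_cong[THEN iffD1, rotated]) (simp add: u_def)
  then have "u permutes {1..?d}" by (rule bij_imp_permutes) (simp only: u_def if_False)
  moreover have "card {q \<in> block_row r j. u q \<in> block_col n r i} = N j i" if "i \<le> n" "j \<le> n" for i j
  proof -
    have gz: "g q \<in> Z" if "q \<in> {1..?d}" for q using bij_betwE[OF g(1)] that by blast
    have hz: "h z \<in> {1..?d}" if "z \<in> Z" for z using bij_betwE[OF h(1)] that by blast
    define Q where "Q = {q \<in> {1..?d}. fst (g q) = j \<and> fst (snd (g q)) = i}"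
    have "{q \<in> block_row r j. u q \<in> block_col n r i} = Q" unfolding Q_def
    proof (intro Set.set_eqI)
      fix q
      show "q \<in> {q \<in> block_row r j. u q \<in> block_col n r i} \<longleftrightarrow> q \<in> {q \<in> {1..?d}. fst (g q) = j \<and> fst (snd (g q)) = i}"
      proof (cases "q \<in> {1..?d}")
        case True
        have "q \<in> block_row r j \<longleftrightarrow> \<rho> q = j" using rho[OF True] rho_eq[OF \<open>j \<le> n\<close>] by blast
        moreover have "u q \<in> block_col n r i \<longleftrightarrow> \<gamma> (h (g q)) = i"
          using gamma[OF hz[OF gz[OF True]]] gamma_eq[OF \<open>i \<le> n\<close>] True unfolding u_def by auto
        ultimately show ?thesis using g(2)[OF True] h(2)[OF gz[OF True]] True by simp
      next
        case False
        then show ?thesis using block_row_subset[OF \<open>j \<le> n\<close>, of r] by blast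
      qed
    qed
    moreover have "card Q = card (g ` Q)"
      by (rule card_image[symmetric]) (rule inj_on_subset[OF bij_betw_imp_inj_on[OF g(1)]], auto simp: Q_def)
    moreover have "g ` Q = {z \<in> Z. fst z = j \<and> fst (snd z) = i}"
      using bij_betw_imp_surj_on[OF g(1)] unfolding Q_def by blast
    moreover have "{z \<in> Z. fst z = j \<and> fst (snd z) = i} = {j} \<times> {i} \<times> {..<N j i}" using that by (auto simp: Z_def)
    ultimately show ?thesis by (simp add: card_cartesian_product)
  qed
  ultimately show ?thesis using that by blast
qed

lemma telescope_up: "(\<Sum>i\<le>m. g (int i) - g (int i - 1)) = g (int m) - (g (- 1) :: int)"
  by (induction m) (auto simp: algebra_simps)

lemma telescope_down: "i \<le> m \<Longrightarrow> (\<Sum>j = i..m. h j - h (Suc j)) = h i - (h (Suc m) :: int)"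
  by (induction m rule: dec_induct) auto

text \<open>The prescribed counts have the right margins. The lace counts of block row
  \<open>j\<close> telescope to \<open>r j j - r j (j + 1)\<close>, those of block column
  \<open>i\<close> to \<open>r i i - r (i - 1) i\<close>, and the blocks with
  \<open>i = j + 1\<close> supply what is missing. Nonnegativity makes the counts natural
  numbers.\<close>

lemma zelevinsky_perm_exists:
  assumes occ: "can_occur TYPE('k::field) n r" and n: "1 \<le> n"
  shows "\<exists>u. is_zelevinsky_perm n r u"
proof -
  define E where "E = rank_ext n r"
  define N where "N j i = (if i \<le> j then nat (lace_count n r (int i) (int j))
     else if i = Suc j then r j (Suc j) else 0)" for i j
  define L where "L i j = lace_count n r (int i) (int j)" for i j
  have N: "int (N j i) = (if i \<le> j then L i j else 0) + (if i = Suc j then int (r j (Suc j)) else 0)"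
    if "j \<le> n" for i j
    using lace_count_nonneg[OF occ n _ that, of i] by (simp add: N_def L_def)
  have rows: "(\<Sum>i\<le>n. N j i) = r j j" if j: "j \<le> n" for j
  proof -
    define g where "g x = E x (int j) - E x (int j + 1)" for x
    have "(\<Sum>i\<le>n. if i \<le> j then L i j else 0) = (\<Sum>i\<le>j. L i j)"
      using j by (intro sum.mono_neutral_cong_right) auto
    also have "\<dots> = (\<Sum>i\<le>j. g (int i) - g (int i - 1))"
      by (intro sum.cong) (auto simp: L_def lace_count_def E_def g_def)
    also have "\<dots> = g (int j) - g (- 1)" by (rule telescope_up)
    also have "\<dots> = int (r j j) - E (int j) (int j + 1)"
      using j by (simp add: g_def E_def rank_ext_def)
    finally have 1: "(\<Sum>i\<le>n. if i \<le> j then L i j else 0) = int (r j j) - E (int j) (int j + 1)" .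
    have "int (\<Sum>i\<le>n. N j i) = (\<Sum>i\<le>n. (if i \<le> j then L i j else 0) + (if i = Suc j then int (r j (Suc j)) else 0))"
      by (simp add: N[OF j])
    also have "\<dots> = int (r j j) - E (int j) (int j + 1) + (if Suc j \<le> n then int (r j (Suc j)) else 0)"
      unfolding sum.distrib 1 by simp
    also have "\<dots> = int (r j j)" using j by (simp add: E_def rank_ext_def nat_add_distrib)
    finally show ?thesis by linarith
  qed
  have cols: "(\<Sum>j\<le>n. N j i) = r i i" if i: "i \<le> n" for i
  proof -
    define h where "h j = E (int i) (int j) - E (int i - 1) (int j)" for j
    have "(\<Sum>j\<le>n. if i \<le> j then L i j else 0) = (\<Sum>j = i..n. L i j)"
      by (intro sum.mono_neutral_cong_right) auto
    also have "\<dots> = (\<Sum>j = i..n. h j - h (Suc j))"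
      by (intro sum.cong) (auto simp: L_def lace_count_def E_def h_def add.commute)
    also have "\<dots> = h i - h (Suc n)" by (rule telescope_down[OF i])
    also have "\<dots> = int (r i i) - E (int i - 1) (int i)" using i by (simp add: h_def E_def rank_ext_def)
    finally have 1: "(\<Sum>j\<le>n. if i \<le> j then L i j else 0) = int (r i i) - E (int i - 1) (int i)" .
    have 2: "(\<Sum>j\<le>n. if i = Suc j then int (r j (Suc j)) else 0) = E (int i - 1) (int i)"
    proof (cases i)
      case 0
      then show ?thesis by (simp add: E_def rank_ext_def)
    next
      case (Suc k)
      then have "(\<Sum>j\<le>n. if i = Suc j then int (r j (Suc j)) else 0) = (\<Sum>j\<le>n. if j = k then int (r k (Suc k)) else 0)"
        by (intro sum.cong) auto
      also have "\<dots> = int (r k (Suc k))" using Suc i by simp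
      finally show ?thesis using Suc i by (simp add: E_def rank_ext_def nat_add_distrib)
    qed
    have "int (\<Sum>j\<le>n. N j i) = (\<Sum>j\<le>n. (if i \<le> j then L i j else 0) + (if i = Suc j then int (r j (Suc j)) else 0))"
      by (simp add: N)
    also have "\<dots> = int (r i i)" unfolding sum.distrib 1 2 by simp
    finally show ?thesis by linarith
  qed
  obtain u where u: "u permutes {1..total_dim n r}"
    "\<And>i j. i \<le> n \<Longrightarrow> j \<le> n \<Longrightarrow> card {q \<in> block_row r j. u q \<in> block_col n r i} = N j i"
    using permutation_with_block_counts[of n N r, OF rows cols] by blast
  have "zel_ranks n r u" unfolding zel_ranks_iff_block_counts
    using u N by (auto simp: L_def)
  then show ?thesis by (rule zelevinsky_perm_exists_of_ranks)
qed

lemma zelevinsky_perm_eqI: "is_zelevinsky_perm n r v \<Longrightarrow> zelevinsky_perm n r = v"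
  unfolding zelevinsky_perm_def by (rule the_equality) (auto intro: zelevinsky_perm_unique)

section \<open>The length of the lacing diagram of a pipe dream\<close>

text \<open>Up to a level, a path reads only tiles below that level, from its own starting row
  upwards and not to the left of its starting column.\<close>

lemma steps_transfer:
  assumes "((s, q, p), (s', q', p')) \<in> (pipe_step D)\<^sup>*"
    and "\<And>a b. q1 < a \<Longrightarrow> a \<le> q \<Longrightarrow> p \<le> b \<Longrightarrow> (a, b) \<in> D \<longleftrightarrow> (a, b) \<in> E"
    and "q1 < q' \<or> s' = South \<and> q1 \<le> q'"
  shows "((s, q, p), (s', q', p')) \<in> (pipe_step E)\<^sup>*"
proof -
  have "case e of (s', q', p') \<Rightarrow> q1 < q' \<or> s' = South \<and> q1 \<le> q' \<longrightarrow> ((s, q, p), e) \<in> (pipe_step E)\<^sup>*"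
    if "((s, q, p), e) \<in> (pipe_step D)\<^sup>*" for e
    using that
  proof induction
    case base
    then show ?case by simp
  next
    case (step e e')
    obtain s1 a b s2 a2 b2 where e: "e = (s1, a, b)" "e' = (s2, a2, b2)" by (metis prod_cases3)
    have "q1 < a \<and> ((s1, a, b), (s2, a2, b2)) \<in> pipe_step E" if *: "q1 < a2 \<or> s2 = South \<and> q1 \<le> a2"
    proof -
      have st: "((s1, a, b), (s2, a2, b2)) \<in> pipe_step D" using step(2) by (simp add: e)
      then have "q1 < a" using * by (auto elim!: pipe_step_cases)
      moreover have "a \<le> q" "p \<le> b" using steps_mono[of s q p s1 a b D] step(1) by (auto simp: e)
      ultimately have "(a, b) \<in> D \<longleftrightarrow> (a, b) \<in> E" using assms(2) by blast
      with st \<open>q1 < a\<close> show ?thesis by (simp add: pipe_step_iff)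
    qed
    then show ?case using step(3) unfolding e prod.case by (blast intro: rtrancl_into_rtrancl)
  qed
  from this[OF assms(1)] assms(3) show ?thesis unfolding prod.case by blast
qed

lemma pipe_steps: "pipe D t s q p \<Longrightarrow> ((s, q, p), (s', q', p')) \<in> (pipe_step D)\<^sup>* \<Longrightarrow> pipe D t s' q' p'"
  unfolding pipe_iff_steps by (rule rtrancl_trans)

lemma pipe_elbows_start:
  assumes "pipe D t s q p" "\<And>q' p'. q0 < q' \<Longrightarrow> (q', p') \<notin> D" "q0 < q \<or> s = South \<and> q0 \<le> q"
  shows "edge_index s q p = t"
  using assms(1,3)
proof induction
  case start
  show ?case by (simp add: edge_index_def)
next
  case (west_cross q p)
  then show ?case using assms(2) by auto
next
  case (west_elbow q p)
  then show ?case by (auto simp: edge_index_def)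
next
  case (south_cross q p)
  then have "q0 < Suc q" by auto
  then show ?case using south_cross assms(2) by blast
next
  case (south_elbow q p)
  then show ?case by (auto simp: edge_index_def)
qed

text \<open>Rows are treated from the top and columns from the left. If \<open>(q, p)\<close> were
  the first missing box, the pipe of row \<open>q\<close> would cross to column \<open>p\<close>,
  turn north there and climb through crossings to the exit at \<open>p\<close>, too far left for its
  block row.\<close>

lemma hom_boxes_subset_pipe_dream:
  assumes pd: "pipe_dream (total_dim n r) D"
    and ranks: "\<And>j t. j \<le> n \<Longrightarrow> t \<in> block_row r j \<Longrightarrow> col_end n r (j + 2) < pipe_perm (total_dim n r) D t"
  shows "hom_boxes n r \<subseteq> D"
proof -
  have "(q, p) \<in> D" if "(q, p) \<in> hom_boxes n r" for q p
    using that
  proof (induction q arbitrary: p rule: less_induct)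
    case (less q)
    note IHq = less.IH
    show ?case using less.prems
    proof (induction p rule: less_induct)
      case (less p)
      then obtain j where j: "j \<le> n" "q \<in> block_row r j" "1 \<le> p" "p \<le> col_end n r (j + 2)"
        by (auto simp: hom_boxes_def)
      show ?case
      proof (rule ccontr)
        assume nin: "(q, p) \<notin> D"
        have q1: "1 \<le> q" using j(2) by (simp add: block_row_def)
        then obtain q' where q': "q = Suc q'" by (cases q) auto
        have "pipe D q West q (Suc k)" if "k < p" for k
          using that
        proof (induction k)
          case 0
          show ?case using pipe.start[of D q] by simp
        next
          case (Suc k)
          have "(q, Suc k) \<in> hom_boxes n r" using j Suc.prems by (auto simp: hom_boxes_def)
          then have "(q, Suc k) \<in> D" using less.IH[of "Suc k"] Suc.prems by simp
          moreover have "pipe D q West q (Suc k)" using Suc by simp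
          ultimately show ?case using pipe.west_cross[of D q q' "Suc k"] unfolding q' by simp
        qed
        from this[of "p - 1"] have "pipe D q West q p" using j(3) by simp
        then have "pipe D q South q' p" using nin pipe.west_elbow[of D q q' p] unfolding q' by simp
        moreover have "(a, p) \<in> D" if a: "1 \<le> a" "a \<le> q'" for a
        proof -
          have "a \<le> row_offset r (Suc j)" using a j(2) q' by (simp add: block_row_def)
          then have "(a, p) \<in> hom_boxes n r" using a(1) j by (intro hom_boxesI[of a r "Suc j"]) simp_all
          then show ?thesis using IHq a q' by simp
        qed
        ultimately have "pipe D q South 0 p" by (rule pipe_straight_up)
        moreover have "q \<in> {1..total_dim n r}" using block_row_subset[OF j(1), of r] j(2) by blast
        ultimately have "pipe_perm (total_dim n r) D q = p" using pipe_perm_exit[OF pd, of q p] by simp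
        then show False using ranks[OF j(1,2)] j(4) by simp
      qed
    qed
  qed
  then show ?thesis by auto
qed

text \<open>With \<open>w0\<close> the reversal of \<open>{1..d}\<close>, this is the product of
  \<open>w0\<close>, the inverse of \<open>u\<close>, and \<open>w0\<close>. The inverse appears
  because lacing diagrams follow the pipes from northeast to southwest, the reversal because
  positions in a block are counted from the right.\<close>

definition rotated_inverse :: "nat \<Rightarrow> (nat \<Rightarrow> nat) \<Rightarrow> nat \<Rightarrow> nat" where
  "rotated_inverse d u i = (if i \<in> {1..d} then Suc d - inv_into UNIV u (Suc d - i) else i)"

lemma rotated_inverse:
  assumes u: "u permutes {1..d}"
  shows "rotated_inverse d u permutes {1..d}"
    and "perm_length (rotated_inverse d u) \<le> perm_length u"
proof -
  let ?v = "rotated_inverse d u"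
  note iu = permutes_inv[OF u]
  have inv_range: "inv_into UNIV u i \<in> {1..d}" if "i \<in> {1..d}" for i
    using permutes_in_image[OF iu, of i] that by simp
  have v: "?v permutes {1..d}"
  proof (rule bij_imp_permutes)
    show "bij_betw ?v {1..d} {1..d}"
    proof (rule bij_betw_byWitness[where f' = "\<lambda>k. Suc d - u (Suc d - k)"])
      have *: "Suc d - i \<in> {1..d}" if "i \<in> {1..d}" for i using that by auto
      have **: "Suc d - (Suc d - i) = i" if "i \<in> {1..d}" for i using that by auto
      have u_range: "u i \<in> {1..d}" if "i \<in> {1..d}" for i
        using permutes_in_image[OF u, of i] that by simp
      show "\<forall>i\<in>{1..d}. Suc d - u (Suc d - ?v i) = i"
      proof
        fix i assume i: "i \<in> {1..d}"
        have "Suc d - ?v i = inv_into UNIV u (Suc d - i)"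
          using i **[OF inv_range[OF *[OF i]]] unfolding rotated_inverse_def by simp
        then show "Suc d - u (Suc d - ?v i) = i" using permutes_inverses(1)[OF u] **[OF i] by simp
      qed
      show "\<forall>k\<in>{1..d}. ?v (Suc d - u (Suc d - k)) = k"
      proof
        fix k assume k: "k \<in> {1..d}"
        then show "?v (Suc d - u (Suc d - k)) = k"
          using *[OF u_range[OF *[OF k]]] **[OF u_range[OF *[OF k]]] **[OF k] permutes_inverses[OF u]
          unfolding rotated_inverse_def by simp
      qed
      show "?v ` {1..d} \<subseteq> {1..d}" using inv_range * by (force simp: rotated_inverse_def)
      show "(\<lambda>k. Suc d - u (Suc d - k)) ` {1..d} \<subseteq> {1..d}" using u_range * by force
    qed
    show "?v i = i" if "i \<notin> {1..d}" for i using that by (simp only: rotated_inverse_def if_False)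
  qed
  then show "?v permutes {1..d}" .
  let ?f = "\<lambda>(i, k). (inv_into UNIV u (Suc d - i), inv_into UNIV u (Suc d - k))"
  have "card {(i, k). i < k \<and> ?v k < ?v i} \<le> card {(i, k). i < k \<and> u k < u i}"
  proof (rule card_inj_on_le[where f = ?f])
    have range: "i \<in> {1..d}" "k \<in> {1..d}" if "(i, k) \<in> {(i, k). i < k \<and> ?v k < ?v i}" for i k
      using inversion_in_range[OF v, of i k] that by auto
    show "inj_on ?f {(i, k). i < k \<and> ?v k < ?v i}"
    proof (rule inj_onI)
      fix x y assume x: "x \<in> {(i, k). i < k \<and> ?v k < ?v i}" and y: "y \<in> {(i, k). i < k \<and> ?v k < ?v i}"
        and eq: "?f x = ?f y"
      obtain i k i' k' where xy: "x = (i, k)" "y = (i', k')" by (cases x, cases y)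
      have "Suc d - i = Suc d - i'" "Suc d - k = Suc d - k'"
        using eq permutes_inj[OF iu] unfolding xy by (auto dest: injD)
      then show "x = y" using range[OF x[unfolded xy]] range[OF y[unfolded xy]] unfolding xy by auto
    qed
    show "?f ` {(i, k). i < k \<and> ?v k < ?v i} \<subseteq> {(i, k). i < k \<and> u k < u i}"
    proof
      fix z assume "z \<in> ?f ` {(i, k). i < k \<and> ?v k < ?v i}"
      then obtain i k where ik: "(i, k) \<in> {(i, k). i < k \<and> ?v k < ?v i}" "z = ?f (i, k)" by blast
      note rng = range[OF ik(1)]
      have "inv_into UNIV u (Suc d - i) < inv_into UNIV u (Suc d - k)" using ik(1) rng by (auto simp: rotated_inverse_def)
      moreover have "u (inv_into UNIV u (Suc d - k)) < u (inv_into UNIV u (Suc d - i))"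
        using ik(1) rng permutes_inverses(1)[OF u] by auto
      ultimately show "z \<in> {(i, k). i < k \<and> u k < u i}" using ik(2) by simp
    qed
  qed (rule finite_inversions[OF u])
  then show "perm_length ?v \<le> perm_length u" by (simp add: perm_length_def)
qed

lemma rotated_inverse_eq_iff:
  assumes "u permutes {1..d}" "p < d" "q < d"
  shows "rotated_inverse d u (p + 1) = q + 1 \<longleftrightarrow> u (d - q) = d - p"
proof -
  have "inv_into UNIV u (d - p) \<in> {1..d}"
    using permutes_in_image[OF permutes_inv[OF assms(1)], of "d - p"] assms(2) by simp
  then have "rotated_inverse d u (p + 1) = q + 1 \<longleftrightarrow> inv_into UNIV u (d - p) = d - q"
    using assms by (auto simp: rotated_inverse_def)
  also have "\<dots> \<longleftrightarrow> u (d - q) = d - p"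
    using permutes_inverses[OF assms(1)] by metis
  finally show ?thesis .
qed

text \<open>The superantidiagonal block of block row \<open>j\<close> with everything to the right
  of it: a pipe between the tops of the antidiagonal blocks \<open>j + 1\<close> and
  \<open>j\<close> meets only boxes in it.\<close>

definition strip :: "nat \<Rightarrow> (nat \<Rightarrow> nat \<Rightarrow> nat) \<Rightarrow> nat \<Rightarrow> (nat \<times> nat) set" where
  "strip n r j = block_row r j \<times> {col_end n r (j + 2)<..}"

context hom_pipe_dream
begin

text \<open>
  Only the crossings in the strip are kept: outside of it the pipes then run along antidiagonals,
  so the partial permutation is read off, rotated by a half-turn, from the pipe permutation.
\<close>

lemma extension_of_pipe_lacing:
  assumes j: "j < n"
  shows "\<exists>v. extends_partial_perm (pipe_lacing n r D ! j :: 'k::field mat) v \<and>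
    perm_length v \<le> card (D \<inter> strip n r j)"
proof -
  let ?d = "total_dim n r"
  let ?R = "row_offset r" and ?C = "col_end n r"
  define E where "E = D \<inter> strip n r j"
  have E: "pipe_dream ?d E" using pd by (auto simp: E_def pipe_dream_def)
  define u' where "u' = pipe_perm ?d E"
  have u': "u' permutes {1..?d}" unfolding u'_def by (rule pipe_perm_permutes[OF E])
  have agree: "(a, b) \<in> D \<longleftrightarrow> (a, b) \<in> E" if "?R j < a" "a \<le> ?R (Suc j)" "?C (j + 2) < b" for a b
    using that by (auto simp: E_def strip_def block_row_def)
  have below: "(a, b) \<notin> E" if "?R (Suc j) < a" for a b using that by (auto simp: E_def strip_def block_row_def)
  have above: "(a, b) \<notin> E" if "a \<le> ?R j" for a b using that by (auto simp: E_def strip_def block_row_def)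
  have Cj: "?C j = r j j + ?C (Suc j)" "?C (Suc j) = r (Suc j) (Suc j) + ?C (j + 2)"
    using col_end_step[of j n r] col_end_step[of "Suc j" n r] j by simp_all
  have RC: "?R j + ?C j = ?d" "?R (Suc j) + ?C (Suc j) = ?d"
    using row_offset_plus_col_end[of j n r] row_offset_plus_col_end[of "Suc j" n r] j by simp_all
  have Rj: "?R j \<le> ?R (Suc j)" by (rule row_offset_mono) simp
  \<comment> \<open>Below and above the strip \<open>E\<close> has only elbows. So the pipe of
    \<open>E\<close> at position \<open>q\<close> of the lower block top starts in row
    \<open>d - q\<close>, and a pipe at position \<open>p\<close> of the upper block top exits in
    column \<open>d - p\<close>.\<close>
  have main: "joined j (Suc j) p q \<longleftrightarrow> u' (?d - q) = ?d - p" if p: "p < r j j" and q: "q < r (Suc j) (Suc j)" for p q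
  proof -
    define x0 where "x0 = ?C (Suc j) - q"
    define x1 where "x1 = ?C j - p"
    have x0: "?C (j + 2) < x0" "1 \<le> x0" using q Cj by (simp_all add: x0_def)
    have idx: "?R (Suc j) + x0 = ?d - q" "?R j + x1 = ?d - p" using p q Cj RC by (simp_all add: x0_def x1_def)
    have dq: "?d - q \<in> {1..?d}" using idx(1) x0(2) by auto
    obtain t' where t': "pipe E t' South (?R (Suc j)) x0" using pipe_edge_exists[OF E, of x0 South] x0 by blast
    have "t' = ?d - q" using pipe_elbows_start[OF t' below] idx(1) by (simp add: edge_index_def)
    with t' have Eq: "pipe E (?d - q) South (?R (Suc j)) x0" by simp
    have exit: "u' (?d - q) = ?R j + y" if "pipe E (?d - q) South (?R j) y" for y
      using pipe_elbows_tail[OF that above] pipe_perm_exit[OF E dq] by (simp add: u'_def)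
    have path: "((South, ?R (Suc j), x0), (South, ?R j, x1)) \<in> (pipe_step D)\<^sup>* \<longleftrightarrow>
        ((South, ?R (Suc j), x0), (South, ?R j, x1)) \<in> (pipe_step E)\<^sup>*"
      using steps_transfer[of South "?R (Suc j)" x0 South "?R j" x1 D "?R j" E]
        steps_transfer[of South "?R (Suc j)" x0 South "?R j" x1 E "?R j" D] agree x0(1) by auto
    show ?thesis
    proof
      assume "joined j (Suc j) p q"
      then obtain t where "pipe D t South (?R j) x1" "pipe D t South (?R (Suc j)) x0"
        by (auto simp: joined_def meets_block_top_def x0_def x1_def)
      then have "((South, ?R (Suc j), x0), (South, ?R j, x1)) \<in> (pipe_step E)\<^sup>*"
        using pipe_levels_steps Rj path by blast
      from pipe_steps[OF Eq this] show "u' (?d - q) = ?d - p" using exit idx by simp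
    next
      assume eq: "u' (?d - q) = ?d - p"
      have "?R j < ?d - q" using pipe_bounds[OF Eq] Rj by simp
      then obtain y where y: "pipe E (?d - q) South (?R j) y" using pipe_level_exists[OF E] by blast
      then have "y = x1" using exit[OF y] eq idx(2) by simp
      with y have "((South, ?R (Suc j), x0), (South, ?R j, x1)) \<in> (pipe_step D)\<^sup>*"
        using pipe_levels_steps[OF Eq y Rj] path by simp
      moreover obtain t where t: "t \<in> {1..?d}" "pipe D t South (?R (Suc j)) x0"
        using meets_block_top_exists[of "Suc j" q] j q by (auto simp: meets_block_top_def x0_def)
      ultimately have "pipe D t South (?R j) x1" using pipe_steps by blast
      with t show "joined j (Suc j) p q" by (auto simp: joined_def meets_block_top_def x0_def x1_def)
    qed
  qed
  let ?v = "rotated_inverse ?d u'"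
  have "extends_partial_perm (pipe_lacing n r D ! j :: 'k mat) ?v"
    unfolding extends_partial_perm_def
  proof (intro conjI allI impI exI)
    show "?v permutes {1..?d}" by (rule rotated_inverse(1)[OF u'])
    fix p q assume "p < dim_row (pipe_lacing n r D ! j :: 'k mat)" "q < dim_col (pipe_lacing n r D ! j :: 'k mat)"
    then have pq: "p < r j j" "q < r (Suc j) (Suc j)" using pipe_lacing_nth[OF j, where 'a = 'k] by simp_all
    then have "p < ?d" "q < ?d" using Cj RC by linarith+
    from rotated_inverse_eq_iff[OF u' this] main[OF pq]
    show "(pipe_lacing n r D ! j :: 'k mat) $$ (p, q) = 1 \<longleftrightarrow> ?v (p + 1) = q + 1"
      using pq pipe_lacing_nth[OF j, where 'a = 'k] by simp
  qed
  moreover have "perm_length ?v \<le> card (D \<inter> strip n r j)"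
    using rotated_inverse(2)[OF u'] perm_length_pipe_perm_le[OF E] by (simp add: u'_def E_def)
  ultimately show ?thesis by blast
qed

lemma lacing_length_eq_sum:
  "lacing_length (pipe_lacing n r D :: 'k::field mat list) = (\<Sum>j<n. perm_length (completion (pipe_lacing n r D ! j :: 'k mat)))"
proof -
  have "length (pipe_lacing n r D :: 'k mat list) = n" by (simp add: pipe_lacing_def)
  then show ?thesis unfolding lacing_length_def
    by (simp add: sum_list_sum_nth atLeast0LessThan)
qed

text \<open>\<open>arg_min\<close> extends the matrix only if some extension exists. The one
  obtained from the crossings in the strip provides this and also bounds the minimum.\<close>

lemma completion_pipe_lacing:
  assumes "j < n"
  shows "extends_partial_perm (pipe_lacing n r D ! j :: 'k::field mat) (completion (pipe_lacing n r D ! j :: 'k mat))"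
    and "perm_length (completion (pipe_lacing n r D ! j :: 'k mat)) \<le> card (D \<inter> strip n r j)"
proof -
  obtain v where v: "extends_partial_perm (pipe_lacing n r D ! j :: 'k mat) v" "perm_length v \<le> card (D \<inter> strip n r j)"
    using extension_of_pipe_lacing[OF assms] by blast
  show "extends_partial_perm (pipe_lacing n r D ! j :: 'k mat) (completion (pipe_lacing n r D ! j :: 'k mat))"
    unfolding completion_def
    by (rule arg_min_natI[of "extends_partial_perm (pipe_lacing n r D ! j :: 'k mat)" v perm_length, OF v(1)])
  show "perm_length (completion (pipe_lacing n r D ! j :: 'k mat)) \<le> card (D \<inter> strip n r j)"
    unfolding completion_def using arg_min_nat_le[of "extends_partial_perm (pipe_lacing n r D ! j :: 'k mat)" v perm_length] v
    by (meson order_trans)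
qed

text \<open>The strips lie in different block rows and begin where the boxes of
  \<open>hom_boxes\<close> in their block row end, so no crossing is counted twice.\<close>

lemma lacing_length_le:
  "lacing_length (pipe_lacing n r D :: 'k::field mat list) + card (hom_boxes n r) \<le> card D"
proof -
  have fin: "finite D" using pipe_dream_finite[OF pd] .
  have "(\<Sum>j<n. card (D \<inter> strip n r j)) = card (\<Union>j\<in>{..<n}. D \<inter> strip n r j)"
    using fin by (intro card_UN_disjoint[symmetric]) (auto simp: strip_def dest: block_row_unique)
  then have "(\<Sum>j<n. card (D \<inter> strip n r j)) + card (hom_boxes n r) =
      card (\<Union>j\<in>{..<n}. D \<inter> strip n r j) + card (hom_boxes n r)" by simp
  also have "\<dots> = card ((\<Union>j\<in>{..<n}. D \<inter> strip n r j) \<union> hom_boxes n r)"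
  proof (rule card_Un_disjoint[symmetric])
    show "finite (\<Union>j\<in>{..<n}. D \<inter> strip n r j)" using fin by simp
    show "finite (hom_boxes n r)" using hom fin by (rule finite_subset)
    show "(\<Union>j\<in>{..<n}. D \<inter> strip n r j) \<inter> hom_boxes n r = {}"
      by (auto simp: strip_def hom_boxes_def dest: block_row_unique)
  qed
  also have "\<dots> \<le> card D" using hom fin by (intro card_mono) auto
  finally have "(\<Sum>j<n. card (D \<inter> strip n r j)) + card (hom_boxes n r) \<le> card D" .
  moreover have "lacing_length (pipe_lacing n r D :: 'k mat list) \<le> (\<Sum>j<n. card (D \<inter> strip n r j))"
    unfolding lacing_length_eq_sum using completion_pipe_lacing(2) by (intro sum_mono) auto
  ultimately show ?thesis by linarith
qed

end

section \<open>A pipe dream for every lacing diagram\<close>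

text \<open>
  Each \<open>q \<in> code_set P b p\<close> accounts for one inversion in row \<open>p\<close> of every permutation that extends
  the partial permutation \<open>P\<close> with \<open>b\<close> columns.
\<close>

definition code_set :: "(nat \<Rightarrow> nat \<Rightarrow> bool) \<Rightarrow> nat \<Rightarrow> nat \<Rightarrow> nat set" where
  "code_set P b p = {q. q < b \<and> (\<forall>p'\<le>p. \<not> P p' q) \<and> (\<forall>q'<b. P p q' \<longrightarrow> q < q')}"

text \<open>The column, counted from the right, in which the pipe from position \<open>x\<close>
  reaches row \<open>p\<close> of the rectangle, as long as no row before \<open>p\<close> has its 1
  in column \<open>x\<close>: each earlier 1 to the left of \<open>x\<close> has moved it one column
  to the right.\<close>

definition free_before :: "(nat \<Rightarrow> nat \<Rightarrow> bool) \<Rightarrow> nat \<Rightarrow> nat \<Rightarrow> nat" where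
  "free_before P p x = card {q. q < x \<and> (\<forall>p'<p. \<not> P p' q)}"

lemma card_code_set_le: "card (code_set P b p) \<le> b"
proof -
  have "card (code_set P b p) \<le> card {..<b}" by (rule card_mono) (auto simp: code_set_def)
  then show ?thesis by simp
qed

text \<open>An element \<open>q\<close> of the code of row \<open>p\<close> yields the inversion of
  position \<open>p + 1\<close> with the position of the value \<open>q + 1\<close>. That value is
  not taken up to row \<open>p\<close>, and \<open>v (p + 1)\<close> exceeds it, being either a 1
  further right or a value beyond the \<open>b\<close> columns. The argument applies to every
  extension, so also to the completion.\<close>

lemma sum_card_code_set_le:
  assumes "extends_partial_perm w v" "\<And>p q. P p q \<longleftrightarrow> w $$ (p, q) = 1"
    and "dim_row w = a" "dim_col w = b"
  shows "(\<Sum>p<a. card (code_set P b p)) \<le> perm_length v"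
proof -
  obtain N where v: "v permutes {1..N}" using assms(1) by (auto simp: extends_partial_perm_def)
  have w: "P p q \<longleftrightarrow> v (p + 1) = q + 1" if "p < a" "q < b" for p q
    using assms that by (auto simp: extends_partial_perm_def)
  have v0: "v 0 = 0" using permutes_not_in[OF v, of 0] by simp
  have inj: "v x = v y \<longleftrightarrow> x = y" for x y using permutes_inj[OF v] by (auto dest: injD)
  have vinv: "v (inv_into UNIV v x) = x" for x using permutes_inverses(1)[OF v] .
  let ?S = "Sigma {..<a} (code_set P b)"
  let ?f = "\<lambda>(p :: nat, q). (p + 1, inv_into UNIV v (q + 1))"
  have fin: "finite (code_set P b p)" for p by (rule finite_subset[of _ "{..<b}"]) (auto simp: code_set_def)
  have "card ?S \<le> card {(i, j). i < j \<and> v j < v i}"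
  proof (rule card_inj_on_le[where f = ?f])
    show "inj_on ?f ?S"
    proof (rule inj_onI)
      fix x y assume eq: "?f x = ?f y"
      obtain p q p' q' where xy: "x = (p, q)" "y = (p', q')" by (cases x, cases y)
      have "inv_into UNIV v (q + 1) = inv_into UNIV v (q' + 1)" using eq by (simp add: xy)
      then have "q + 1 = q' + 1" by (metis vinv)
      then show "x = y" using eq by (simp add: xy)
    qed
    show "?f ` ?S \<subseteq> {(i, j). i < j \<and> v j < v i}"
    proof (rule image_subsetI)
      fix x assume "x \<in> ?S"
      then obtain p q where x: "x = (p, q)" "p < a" "q \<in> code_set P b p" by auto
      then have q: "q < b" "\<And>p'. p' \<le> p \<Longrightarrow> \<not> P p' q" "\<And>q'. q' < b \<Longrightarrow> P p q' \<Longrightarrow> q < q'"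
        by (auto simp: code_set_def)
      define k where "k = inv_into UNIV v (q + 1)"
      have vk: "v k = q + 1" by (simp add: k_def vinv)
      have "p + 1 < k"
      proof (rule ccontr)
        assume "\<not> p + 1 < k"
        moreover have "k \<noteq> 0" using vk v0 by (metis add_is_0 one_neq_zero)
        ultimately obtain p' where p': "k = p' + 1" "p' \<le> p" by (cases k) auto
        then show False using q(2)[OF p'(2)] w[of p' q] x(2) q(1) vk by simp
      qed
      moreover have "q + 1 < v (p + 1)"
      proof -
        have "v (p + 1) \<noteq> 0" using inj[of "p + 1" 0] v0 by simp
        then obtain q' where q': "v (p + 1) = q' + 1" by (cases "v (p + 1)") auto
        then show ?thesis using q(1) q(3)[of q'] w[OF x(2), of q'] by (cases "q' < b") auto
      qed
      ultimately show "?f x \<in> {(i, j). i < j \<and> v j < v i}" using vk by (simp add: x k_def)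
    qed
  qed (rule finite_inversions[OF v])
  then show ?thesis using fin by (simp add: perm_length_def card_SigmaI)
qed

lemma free_before_0: "free_before P 0 x = x"
  by (simp add: free_before_def)

lemma finite_less [simp]: "finite {q. q < (x::nat) \<and> R q}"
  by (rule finite_subset[of _ "{..<x}"]) auto

lemma free_before_le: "free_before P p x \<le> x"
proof -
  have "free_before P p x \<le> card {..<x}" unfolding free_before_def by (rule card_mono) auto
  then show ?thesis by simp
qed

lemma free_before_less:
  assumes "x < y" "\<And>p'. p' < p \<Longrightarrow> \<not> P p' x"
  shows "free_before P p x < free_before P p y"
  unfolding free_before_def using assms by (intro psubset_card_mono) auto

locale partial_perm_rel =
  fixes P :: "nat \<Rightarrow> nat \<Rightarrow> bool" and a b :: nat
  assumes P_fun: "\<And>p q q'. p < a \<Longrightarrow> q < b \<Longrightarrow> q' < b \<Longrightarrow> P p q \<Longrightarrow> P p q' \<Longrightarrow> q = q'"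
    and P_inj: "\<And>p p' q. p < a \<Longrightarrow> p' < a \<Longrightarrow> q < b \<Longrightarrow> P p q \<Longrightarrow> P p' q \<Longrightarrow> p = p'"
begin

lemma card_code_set_hit:
  assumes "p < a" "q < b" "P p q"
  shows "card (code_set P b p) = free_before P p q"
proof -
  have "code_set P b p = {x. x < q \<and> (\<forall>p'<p. \<not> P p' x)}"
  proof (intro equalityI subsetI)
    fix x assume "x \<in> code_set P b p"
    then show "x \<in> {x. x < q \<and> (\<forall>p'<p. \<not> P p' x)}" using assms by (auto simp: code_set_def)
  next
    fix x assume x: "x \<in> {x. x < q \<and> (\<forall>p'<p. \<not> P p' x)}"
    then have "\<not> P p x" using P_fun[OF assms(1,2) _ assms(3), of x] assms(2) by auto
    then have "\<not> P p' x" if "p' \<le> p" for p' using x that by (cases "p' = p") auto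
    moreover have "x < q'" if "q' < b" "P p q'" for q'
      using P_fun[OF assms(1,2) that(1) assms(3) that(2)] x by simp
    ultimately show "x \<in> code_set P b p" using x assms(2) by (auto simp: code_set_def)
  qed
  then show ?thesis by (simp add: free_before_def)
qed

lemma card_code_set_no_hit:
  assumes "\<And>q. q < b \<Longrightarrow> \<not> P p q"
  shows "card (code_set P b p) = free_before P p b"
proof -
  have "code_set P b p = {x. x < b \<and> (\<forall>p'<p. \<not> P p' x)}"
    using assms by (force simp: code_set_def le_less)
  then show ?thesis by (simp add: free_before_def)
qed

text \<open>Either the 1 of row \<open>p\<close> lies to the right of \<open>x\<close> or is absent,
  and the count stays below the code and does not change; or it lies to the left, and the count
  exceeds the code and drops by one. Equality with the code is reserved for the pipe that leaves in
  row \<open>p\<close>.\<close>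

lemma free_before_Suc:
  assumes "p < a" "x < b" "\<And>p'. p' \<le> p \<Longrightarrow> \<not> P p' x"
  shows "free_before P p x < card (code_set P b p) \<and> free_before P (Suc p) x = free_before P p x \<or>
    card (code_set P b p) < free_before P p x \<and> Suc (free_before P (Suc p) x) = free_before P p x"
proof (cases "\<exists>q<b. P p q")
  case True
  then obtain q where q: "q < b" "P p q" by blast
  have unhit: "\<not> P p' q" if "p' < p" for p' using P_inj[OF assms(1) _ q(1,2), of p'] that assms(1) by auto
  have neq: "x \<noteq> q" using assms(3)[of p] q by auto
  note code = card_code_set_hit[OF assms(1) q]
  show ?thesis
  proof (cases "x < q")
    case True
    have "\<not> P p y" if "y < x" for y using P_fun[OF assms(1) q(1) _ q(2), of y] that True assms(2) by auto
    then have "{y. y < x \<and> (\<forall>p'<Suc p. \<not> P p' y)} = {y. y < x \<and> (\<forall>p'<p. \<not> P p' y)}"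
      by (auto simp: less_Suc_eq)
    then show ?thesis using free_before_less[OF True, of p P] assms(3) code by (auto simp: free_before_def)
  next
    case False
    then have qx: "q < x" using neq by simp
    have "\<not> P p y" if "y < x" "y \<noteq> q" for y using P_fun[OF assms(1) q(1) _ q(2), of y] that assms(2) by auto
    then have "{y. y < x \<and> (\<forall>p'<p. \<not> P p' y)} = insert q {y. y < x \<and> (\<forall>p'<Suc p. \<not> P p' y)}"
      using qx unhit q(2) by (auto simp: less_Suc_eq)
    moreover have "q \<notin> {y. y < x \<and> (\<forall>p'<Suc p. \<not> P p' y)}" using q(2) by auto
    ultimately have "free_before P p x = Suc (free_before P (Suc p) x)" by (simp add: free_before_def)
    then show ?thesis using free_before_less[of q x p P, OF qx unhit] code by auto
  qed
next
  case False
  then have "{y. y < x \<and> (\<forall>p'<Suc p. \<not> P p' y)} = {y. y < x \<and> (\<forall>p'<p. \<not> P p' y)}"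
    using assms(2) by (auto simp: less_Suc_eq)
  then show ?thesis using card_code_set_no_hit[of p] False free_before_less[OF assms(2), of p P] assms(3)
    by (auto simp: free_before_def)
qed

end

lemma pipe_east_crossings:
  assumes "pipe D t West (Suc q) p" "\<And>k. k < m \<Longrightarrow> (Suc q, p + k) \<in> D"
  shows "pipe D t West (Suc q) (p + m)"
  using assms(2)
proof (induction m)
  case 0
  then show ?case using assms(1) by simp
next
  case (Suc m)
  then show ?case using pipe.west_cross[of D t q "p + m"] by simp
qed

lemma pipe_staircase:
  assumes "pipe D t West (Suc (q + m)) p" "\<And>q' p'. q < q' \<Longrightarrow> q' \<le> Suc (q + m) \<Longrightarrow> p \<le> p' \<Longrightarrow> (q', p') \<notin> D"
  shows "pipe D t South q (p + m)"
  using assms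
proof (induction m arbitrary: p)
  case 0
  then show ?case using pipe.west_elbow[of D t q p] by simp
next
  case (Suc m)
  have "pipe D t South (Suc (q + m)) p" using pipe.west_elbow[of D t "Suc (q + m)" p] Suc.prems by simp
  then have "pipe D t West (Suc (q + m)) (Suc p)" using pipe.south_elbow[of D t "q + m" p] Suc.prems(2)[of "Suc (q + m)" p] by simp
  from Suc.IH[OF this] Suc.prems(2) show ?case by simp
qed

text \<open>
  The rows of the rectangle are counted from its bottom row \<open>R\<close> and its columns from its rightmost column
  \<open>C\<close>.  Each row has its crossings at the right end: a pipe that enters it from below goes straight up
  if its column is less than the code, leaves the rectangle to the east if its column is the code,
  and otherwise goes up in the next column to the right.
\<close>

locale code_rectangle = partial_perm_rel P a b
  for P a b +
  fixes D :: "(nat \<times> nat) set" and R R' C :: nat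
  assumes R: "R = R' + a" and bC: "b \<le> C"
    and boxes: "\<And>p y. p < a \<Longrightarrow> y < b \<Longrightarrow> (R - p, C - y) \<in> D \<longleftrightarrow> y < card (code_set P b p)"
    and triangle: "\<And>q' p'. R' < q' \<Longrightarrow> q' \<le> R \<Longrightarrow> C < p' \<Longrightarrow> (q', p') \<notin> D"
begin

lemma pipe_unhit:
  assumes "pipe D t South R (C - x)" "x < b" "p \<le> a" "\<And>p'. p' < p \<Longrightarrow> \<not> P p' x"
  shows "pipe D t South (R - p) (C - free_before P p x)"
  using assms(3,4)
proof (induction p)
  case 0
  then show ?case using assms(1) by (simp add: free_before_0)
next
  case (Suc p)
  define y where "y = free_before P p x"
  have p: "p < a" using Suc.prems by simp
  have pos: "pipe D t South (R - p) (C - y)" using Suc by (simp add: y_def)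
  have yb: "y < b" using free_before_le[of P p x] assms(2) by (simp add: y_def)
  obtain q where q: "R - p = Suc q" "R - Suc p = q" using p R by (cases "R - p") auto
  have unhit: "\<not> P p' x" if "p' \<le> p" for p' using Suc.prems that by simp
  consider "y < card (code_set P b p)" "free_before P (Suc p) x = y"
    | "card (code_set P b p) < y" "Suc (free_before P (Suc p) x) = y"
    using free_before_Suc[OF p assms(2) unhit] by (auto simp: y_def)
  then show ?case
  proof cases
    case 1
    then have "(Suc q, C - y) \<in> D" using boxes[OF p yb] q by simp
    then show ?thesis using pos 1 pipe.south_cross[of D t q "C - y"] by (simp add: q)
  next
    case 2
    \<comment> \<open>Both boxes are elbows: the pipe turns east in the first and north in the
      second. The code is less than \<open>y\<close>, so it is at most \<open>z\<close> and leaves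
      the second box uncrossed.\<close>
    define z where "z = free_before P (Suc p) x"
    have z: "y = Suc z" "z < b" "Suc (C - y) = C - z" using 2 yb bC by (auto simp: z_def)
    have "(Suc q, C - y) \<notin> D" "(Suc q, C - z) \<notin> D"
      using boxes[OF p yb] boxes[OF p z(2)] q 2 z(1) by simp_all
    then show ?thesis using pos z pipe.south_elbow[of D t q "C - y"] pipe.west_elbow[of D t q "C - z"]
      by (simp add: q z_def)
  qed
qed

text \<open>In row \<open>p\<close> the pipe arrives at the leftmost column without a crossing to
  its right being missing: it turns there and all \<open>y\<close> boxes further east are crossings,
  so it leaves the rectangle and then zigzags up the triangle of elbows, one column per row.\<close>

lemma pipe_hit:
  assumes "pipe D t South R (C - x)" "x < b" "p < a" "P p x"
  shows "pipe D t South R' (C + a - p)"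
proof -
  define y where "y = free_before P p x"
  have unhit: "\<not> P p' x" if "p' < p" for p' using P_inj[OF assms(3) _ assms(2,4), of p'] that assms(3) by auto
  have pos: "pipe D t South (R - p) (C - y)"
    using pipe_unhit[OF assms(1,2) _ unhit] assms(3) by (simp add: y_def)
  have yb: "y < b" using free_before_le[of P p x] assms(2) by (simp add: y_def)
  have code: "card (code_set P b p) = y" using card_code_set_hit[OF assms(3,2,4)] by (simp add: y_def)
  obtain q where q: "R - p = Suc q" using assms(3) R by (cases "R - p") auto
  have "(Suc q, C - y) \<notin> D" using boxes[OF assms(3) yb] q code by simp
  then have "pipe D t West (Suc q) (Suc (C - y))" using pos pipe.south_elbow[of D t q "C - y"] by (simp add: q)
  moreover have "(Suc q, Suc (C - y) + k) \<in> D" if "k < y" for k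
  proof -
    have e: "Suc (C - y) + k = C - (y - Suc k)" "y - Suc k < b" "y - Suc k < y" using that yb bC by auto
    show ?thesis unfolding e(1) q[symmetric] using boxes[OF assms(3) e(2)] code e(3) by simp
  qed
  ultimately have "pipe D t West (Suc q) (Suc (C - y) + y)" by (rule pipe_east_crossings)
  moreover have "Suc (C - y) + y = Suc C" using yb bC by simp
  \<comment> \<open>The number of rows of the rectangle above row \<open>p\<close>. The final column
    \<open>C + a - p\<close> is the \<open>p\<close>-th from the right end \<open>C + a\<close> of
    the next antidiagonal block.\<close>
  moreover define m where "m = a - Suc p"
  moreover have m: "q = R' + m" "m + Suc p = a" using q R assms(3) by (auto simp: m_def)
  ultimately have "pipe D t West (Suc (R' + m)) (Suc C)" by simp
  from pipe_staircase[OF this] triangle have "pipe D t South R' (Suc C + m)" using R m by simp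
  moreover have "Suc C + m = C + a - p" using m by simp
  ultimately show ?thesis by simp
qed

end

section \<open>Assembling the pipe dream of a lacing diagram\<close>

lemma lacing_diagrams_nth:
  assumes "ws \<in> lacing_diagrams n ds" "j < n"
  shows "ws ! j \<in> carrier_mat (ds j) (ds (Suc j))" "partial_perm_mat (ws ! j)"
  using assms HomD[of ws n ds j] by (auto simp: lacing_diagrams_def Hom_def)

text \<open>The left-justified pipe dream whose row lengths are the Lehmer code, turned by a
  half-turn: row \<open>p\<close> is counted from the bottom, and its crossings fill the right end
  of the row.\<close>

definition lacing_boxes :: "nat \<Rightarrow> (nat \<Rightarrow> nat \<Rightarrow> nat) \<Rightarrow> 'k::field mat list \<Rightarrow> (nat \<times> nat) set" where
  "lacing_boxes n r ws = (\<Union>(j, p)\<in>Sigma {..<n} (\<lambda>j. {..<r j j}).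
     (\<lambda>y. (row_offset r (Suc j) - p, col_end n r (Suc j) - y)) `
       {..<card (code_set (\<lambda>p q. ws ! j $$ (p, q) = 1) (r (Suc j) (Suc j)) p)})"

definition lacing_pipe_dream :: "nat \<Rightarrow> (nat \<Rightarrow> nat \<Rightarrow> nat) \<Rightarrow> 'k::field mat list \<Rightarrow> (nat \<times> nat) set" where
  "lacing_pipe_dream n r ws = hom_boxes n r \<union> lacing_boxes n r ws"

lemma lacing_boxes_iff:
  "(q, c) \<in> lacing_boxes n r ws \<longleftrightarrow> (\<exists>j p y. j < n \<and> p < r j j \<and>
     y < card (code_set (\<lambda>p q. ws ! j $$ (p, q) = 1) (r (Suc j) (Suc j)) p) \<and>
     q = row_offset r (Suc j) - p \<and> c = col_end n r (Suc j) - y)"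
  by (force simp: lacing_boxes_def)

lemma lacing_box_position:
  assumes "j < n" "p < r j j" "y < r (Suc j) (Suc j)"
  shows "row_offset r (Suc j) - p \<in> block_row r j" "col_end n r (Suc j) - y \<in> block_col n r (Suc j)"
  using assms col_end_step[of "Suc j" n r] by (auto simp: block_row_def block_col_def row_offset_Suc)

lemma hom_boxes_bounds:
  assumes "(q, p) \<in> hom_boxes n r"
  shows "1 \<le> q \<and> 1 \<le> p \<and> q + p \<le> total_dim n r"
proof -
  obtain j where j: "j \<le> n" "q \<in> block_row r j" "1 \<le> p" "p \<le> col_end n r (j + 2)"
    using assms by (auto simp: hom_boxes_def)
  then show ?thesis
    using row_offset_plus_col_end[of "Suc j" n r] col_end_antimono[of "Suc j" "j + 2" n r]
    by (auto simp: block_row_def)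
qed

lemma lacing_pipe_dream: "hom_pipe_dream n r (lacing_pipe_dream n r ws)"
proof
  show "pipe_dream (total_dim n r) (lacing_pipe_dream n r ws)"
    unfolding pipe_dream_def
  proof clarify
    fix q c assume "(q, c) \<in> lacing_pipe_dream n r ws"
    then consider "(q, c) \<in> hom_boxes n r" | "(q, c) \<in> lacing_boxes n r ws" by (auto simp: lacing_pipe_dream_def)
    then show "1 \<le> q \<and> 1 \<le> c \<and> q + c \<le> total_dim n r"
    proof cases
      case 1
      then show ?thesis by (rule hom_boxes_bounds)
    next
      case 2
      then obtain j p y where jpy: "j < n" "p < r j j"
        "y < card (code_set (\<lambda>p q. ws ! j $$ (p, q) = 1) (r (Suc j) (Suc j)) p)"
        "q = row_offset r (Suc j) - p" "c = col_end n r (Suc j) - y" unfolding lacing_boxes_iff by blast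
      have "y < r (Suc j) (Suc j)" using jpy(3) card_code_set_le less_le_trans by blast
      from lacing_box_position[of j n p r y, OF jpy(1,2) this] have "1 \<le> q" "1 \<le> c"
        using jpy(4,5) by (auto simp: block_row_def block_col_def)
      then show ?thesis using row_offset_plus_col_end[of "Suc j" n r] jpy by auto
    qed
  qed
qed (simp add: lacing_pipe_dream_def)

lemma lacing_boxes_not_hom:
  assumes "j < n" "q \<in> block_row r j" "c \<in> block_col n r (Suc j)"
  shows "(q, c) \<notin> hom_boxes n r"
  using assms by (auto simp: hom_boxes_def block_col_def dest: block_row_unique)

lemma lacing_pipe_dream_rectangle:
  assumes "j < n" "p < r j j" "y < r (Suc j) (Suc j)"
  shows "(row_offset r (Suc j) - p, col_end n r (Suc j) - y) \<in> lacing_pipe_dream n r ws \<longleftrightarrow>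
    y < card (code_set (\<lambda>p q. ws ! j $$ (p, q) = 1) (r (Suc j) (Suc j)) p)"
proof
  assume "(row_offset r (Suc j) - p, col_end n r (Suc j) - y) \<in> lacing_pipe_dream n r ws"
  then have "(row_offset r (Suc j) - p, col_end n r (Suc j) - y) \<in> lacing_boxes n r ws"
    using lacing_boxes_not_hom[OF assms(1) lacing_box_position[of j n p r y, OF assms]] by (auto simp: lacing_pipe_dream_def)
  then obtain j' p' y' where *: "j' < n" "p' < r j' j'"
    "y' < card (code_set (\<lambda>p q. ws ! j' $$ (p, q) = 1) (r (Suc j') (Suc j')) p')"
    "row_offset r (Suc j) - p = row_offset r (Suc j') - p'" "col_end n r (Suc j) - y = col_end n r (Suc j') - y'"
    unfolding lacing_boxes_iff by blast
  have y': "y' < r (Suc j') (Suc j')" using *(3) card_code_set_le less_le_trans by blast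
  have "j' = j" using lacing_box_position(1)[of j n p r y, OF assms] lacing_box_position(1)[of j' n p' r y', OF *(1,2) y'] *(4)
    block_row_unique by metis
  moreover have "p' = p" using *(2,4) assms(2) \<open>j' = j\<close> by (simp add: row_offset_Suc)
  moreover have "y' = y" using *(5) assms(3) y' \<open>j' = j\<close> col_end_step[of "Suc j" n r] assms(1) by simp
  ultimately show "y < card (code_set (\<lambda>p q. ws ! j $$ (p, q) = 1) (r (Suc j) (Suc j)) p)" using *(3) by simp
next
  assume "y < card (code_set (\<lambda>p q. ws ! j $$ (p, q) = 1) (r (Suc j) (Suc j)) p)"
  then show "(row_offset r (Suc j) - p, col_end n r (Suc j) - y) \<in> lacing_pipe_dream n r ws"
    using assms unfolding lacing_pipe_dream_def Un_iff lacing_boxes_iff by blast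
qed

lemma lacing_pipe_dream_triangle:
  assumes "j \<le> n" "q \<in> block_row r j" "col_end n r (Suc j) < c"
  shows "(q, c) \<notin> lacing_pipe_dream n r ws"
proof
  assume "(q, c) \<in> lacing_pipe_dream n r ws"
  then consider "(q, c) \<in> hom_boxes n r" | "(q, c) \<in> lacing_boxes n r ws" by (auto simp: lacing_pipe_dream_def)
  then show False
  proof cases
    case 1
    then have "c \<le> col_end n r (j + 2)" using assms by (auto simp: hom_boxes_def dest: block_row_unique)
    then show False using assms(3) col_end_antimono[of "Suc j" "j + 2" n r] by simp
  next
    case 2
    then obtain j' p y where *: "j' < n" "p < r j' j'"
      "y < card (code_set (\<lambda>p q. ws ! j' $$ (p, q) = 1) (r (Suc j') (Suc j')) p)"
      "q = row_offset r (Suc j') - p" "c = col_end n r (Suc j') - y" unfolding lacing_boxes_iff by blast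
    have y: "y < r (Suc j') (Suc j')" using *(3) card_code_set_le less_le_trans by blast
    have "j' = j" using lacing_box_position(1)[of j' n p r y, OF *(1,2) y] assms(2) *(4) block_row_unique by metis
    then show False using *(5) assms(3) by simp
  qed
qed

text \<open>An upper bound is all that the comparison of lengths asks for, so union bounds
  suffice.\<close>

lemma card_lacing_pipe_dream_le:
  "card (lacing_pipe_dream n r ws) \<le> card (hom_boxes n r) +
     (\<Sum>j<n. \<Sum>p<r j j. card (code_set (\<lambda>p q. ws ! j $$ (p, q) = 1) (r (Suc j) (Suc j)) p))"
proof -
  let ?c = "\<lambda>(j, p). card (code_set (\<lambda>p q. ws ! j $$ (p, q) = 1) (r (Suc j) (Suc j)) p)"
  have "card (lacing_boxes n r ws) \<le> (\<Sum>x\<in>Sigma {..<n} (\<lambda>j. {..<r j j}).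
      card (case x of (j, p) \<Rightarrow> (\<lambda>y. (row_offset r (Suc j) - p, col_end n r (Suc j) - y)) ` {..<?c (j, p)}))"
    unfolding lacing_boxes_def by (rule order_trans[OF card_UN_le]) (auto intro!: sum_mono)
  also have "\<dots> \<le> (\<Sum>x\<in>Sigma {..<n} (\<lambda>j. {..<r j j}). ?c x)"
  proof (rule sum_mono)
    fix x :: "nat \<times> nat"
    obtain j p where x: "x = (j, p)" by (cases x)
    show "card (case x of (j, p) \<Rightarrow> (\<lambda>y. (row_offset r (Suc j) - p, col_end n r (Suc j) - y)) ` {..<?c (j, p)}) \<le> ?c x"
      unfolding x prod.case by (rule order_trans[OF card_image_le]) simp_all
  qed
  also have "\<dots> = (\<Sum>j<n. \<Sum>p<r j j. ?c (j, p))"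
    by (subst sum.Sigma) (auto simp: case_prod_unfold)
  finally show ?thesis unfolding lacing_pipe_dream_def
    using card_Un_le[of "hom_boxes n r" "lacing_boxes n r ws"] by simp
qed

lemma pipe_lacing_lacing_pipe_dream:
  assumes ws: "ws \<in> lacing_diagrams n (\<lambda>i. r i i)"
  shows "pipe_lacing n r (lacing_pipe_dream n r ws) = (ws :: 'k::field mat list)"
proof (rule nth_equalityI)
  interpret hom_pipe_dream n r "lacing_pipe_dream n r ws" by (rule lacing_pipe_dream)
  let ?D = "lacing_pipe_dream n r ws"
  have len: "length ws = n" using ws by (simp add: lacing_diagrams_def Hom_def)
  then show "length (pipe_lacing n r ?D :: 'k mat list) = length ws" by (simp add: pipe_lacing_def)
  fix j assume "j < length (pipe_lacing n r ?D :: 'k mat list)"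
  then have j: "j < n" by (simp add: pipe_lacing_def del: upt_Suc)
  define P where "P p q \<longleftrightarrow> ws ! j $$ (p, q) = 1" for p q
  let ?a = "r j j" and ?b = "r (Suc j) (Suc j)"
  note w = lacing_diagrams_nth[of ws n "\<lambda>i. r i i", OF ws j]
  have dims: "dim_row (ws ! j) = ?a" "dim_col (ws ! j) = ?b" using w(1) by simp_all
  have Cj: "col_end n r j = ?a + col_end n r (Suc j)" "?b \<le> col_end n r (Suc j)"
    using col_end_step[of j n r] col_end_step[of "Suc j" n r] j by simp_all
  interpret code_rectangle P ?a ?b ?D "row_offset r (Suc j)" "row_offset r j" "col_end n r (Suc j)"
  proof
    show "row_offset r (Suc j) = row_offset r j + ?a" by (rule row_offset_Suc)
    show "?b \<le> col_end n r (Suc j)" by (rule Cj)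
    show "q = q'" if "p < ?a" "q < ?b" "q' < ?b" "P p q" "P p q'" for p q q'
      using w(2) that unfolding partial_perm_mat_def dims P_def by blast
    show "p = p'" if "p < ?a" "p' < ?a" "q < ?b" "P p q" "P p' q" for p p' q
      using w(2) that unfolding partial_perm_mat_def dims P_def by blast
    show "(row_offset r (Suc j) - p, col_end n r (Suc j) - y) \<in> ?D \<longleftrightarrow> y < card (code_set P ?b p)"
      if "p < ?a" "y < ?b" for p y
      using lacing_pipe_dream_rectangle[of j n p r y ws, OF j that] unfolding P_def[abs_def] .
    show "(q', p') \<notin> ?D" if "row_offset r j < q'" "q' \<le> row_offset r (Suc j)" "col_end n r (Suc j) < p'" for q' p'
      using lacing_pipe_dream_triangle[of j n q' r p' ws] that j by (simp add: block_row_def)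
  qed
  have "joined j (Suc j) p x \<longleftrightarrow> P p x" if p: "p < ?a" and x: "x < ?b" for p x
  proof -
    obtain t where t: "t \<in> {1..total_dim n r}" "meets_block_top n r ?D t (Suc j) x"
      using meets_block_top_exists[of "Suc j" x] j x by auto
    then have pos: "pipe ?D t South (row_offset r (Suc j)) (col_end n r (Suc j) - x)"
      by (simp add: meets_block_top_def)
    have hit: "joined j (Suc j) p' x" if "p' < ?a" "P p' x" for p'
    proof -
      have "meets_block_top n r ?D t j p'"
        using pipe_hit[OF pos x that] Cj that(1) by (simp add: meets_block_top_def add.commute)
      then show ?thesis using t by (auto simp: joined_def)
    qed
    show ?thesis
    proof
      assume jn: "joined j (Suc j) p x"
      show "P p x"
      proof (cases "\<exists>p'<?a. P p' x")
        case True
        then obtain p' where p': "p' < ?a" "P p' x" by blast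
        then have "p = p'" using joined_inj[OF jn hit[OF p']] p x j by simp
        then show ?thesis using p' by simp
      next
        \<comment> \<open>Without a 1 in column \<open>x\<close>, the pipe leaves the rectangle
          through its top, hence to the left of the antidiagonal block \<open>j\<close>, and cannot
          be at position \<open>p\<close> of that block.\<close>
        case False
        obtain t' where t': "meets_block_top n r ?D t' j p" "meets_block_top n r ?D t' (Suc j) x"
          using jn by (auto simp: joined_def)
        then have "t' = t" using meets_block_top_pipe_unique t(2) by blast
        then have "pipe ?D t South (row_offset r j) (col_end n r j - p)" using t' by (simp add: meets_block_top_def)
        moreover have "pipe ?D t South (row_offset r j) (col_end n r (Suc j) - free_before P ?a x)"
          using pipe_unhit[OF pos x order_refl] False by (simp add: row_offset_Suc)
        ultimately have "col_end n r j - p = col_end n r (Suc j) - free_before P ?a x" by (rule pipe_level_unique)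
        then show ?thesis using p Cj by linarith
      qed
    qed (use hit p in blast)
  qed
  moreover have "ws ! j $$ (p, q) \<in> {0, 1}" if "p < ?a" "q < ?b" for p q
    using w(2) that unfolding partial_perm_mat_def dims by blast
  ultimately show "pipe_lacing n r ?D ! j = ws ! j"
    unfolding pipe_lacing_nth[OF j] using dims by (intro eq_matI) (force simp: P_def)+
qed

text \<open>Since \<open>ws\<close> is itself the lacing diagram of a pipe dream, each completion is
  known to be an extension, and the code bound applies to it.\<close>

lemma card_lacing_pipe_dream_le_length:
  assumes ws: "ws \<in> lacing_diagrams n (\<lambda>i. r i i)"
  shows "card (lacing_pipe_dream n r (ws :: 'k::field mat list)) \<le> card (hom_boxes n r) + lacing_length ws"
proof -
  interpret hom_pipe_dream n r "lacing_pipe_dream n r ws" by (rule lacing_pipe_dream)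
  note eq = pipe_lacing_lacing_pipe_dream[of ws n r, OF ws]
  have "(\<Sum>p<r j j. card (code_set (\<lambda>p q. ws ! j $$ (p, q) = 1) (r (Suc j) (Suc j)) p)) \<le> perm_length (completion (ws ! j))"
    if j: "j < n" for j
    using completion_pipe_lacing(1)[OF j, where 'k = 'k] lacing_diagrams_nth(1)[of ws n "\<lambda>i. r i i", OF ws j] unfolding eq
    by (intro sum_card_code_set_le) auto
  then have "(\<Sum>j<n. \<Sum>p<r j j. card (code_set (\<lambda>p q. ws ! j $$ (p, q) = 1) (r (Suc j) (Suc j)) p)) \<le>
      (\<Sum>j<n. perm_length (completion (ws ! j)))"
    by (intro sum_mono) auto
  also have "\<dots> = lacing_length ws" using lacing_length_eq_sum[where 'k = 'k] unfolding eq by simp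
  finally show ?thesis using card_lacing_pipe_dream_le[of n r ws] by simp
qed

section \<open>Comparison of lengths and the two inclusions\<close>

lemma zel_ranks_hom_pipe_dream:
  assumes "hom_pipe_dream n r D" "has_rank_array n r (pipe_lacing n r D :: 'k::field mat list)"
  shows "zel_ranks n r (pipe_perm (total_dim n r) D)"
proof -
  interpret hom_pipe_dream n r D by fact
  have "col_end n r (j + 2) < u t" if j: "j \<le> n" and t: "t \<in> block_row r j" for j t
  proof (rule ccontr)
    assume *: "\<not> col_end n r (j + 2) < u t"
    have td: "t \<in> {1..total_dim n r}" using block_row_subset[OF j] t by blast
    then have ut: "1 \<le> u t" using permutes_in_image[OF pipe_perm_permutes[OF pd], of t] by simp
    obtain t' where t': "t = Suc t'" using td by (cases t) auto
    obtain c where c: "pipe D t South t' c" using pipe_level_exists[OF pd, of t' t] t' by auto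
    have "c \<le> u t" using pipe_column_mono[OF c] pipe_perm_exit[OF pd td] by blast
    then have cc: "c \<le> col_end n r (j + 2)" "1 \<le> c" using * pipe_bounds[OF c] by simp_all
    then have "(t, c) \<in> D" using hom j t by (auto simp: hom_boxes_def)
    \<comment> \<open>Row \<open>t\<close> begins with crossings up to
      \<open>col_end n r (j + 2)\<close>, so its pipe runs east past column \<open>c\<close>. It
      cannot also leave the row at the top of that column, as neither state can follow the
      other.\<close>
    have "pipe D t West t (Suc k)" if "k \<le> c" for k
      using that
    proof (induction k)
      case 0
      show ?case using pipe.start[of D t] by simp
    next
      case (Suc k)
      have "(t, Suc k) \<in> hom_boxes n r" using Suc.prems cc j t by (auto simp: hom_boxes_def)
      then have "(t, Suc k) \<in> D" using hom by blast
      then show ?case using Suc pipe.west_cross[of D t t' "Suc k"] unfolding t' by simp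
    qed
    from this[of c] have w: "pipe D t West t (Suc c)" by simp
    have "((West, t, Suc c), (South, t', c)) \<in> (pipe_step D)\<^sup>* \<or> ((South, t', c), (West, t, Suc c)) \<in> (pipe_step D)\<^sup>*"
      using single_valued_confluent[OF single_valued_pipe_step] w c by (simp add: pipe_iff_steps)
    then show False using t' by (auto dest!: steps_mono)
  qed
  then show ?thesis using assms(2) pipe_perm_permutes[OF pd]
    unfolding has_rank_array_pipe_lacing_iff zel_ranks_def by blast
qed

lemma quiver_codim_le_lacing_length:
  assumes "ws \<in> lacing_diagrams n (\<lambda>i. r i i)" "has_rank_array n r (ws :: 'k::field mat list)"
  shows "quiver_codim n r \<le> int (lacing_length ws)"
proof -
  let ?D = "lacing_pipe_dream n r ws"
  interpret hom_pipe_dream n r ?D by (rule lacing_pipe_dream)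
  have "zel_ranks n r u"
    using zel_ranks_hom_pipe_dream[OF lacing_pipe_dream[of n r ws], where 'k = 'k] assms(2)
    unfolding pipe_lacing_lacing_pipe_dream[of ws n r, OF assms(1)] by blast
  from perm_length_zel_ranks(1)[OF this] perm_length_pipe_perm_le[OF pd] card_lacing_pipe_dream_le_length[of ws n r, OF assms(1)]
  show ?thesis by linarith
qed

theorem corollary18:
  fixes n :: nat and r :: "nat \<Rightarrow> nat \<Rightarrow> nat"
  assumes "n \<ge> 1"
    and "can_occur TYPE('k::field) n r"
  shows "(W n r :: 'k mat list set) = W_RP n r"
proof (intro equalityI subsetI)
  let ?d = "total_dim n r"
  fix ws :: "'k mat list" assume "ws \<in> W n r"
  then have ws: "ws \<in> lacing_diagrams n (\<lambda>i. r i i)" "has_rank_array n r ws"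
    and len: "int (lacing_length ws) = quiver_codim n r" by (auto simp: W_def)
  let ?D = "lacing_pipe_dream n r ws"
  interpret hom_pipe_dream n r ?D by (rule lacing_pipe_dream)
  note eq = pipe_lacing_lacing_pipe_dream[of ws n r, OF ws(1)]
  have z: "zel_ranks n r u"
    using zel_ranks_hom_pipe_dream[OF lacing_pipe_dream[of n r ws], where 'k = 'k] ws(2) unfolding eq by blast
  have "perm_length u \<le> card ?D" by (rule perm_length_pipe_perm_le[OF pd])
  moreover have "int (card ?D) \<le> quiver_codim n r + int (card (hom_boxes n r))"
    using card_lacing_pipe_dream_le_length[of ws n r, OF ws(1)] len by linarith
  moreover note perm_length_zel_ranks(1)[OF z]
  \<comment> \<open>Lower bound for the length, length at most number of boxes, and upper bound for
    the boxes close up, so all are equalities.\<close>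
  ultimately have L: "int (perm_length u) = quiver_codim n r + int (card (hom_boxes n r))" "card ?D = perm_length u"
    by linarith+
  then have "is_zelevinsky_perm n r u" using z perm_length_zel_ranks(2)[OF z] is_zelevinsky_perm_iff by blast
  then have "zelevinsky_perm n r = u" by (rule zelevinsky_perm_eqI)
  then have "?D \<in> reduced_pipe_dreams ?d (zelevinsky_perm n r)"
    using reduced_pipe_dreams_iff[OF pipe_perm_permutes[OF pd]] pd L(2) by simp
  then show "ws \<in> W_RP n r" unfolding W_RP_def using eq[symmetric] by blast
next
  let ?d = "total_dim n r"
  fix ws :: "'k mat list" assume "ws \<in> W_RP n r"
  then obtain D where ws: "ws = pipe_lacing n r D" and D: "D \<in> reduced_pipe_dreams ?d (zelevinsky_perm n r)"
    by (auto simp: W_RP_def)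
  \<comment> \<open>Existence turns the definite description into a permutation with the known block
    counts; it is here that \<open>r\<close> is used as the rank array of some matrices.\<close>
  obtain v where v: "is_zelevinsky_perm n r v" using zelevinsky_perm_exists[OF assms(2,1)] by blast
  then have z: "zel_ranks n r v" and m: "block_mono n r v" by (auto simp: is_zelevinsky_perm_iff)
  have vp: "v permutes {1..?d}" using z by (simp add: zel_ranks_def)
  have pd: "pipe_dream ?d D" and u: "pipe_perm ?d D = v" and card: "card D = perm_length v"
    using D reduced_pipe_dreams_iff[OF vp] unfolding zelevinsky_perm_eqI[OF v] by auto
  have "hom_boxes n r \<subseteq> D" using hom_boxes_subset_pipe_dream[OF pd] zel_ranks_row[OF z] unfolding u by blast
  then interpret hom_pipe_dream n r D using pd by unfold_locales
  have rank: "has_rank_array n r ws" unfolding ws has_rank_array_pipe_lacing_iff u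
    using z by (simp add: zel_ranks_def)
  have ld: "ws \<in> lacing_diagrams n (\<lambda>i. r i i)" unfolding ws by (rule pipe_lacing_in_lacing_diagrams)
  have "int (perm_length v) = quiver_codim n r + int (card (hom_boxes n r))"
    using perm_length_zel_ranks(2)[OF z] m by simp
  then have "int (lacing_length ws) \<le> quiver_codim n r"
    \<comment> \<open>The crossings outside \<open>hom_boxes\<close> number
      \<open>quiver_codim n r\<close>. The reverse inequality holds for every lacing diagram with
      rank array \<open>r\<close>.\<close>
    using lacing_length_le[where 'k = 'k] card unfolding ws by linarith
  then have "int (lacing_length ws) = quiver_codim n r"
    using quiver_codim_le_lacing_length[of ws n r, OF ld rank] by linarith
  then show "ws \<in> W n r" using ld rank by (simp add: W_def)
qed

end
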